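(* (Ordered $3k-3$ Theorem.) Let $G$ be an orderable group and let $S$ be a finite subset of $G$ satisfying $|S^2|\le 3|S|-3$. Then $\langle S\rangle$ is abelian and is generated by a set of at most $3$ elements. Moreover, if $|S|\ge 11$, then one of the following holds: (i) $S$ is a subset of a geometric progression of length at most $2|S|-1$; (ii) $S$ is the union of two geometric progressions with the same ratio, the sum of whose lengths equals $|S|$.
   Context: A group $G$ is orderable if there is a total order $\le$ on $G$ such that $a\le b$ implies $xay\le xby$ for all $a,b,x,y\in G$. For a subset $S$ of a group, $S^2=\{x_1x_2 : x_1,x_2\in S\}$, and $\langle S\rangle$ is the subgroup generated by $S$. A geometric progression of length $l$ and ratio $t$ is a set of the form $\{u,ut,\dots,ut^{l-1}\}$ where $u,t$ are commuting elements of $G$ and $l$ is a positive integer. *)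

theory Defs
  imports "HOL-Algebra.Algebra"
begin

definition orderable_group :: "('a, 'b) monoid_scheme \<Rightarrow> bool"
  where "orderable_group G \<longleftrightarrow> group G \<and>
    (\<exists>r. linear_order_on (carrier G) r \<and>
      (\<forall>a\<in>carrier G. \<forall>b\<in>carrier G. \<forall>x\<in>carrier G. \<forall>y\<in>carrier G.
        (a, b) \<in> r \<longrightarrow> (x \<otimes>\<^bsub>G\<^esub> a \<otimes>\<^bsub>G\<^esub> y, x \<otimes>\<^bsub>G\<^esub> b \<otimes>\<^bsub>G\<^esub> y) \<in> r))"

(* The length l counts the exponents 0, ..., l - 1, not the distinct elements: t = 1 is allowed,
   and then the progression is {u} for every l. *)
definition geometric_progression ::
    "('a, 'b) monoid_scheme \<Rightarrow> 'a \<Rightarrow> nat \<Rightarrow> 'a set \<Rightarrow> bool"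
  where "geometric_progression G t l P \<longleftrightarrow>
    t \<in> carrier G \<and> l > 0 \<and>
    (\<exists>u\<in>carrier G. u \<otimes>\<^bsub>G\<^esub> t = t \<otimes>\<^bsub>G\<^esub> u \<and>
      P = (\<lambda>i. u \<otimes>\<^bsub>G\<^esub> t [^]\<^bsub>G\<^esub> i) ` {0..<l})"

end

theory Submission
  imports Defs
begin

text \<open>
  Order the elements of the set and remove the largest one. If it does not commute with the rest, the
  products it contributes are too numerous: the two translates of the rest cannot coincide, because
  conjugation preserves the order and so fixes every finite set that it leaves invariant. Hence
  the generated group is abelian, and it is torsion-free because the group is ordered.

  A finitely generated torsion-free abelian group has homomorphisms to the integers that do not
  vanish on a prescribed finite set of non-identity elements. Avoiding the finitely many elements
  that would witness a coincidence inside an arithmetic configuration, one may replace the set by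
  a set of integers. For integers the structure follows by induction on the size: remove the
  minimum or the maximum; if what remains fits into a short progression in both cases, count sums
  directly, and otherwise the new element is forced to be compatible with the structure of the
  rest. A planar triangle of six points is the only exception, which is why the two alternatives
  need a lower bound on the size.
\<close>

section \<open>Sets of integers with few sums\<close>

text \<open>Two claims about k-element integer sets go through one induction: at most 3k - 3 sums
  give a structured set, at most 3k - 4 a short one. They need each other because a set is often cut
  at a gap between consecutive members x < y into pieces A and B sharing x and y. Only 2x, x + y and
  2y can be sums in both, so a piece with at least 3|A| - 2 sums leaves the other with at most 3|B|
  - 4. The counting device is the walk \<open>balance\<close>, up at members and down elsewhere: a
  net rise over a window makes the sum of its two ends a sum of members, so every missing sum bounds
  the walk.

  The obstacle on the way back to the group is that the ratio t of an integer progression need not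
  be a value of the additive function. It is therefore written as a difference c - b of two members,
  and the relations to be reflected are s = a (b^-1 c)^i with s, a, b, c in the set and bounded i.
  If no two members of a short progression occupy adjacent places, only even indices occur and the
  set is a progression itself, which is then split in two.\<close>

definition sums_of :: "int set \<Rightarrow> int set"
  where "sums_of A = {x + y | x y. x \<in> A \<and> y \<in> A}"

text \<open>The largest index is \<open>2 * card A - 2\<close> because indices start at 0 and the
  length is \<open>2 * card A - 1\<close>.\<close>

definition short :: "int set \<Rightarrow> bool"
  where "short A \<longleftrightarrow> (\<exists>u t. \<forall>x\<in>A. \<exists>i. 0 \<le> i \<and> i \<le> 2 * int (card A) - 2 \<and> x = u + i * t)"

definition prog :: "int \<Rightarrow> int \<Rightarrow> nat \<Rightarrow> int set"
  where "prog t u l = (\<lambda>i. u + int i * t) ` {..<l}"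

text \<open>The condition \<open>l + m = card A\<close> leaves no room for overlap: the two
  progressions are disjoint and neither repeats a value, so \<open>t = 0\<close> is possible only
  with \<open>l = m = 1\<close>.\<close>

definition biprog :: "int set \<Rightarrow> bool"
  where "biprog A \<longleftrightarrow> (\<exists>t u v l m. l > 0 \<and> m > 0 \<and> l + m = card A \<and> A = prog t u l \<union> prog t v m)"

text \<open>Affine image of the lattice points (i, j) with i, j >= 0 and i + j <= 2. These have 15 =
  3 * 6 - 3 formal sums, so a triangle without coincidences attains the bound.\<close>

definition triangle :: "int set \<Rightarrow> bool"
  where "triangle A \<longleftrightarrow> card A = 6 \<and>
    (\<exists>u a b. A = {u, u + a, u + b, u + 2 * a, u + a + b, u + 2 * b})"

text \<open>A walk that rises by 1 at members and falls by 1 elsewhere. Its increase over a window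
  tells whether more than half of the window is filled.\<close>

definition balance :: "int set \<Rightarrow> int \<Rightarrow> int"
  where "balance A x = 2 * int (card (A \<inter> {..x})) - x"

lemma sums_ofI [intro]: "x \<in> A \<Longrightarrow> y \<in> A \<Longrightarrow> x + y \<in> sums_of A"
  by (auto simp: sums_of_def)

lemma sums_ofI': "x \<in> A \<Longrightarrow> y \<in> A \<Longrightarrow> z = x + y \<Longrightarrow> z \<in> sums_of A"
  by (auto simp: sums_of_def)

lemma sums_ofE [elim]:
  assumes "z \<in> sums_of A"
  obtains x y where "x \<in> A" "y \<in> A" "z = x + y"
  using assms by (auto simp: sums_of_def)

lemma sums_of_conv: "sums_of A = (\<lambda>(x, y). x + y) ` (A \<times> A)"
  by (auto simp: sums_of_def)

lemma finite_sums_of [simp, intro]: "finite A \<Longrightarrow> finite (sums_of A)"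
  by (auto simp: sums_of_conv)

lemma sums_of_mono: "A \<subseteq> B \<Longrightarrow> sums_of A \<subseteq> sums_of B"
  by (auto simp: sums_of_def)

lemma sums_of_affine: "sums_of ((\<lambda>x. c + s * x) ` A) = (\<lambda>x. 2 * c + s * x) ` sums_of A"
proof (intro equalityI subsetI)
  fix z assume "z \<in> sums_of ((\<lambda>x. c + s * x) ` A)"
  then obtain x y where "x \<in> A" "y \<in> A" "z = (c + s * x) + (c + s * y)"
    by (auto simp: sums_of_def)
  then have "z = 2 * c + s * (x + y)" "x + y \<in> sums_of A"
    by (auto simp: algebra_simps)
  then show "z \<in> (\<lambda>x. 2 * c + s * x) ` sums_of A" by blast
next
  fix z assume "z \<in> (\<lambda>x. 2 * c + s * x) ` sums_of A"
  then obtain x y where "x \<in> A" "y \<in> A" "z = 2 * c + s * (x + y)"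
    by (auto simp: sums_of_def)
  then have "z = (c + s * x) + (c + s * y)" "c + s * x \<in> (\<lambda>x. c + s * x) ` A"
    "c + s * y \<in> (\<lambda>x. c + s * x) ` A"
    by (auto simp: algebra_simps)
  then show "z \<in> sums_of ((\<lambda>x. c + s * x) ` A)" by blast
qed

lemma inj_affine: "(s::int) \<noteq> 0 \<Longrightarrow> inj_on (\<lambda>x. c + s * x) A"
  by (auto simp: inj_on_def)

lemma card_affine: "(s::int) \<noteq> 0 \<Longrightarrow> card ((\<lambda>x. c + s * x) ` A) = card A"
  by (simp add: card_image inj_affine)

lemma card_sums_of_affine:
  "s \<noteq> 0 \<Longrightarrow> card (sums_of ((\<lambda>x. c + s * x) ` A)) = card (sums_of A)"
  by (simp add: sums_of_affine card_affine)

lemma short_affine: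
  assumes "short A" "s \<noteq> 0"
  shows "short ((\<lambda>x. c + s * x) ` A)"
proof -
  obtain u t where *: "\<forall>x\<in>A. \<exists>i. 0 \<le> i \<and> i \<le> 2 * int (card A) - 2 \<and> x = u + i * t"
    using assms(1) by (auto simp: short_def)
  show ?thesis unfolding short_def card_affine[OF assms(2)]
  proof (rule exI[of _ "c + s * u"], rule exI[of _ "s * t"], rule ballI)
    fix y assume "y \<in> (\<lambda>x. c + s * x) ` A"
    then obtain x where x: "x \<in> A" "y = c + s * x" by auto
    with * obtain i where "0 \<le> i" "i \<le> 2 * int (card A) - 2" "x = u + i * t" by blast
    with x show "\<exists>i. 0 \<le> i \<and> i \<le> 2 * int (card A) - 2 \<and> y = c + s * u + i * (s * t)"
      by (intro exI[of _ i]) (auto simp: algebra_simps)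
  qed
qed

lemma prog_affine: "(\<lambda>x. c + s * x) ` prog t u l = prog (s * t) (c + s * u) l"
  unfolding prog_def image_image by (rule image_cong) (auto simp: algebra_simps)

lemma biprog_affine:
  assumes "biprog A" "s \<noteq> 0"
  shows "biprog ((\<lambda>x. c + s * x) ` A)"
proof -
  obtain t u v l m where "l > 0" "m > 0" "l + m = card A" "A = prog t u l \<union> prog t v m"
    using assms(1) unfolding biprog_def by blast
  then show ?thesis unfolding biprog_def card_affine[OF assms(2)]
    by (intro exI[of _ "s * t"] exI[of _ "c + s * u"] exI[of _ "c + s * v"] exI[of _ l] exI[of _ m])
       (simp add: image_Un prog_affine)
qed

lemma triangle_affine:
  assumes "triangle A" "s \<noteq> 0"
  shows "triangle ((\<lambda>x. c + s * x) ` A)"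
proof -
  obtain u a b where "card A = 6" "A = {u, u + a, u + b, u + 2 * a, u + a + b, u + 2 * b}"
    using assms(1) unfolding triangle_def by blast
  then show ?thesis unfolding triangle_def card_affine[OF assms(2)]
    by (intro conjI exI[of _ "c + s * u"] exI[of _ "s * a"] exI[of _ "s * b"]) (auto simp: algebra_simps)
qed

definition structured :: "int set \<Rightarrow> bool"
  where "structured A \<longleftrightarrow> short A \<or> biprog A \<or> triangle A"

lemma structured_affine: "structured A \<Longrightarrow> s \<noteq> 0 \<Longrightarrow> structured ((\<lambda>x. c + s * x) ` A)"
  unfolding structured_def using short_affine biprog_affine triangle_affine by blast

section \<open>The balance walk and pigeonhole for sums\<close>

lemma balance_step:
  assumes "finite A"
  shows "balance A (x + 1) = balance A x + (if x + 1 \<in> A then 1 else - 1)"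
proof -
  have "A \<inter> {..x + 1} = (if x + 1 \<in> A then insert (x + 1) (A \<inter> {..x}) else A \<inter> {..x})"
    by (auto simp: zle_add1_eq_le order_le_less)
  then show ?thesis using assms by (auto simp: balance_def)
qed

lemma card_window:
  fixes x y :: int
  assumes "finite A" "x \<le> y"
  shows "int (card (A \<inter> {x<..y})) = int (card (A \<inter> {..y})) - int (card (A \<inter> {..x}))"
proof -
  have "A \<inter> {..y} = (A \<inter> {..x}) \<union> (A \<inter> {x<..y})" using assms(2) by auto
  then have "card (A \<inter> {..y}) = card (A \<inter> {..x}) + card (A \<inter> {x<..y})"
    using assms(1) by (simp add: card_Un_disjoint disjoint_iff)
  then show ?thesis by simp
qed

lemma balance_window:
  assumes "finite A" "x \<le> y"
  shows "balance A y - balance A x = 2 * int (card (A \<inter> {x<..y})) - (y - x)"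
  using card_window[OF assms] by (simp add: balance_def)

lemma balance_upper:
  assumes "finite A" "x \<le> y"
  shows "balance A y \<le> balance A x + (y - x)"
proof -
  have "card (A \<inter> {x<..y}) \<le> card {x<..y}" by (rule card_mono) auto
  then have "int (card (A \<inter> {x<..y})) \<le> y - x" using assms(2) by simp
  then show ?thesis using balance_window[OF assms] by linarith
qed

lemma balance_gap:
  assumes "finite A" "x \<le> y" "\<And>z. z \<in> A \<Longrightarrow> x < z \<Longrightarrow> z \<le> y \<Longrightarrow> False"
  shows "balance A y = balance A x - (y - x)"
proof -
  have "A \<inter> {x<..y} = {}" using assms(3) by force
  then show ?thesis using balance_window[OF assms(1,2)] by simp
qed

text \<open>Reflection y -> x + 1 + q - y maps the window x < y <= q to itself. If x + 1 + q were
  not a sum, the members in the window and their mirror images would be disjoint, so at most half of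
  the window would be filled and the walk could not rise. Mostly used in contrapositive
  form.\<close>

lemma sums_of_window:
  assumes "finite A" "x \<le> q" "balance A x < balance A q"
  shows "x + 1 + q \<in> sums_of A"
proof (rule ccontr)
  assume no: "x + 1 + q \<notin> sums_of A"
  let ?W = "A \<inter> {x<..q}" and ?r = "\<lambda>y. x + 1 + q - y"
  have "?W \<inter> ?r ` ?W = {}"
  proof (rule ccontr)
    assume "?W \<inter> ?r ` ?W \<noteq> {}"
    then obtain y z where "y \<in> A" "z \<in> A" "y = x + 1 + q - z" by auto
    then have "x + 1 + q = y + z" "y \<in> A" "z \<in> A" by auto
    then show False using no by (metis sums_ofI)
  qed
  moreover have "card (?r ` ?W) = card ?W" by (rule card_image) (auto simp: inj_on_def)
  ultimately have "card (?W \<union> ?r ` ?W) = 2 * card ?W"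
    using assms(1) by (simp add: card_Un_disjoint)
  moreover have "card (?W \<union> ?r ` ?W) \<le> card {x<..q}" by (rule card_mono) auto
  ultimately have "2 * int (card ?W) \<le> q - x" using assms(2) by simp
  then show False using balance_window[OF assms(1,2)] assms(3) by linarith
qed

text \<open>The pieces share both ends of the gap. A number that is a sum in both is squeezed
  between sums up to \<open>y\<close> and sums from \<open>x\<close> on, which leaves three values.
  Hence |2A| - 3|A| + 3 is superadditive under such cuts: many sums in one piece force few in the
  other.\<close>

lemma card_sums_split:
  assumes "finite A" "x \<in> A" "y \<in> A" "x < y" "\<And>z. z \<in> A \<Longrightarrow> z \<le> x \<or> y \<le> z"
  shows "card (sums_of (A \<inter> {..y})) + card (sums_of (A \<inter> {x..})) \<le> card (sums_of A) + 3"
    and "card (A \<inter> {..y}) + card (A \<inter> {x..}) = card A + 2"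
proof -
  let ?P = "sums_of (A \<inter> {..y})" and ?Q = "sums_of (A \<inter> {x..})"
  have fin: "finite ?P" "finite ?Q" using assms(1) by auto
  have "?P \<inter> ?Q \<subseteq> {2 * x, x + y, 2 * y}"
  proof
    fix z assume "z \<in> ?P \<inter> ?Q"
    then obtain a b c d where "a \<in> A" "b \<in> A" "c \<in> A" "d \<in> A" "a \<le> y" "b \<le> y" "x \<le> c" "x \<le> d"
      "z = a + b" "z = c + d" by (auto simp: sums_of_def)
    moreover have "a \<le> x \<or> a = y" "b \<le> x \<or> b = y" "c = x \<or> y \<le> c" "d = x \<or> y \<le> d"
      using calculation assms(5) by (metis order_antisym)+
    ultimately show "z \<in> {2 * x, x + y, 2 * y}" using assms(4) by auto
  qed
  then have "card (?P \<inter> ?Q) \<le> card {2 * x, x + y, 2 * y}" by (intro card_mono) auto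
  also have "\<dots> \<le> 3" by (simp add: card_insert_if)
  finally have "card (?P \<inter> ?Q) \<le> 3" .
  moreover have "card (?P \<union> ?Q) \<le> card (sums_of A)"
    using assms(1) by (intro card_mono) (auto intro: sums_of_mono[THEN subsetD, rotated])
  moreover have "card ?P + card ?Q = card (?P \<union> ?Q) + card (?P \<inter> ?Q)"
    by (rule card_Un_Int) (use fin in auto)
  ultimately show "card ?P + card ?Q \<le> card (sums_of A) + 3" by linarith
  have "(A \<inter> {..y}) \<union> (A \<inter> {x..}) = A" using assms(4) by auto
  moreover have "(A \<inter> {..y}) \<inter> (A \<inter> {x..}) = {x, y}"
    using assms(2-5) by (auto intro: order_antisym)
  moreover have "card (A \<inter> {..y}) + card (A \<inter> {x..}) =
      card ((A \<inter> {..y}) \<union> (A \<inter> {x..})) + card ((A \<inter> {..y}) \<inter> (A \<inter> {x..}))"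
    by (rule card_Un_Int) (use assms(1) in auto)
  ultimately show "card (A \<inter> {..y}) + card (A \<inter> {x..}) = card A + 2"
    using assms(4) by simp
qed

text \<open>Dividing the distance from the minimum by \<open>d\<close> embeds \<open>V\<close> into
  an interval.\<close>

lemma card_le_of_dvd:
  fixes V :: "int set"
  assumes "finite V" "V \<noteq> {}" "d > 0" "\<And>x. x \<in> V \<Longrightarrow> lo \<le> x \<and> x \<le> hi"
    and "\<And>x y. x \<in> V \<Longrightarrow> y \<in> V \<Longrightarrow> d dvd x - y"
  shows "d * (int (card V) - 1) \<le> Max V - Min V" "Max V - Min V \<le> hi - lo"
proof -
  let ?m = "Min V" and ?M = "Max V"
  have mM: "?m \<in> V" "?M \<in> V" using assms by auto
  have "(\<lambda>x. (x - ?m) div d) ` V \<subseteq> {0..(?M - ?m) div d}"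
  proof safe
    fix x assume "x \<in> V"
    then show "(x - ?m) div d \<in> {0..(?M - ?m) div d}"
      using assms(1,3) by (auto simp: pos_imp_zdiv_nonneg_iff intro!: zdiv_mono1)
  qed
  moreover have "inj_on (\<lambda>x. (x - ?m) div d) V"
  proof (rule inj_onI)
    fix x y assume *: "x \<in> V" "y \<in> V" "(x - ?m) div d = (y - ?m) div d"
    have "d dvd x - ?m" "d dvd y - ?m" using assms(5) * mM by auto
    then show "x = y" using *(3) by (metis diff_add_cancel dvd_div_mult_self)
  qed
  ultimately have "card V \<le> card {0..(?M - ?m) div d}"
    by (metis card_image card_mono finite_atLeastAtMost_int)
  moreover have "?m \<le> ?M" using assms(1) mM by simp
  then have "(?M - ?m) div d \<ge> 0" using assms(3) by (simp add: pos_imp_zdiv_nonneg_iff)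
  ultimately have "int (card V) - 1 \<le> (?M - ?m) div d" by simp
  then have "d * (int (card V) - 1) \<le> d * ((?M - ?m) div d)" using assms(3) by simp
  moreover have "d * ((?M - ?m) div d) \<le> ?M - ?m"
    using assms(3) by (metis mult_div_mod_eq pos_mod_sign le_add_same_cancel1)
  ultimately show "d * (int (card V) - 1) \<le> ?M - ?m" by linarith
  show "?M - ?m \<le> hi - lo" using assms(4)[OF mM(1)] assms(4)[OF mM(2)] by linarith
qed

lemma balance_pred:
  assumes "finite A" "y\<^sub>0 \<in> A" "y\<^sub>0 \<le> x"
  shows "\<exists>y. y \<in> A \<and> y\<^sub>0 \<le> y \<and> y \<le> x \<and> (\<forall>z\<in>A. z \<le> x \<longrightarrow> z \<le> y) \<and>
    balance A x = balance A y - (x - y)"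
proof -
  define y where "y = Max (A \<inter> {..x})"
  have fin: "finite (A \<inter> {..x})" and y0: "y\<^sub>0 \<in> A \<inter> {..x}" using assms by auto
  then have "y \<in> A \<inter> {..x}" unfolding y_def by (metis Max_in empty_iff)
  moreover have ge: "\<And>z. z \<in> A \<Longrightarrow> z \<le> x \<Longrightarrow> z \<le> y" unfolding y_def using fin by simp
  moreover have "balance A x = balance A y - (x - y)"
    by (rule balance_gap) (use assms(1) calculation(1) ge in force)+
  ultimately show ?thesis using y0 by blast
qed

text \<open>Over the gap the walk falls once per step, but the last step onto \<open>y\<close>
  rises; this accounts for the \<open>+ 2\<close>.\<close>

lemma balance_succ:
  assumes "finite A" "y\<^sub>0 \<in> A" "x < y\<^sub>0"
  shows "\<exists>y. y \<in> A \<and> x < y \<and> y \<le> y\<^sub>0 \<and> (\<forall>z\<in>A. x < z \<longrightarrow> y \<le> z) \<and>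
    balance A y = balance A x - (y - x) + 2"
proof -
  define y where "y = Min (A \<inter> {x<..})"
  have fin: "finite (A \<inter> {x<..})" and y0: "y\<^sub>0 \<in> A \<inter> {x<..}" using assms by auto
  then have y: "y \<in> A \<inter> {x<..}" unfolding y_def by (metis Min_in empty_iff)
  have le: "\<And>z. z \<in> A \<Longrightarrow> x < z \<Longrightarrow> y \<le> z" unfolding y_def using fin by simp
  have "balance A (y - 1) = balance A x - (y - 1 - x)"
    by (rule balance_gap) (use assms(1) y le in force)+
  moreover have "balance A y = balance A (y - 1) + 1"
    using balance_step[OF assms(1), of "y - 1"] y by simp
  ultimately have "balance A y = balance A x - (y - x) + 2" by linarith
  then show ?thesis using y le y0 by blast
qed

section \<open>Recognising progressions and unions of two progressions\<close>

lemma card_prog: "t \<noteq> 0 \<Longrightarrow> card (prog t u l) = l"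
  unfolding prog_def by (subst card_image) (auto simp: inj_on_def)

lemma descend:
  fixes x y d :: int
  assumes "0 < d" "\<And>x. x \<in> S \<Longrightarrow> c + d \<le> x \<Longrightarrow> x - d \<in> S"
  shows "x \<in> S \<Longrightarrow> c \<le> y \<Longrightarrow> y \<le> x \<Longrightarrow> d dvd x - y \<Longrightarrow> y \<in> S"
proof (induction "nat (x - y)" arbitrary: x rule: less_induct)
  case less
  show ?case
  proof (cases "x = y")
    case True then show ?thesis using less by simp
  next
    case False
    then have "d \<le> x - y" using less.prems by (intro zdvd_imp_le) auto
    moreover have "d dvd x - d - y"
      using less.prems(4) dvd_diff[OF _ dvd_refl, of d "x - y"] by (simp add: algebra_simps)
    ultimately show ?thesis
      using less.hyps[of "x - d"] assms less.prems by simp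
  qed
qed

lemma ascend:
  fixes x y d :: int
  assumes "0 < d" "\<And>x. x \<in> S \<Longrightarrow> x \<le> c - d \<Longrightarrow> x + d \<in> S"
    and "x \<in> S" "y \<le> c" "x \<le> y" "d dvd x - y"
  shows "y \<in> S"
proof -
  have "- y \<in> uminus ` S"
  proof (rule descend[OF assms(1), where c = "- c" and x = "- x"])
    fix v assume "v \<in> uminus ` S" "- c + d \<le> v"
    then have "- v + d \<in> S" using assms(2)[of "- v"] by auto
    then have "- (- v + d) \<in> uminus ` S" by blast
    then show "v - d \<in> uminus ` S" by simp
  qed (use assms in \<open>auto simp: dvd_diff_commute\<close>)
  then show ?thesis by auto
qed

lemma progI:
  assumes "finite P" "lo \<in> P" "0 < d" "\<And>x. x \<in> P \<Longrightarrow> d dvd x - lo"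
    and "\<And>x. x \<in> P \<Longrightarrow> x \<noteq> lo \<Longrightarrow> x - d \<in> P"
  shows "\<exists>l>0. P = prog d lo l"
proof -
  have ge: "lo \<le> x" if "x \<in> P" for x
  proof (rule ccontr)
    assume "\<not> lo \<le> x"
    \<comment> \<open>Finiteness excludes members below \<open>lo\<close>: the downward steps from
      one would never stop.\<close>
    have "x - int i * d \<in> P" for i :: nat
    proof (induction i)
      case (Suc i)
      have "x - int i * d \<noteq> lo" using \<open>\<not> lo \<le> x\<close> assms(3)
        by (smt (verit) mult_nonneg_nonneg of_nat_0_le_iff)
      then show ?case using assms(5)[OF Suc] by (simp add: algebra_simps)
    qed (use that in simp)
    then have "range (\<lambda>i::nat. x - int i * d) \<subseteq> P" by blast
    moreover have "inj (\<lambda>i::nat. x - int i * d)" using assms(3) by (auto simp: inj_on_def)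
    ultimately show False using assms(1) by (metis finite_imageD infinite_UNIV_nat rev_finite_subset)
  qed
  define M where "M = Max P"
  have MP: "M \<in> P" unfolding M_def using assms(1,2) by (intro Max_in) blast+
  have Mx: "x \<le> M" if "x \<in> P" for x unfolding M_def using assms(1) that by (rule Max_ge)
  have dM: "d dvd M - lo" "0 \<le> M - lo" using assms(4) ge MP by auto
  have Mdiv: "(M - lo) div d * d = M - lo" using dM by simp
  have Mnn: "0 \<le> (M - lo) div d" using dM assms(3) by (simp add: pos_imp_zdiv_nonneg_iff)
  define l where "l = nat ((M - lo) div d) + 1"
  have "P = prog d lo l"
  proof (intro equalityI subsetI)
    fix x assume x: "x \<in> P"
    then obtain i where i: "x - lo = d * i" using assms(4) by blast
    have "0 \<le> d * i" using i ge[OF x] by linarith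
    then have "0 \<le> i" using assms(3) by (simp add: zero_le_mult_iff)
    have "d * i \<le> M - lo" using i Mx[OF x] by linarith
    then have "(d * i) div d \<le> (M - lo) div d" using assms(3) by (intro zdiv_mono1)
    then have "i \<le> (M - lo) div d" using assms(3) by simp
    then have "nat i < l" unfolding l_def using \<open>0 \<le> i\<close> by linarith
    moreover have "x = lo + int (nat i) * d" using i \<open>0 \<le> i\<close> by (simp add: algebra_simps)
    ultimately show "x \<in> prog d lo l" unfolding prog_def by blast
  next
    fix x assume "x \<in> prog d lo l"
    then obtain i where i: "i < l" "x = lo + int i * d" unfolding prog_def by auto
    have "int i \<le> (M - lo) div d" using i(1) Mnn unfolding l_def by linarith
    then have "int i * d \<le> (M - lo) div d * d" using assms(3) by (intro mult_right_mono) simp_all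
    then have "x \<le> M" using Mdiv i(2) by linarith
    moreover have "d dvd (M - lo) - int i * d" by (rule dvd_diff[OF dM(1)]) simp
    then have "d dvd M - x" using i(2) by (simp add: algebra_simps)
    moreover have "v - d \<in> P" if "v \<in> P" "lo + d \<le> v" for v using assms(3,5) that by fastforce
    ultimately show "x \<in> P"
      using descend[OF assms(3), of P lo M x] MP i(2) assms(3) by simp
  qed
  moreover have "l > 0" unfolding l_def by simp
  ultimately show ?thesis by blast
qed

text \<open>Each of the two residue classes modulo \<open>d\<close> contains only one member without
  predecessor, so it is a progression. Incongruence of \<open>p\<close> and \<open>q\<close> makes
  the classes disjoint, and the lengths add up to the size.\<close>

lemma biprogI:
  assumes "finite S" "0 < d" "p \<in> S" "q \<in> S" "\<not> d dvd p - q"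
    and "\<And>x. x \<in> S \<Longrightarrow> d dvd x - p \<or> d dvd x - q"
    and "\<And>x. x \<in> S \<Longrightarrow> x \<noteq> p \<Longrightarrow> x \<noteq> q \<Longrightarrow> x - d \<in> S"
  shows "biprog S"
proof -
  define P where "P = {x \<in> S. d dvd x - p}"
  define Q where "Q = {x \<in> S. d dvd x - q}"
  have shift: "d dvd x - d - y \<longleftrightarrow> d dvd x - y" for x y
    using dvd_add_times_triv_right_iff[of d "x - y" "- 1"] by (simp add: algebra_simps)
  have "\<exists>l>0. P = prog d p l"
  proof (rule progI)
    fix x assume "x \<in> P" "x \<noteq> p"
    then have "x \<in> S" "d dvd x - p" unfolding P_def by auto
    moreover have "x \<noteq> q" using calculation(2) assms(5) by (metis dvd_diff_commute)
    ultimately show "x - d \<in> P" unfolding P_def using assms(7) \<open>x \<noteq> p\<close> shift by auto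
  qed (use assms in \<open>auto simp: P_def\<close>)
  then obtain l where l: "l > 0" "P = prog d p l" by blast
  have "\<exists>l>0. Q = prog d q l"
  proof (rule progI)
    fix x assume "x \<in> Q" "x \<noteq> q"
    then have "x \<in> S" "d dvd x - q" unfolding Q_def by auto
    moreover have "x \<noteq> p" using calculation(2) assms(5) by auto
    ultimately show "x - d \<in> Q" unfolding Q_def using assms(7) \<open>x \<noteq> q\<close> shift by auto
  qed (use assms in \<open>auto simp: Q_def\<close>)
  then obtain m where m: "m > 0" "Q = prog d q m" by blast
  have S: "S = P \<union> Q" unfolding P_def Q_def using assms(6) by auto
  have "P \<inter> Q = {}"
  proof (rule ccontr)
    assume "P \<inter> Q \<noteq> {}"
    then obtain x where "d dvd x - p" "d dvd x - q" unfolding P_def Q_def by auto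
    then have "d dvd (x - q) - (x - p)" by (rule dvd_diff[rotated])
    then show False using assms(5) by simp
  qed
  then have "card S = card P + card Q" using S assms(1) by (metis card_Un_disjoint finite_Un)
  then have "l + m = card S" using l m card_prog assms(2) by simp
  then show ?thesis unfolding biprog_def using l m S by blast
qed

section \<open>Extremal sets with a gap at both ends\<close>

lemma propagation_absurd:
  fixes f :: "int \<Rightarrow> bool" and E :: "int \<Rightarrow> int"
  assumes step: "\<And>x. E (x + 1) = E x + (if f (x + 1) then 1 else - 1)"
    and hyps: "z \<le> w" "f z" "\<not> f (z + 1)" "f (z + 2)" "E z = 2" "E w \<le> 0"
    and back0: "\<And>x. z \<le> x \<Longrightarrow> x < w \<Longrightarrow> \<not> f (x + 1) \<Longrightarrow> E x \<ge> 2 \<Longrightarrow> \<not> f (x - 2)"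
  shows False
proof -
  have E1: "E (z + 1) = 1" and E2: "E (z + 2) = 2"
    using step[of z] step[of "z + 1"] hyps by (simp_all add: add.assoc)
  have "w \<noteq> z" "w \<noteq> z + 1" "w \<noteq> z + 2" using E1 E2 hyps by auto
  then have "z + 2 < w" using hyps(1) by linarith
  \<comment> \<open>Consider the first place \<open>v = z + 2 + y\<close> from \<open>z + 2\<close>
    on where the walk is at most 1. Both \<open>v\<close> and \<open>v - 1\<close> will be
    non-members, and below \<open>v\<close>, where the walk is still high, \<open>back0\<close>
    carries non-membership down in steps of 3.\<close>
  define y where "y = (LEAST i. E (z + 2 + int i) \<le> 1)"
  have ex: "E (z + 2 + int (nat (w - z - 2))) \<le> 1" using \<open>z + 2 < w\<close> hyps by auto
  have Ey: "E (z + 2 + int y) \<le> 1" unfolding y_def by (rule LeastI, rule ex)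
  have yle: "y \<le> nat (w - z - 2)" unfolding y_def by (rule Least_le, rule ex)
  have before: "E (z + 2 + int i) \<ge> 2" if "i < y" for i
    using not_less_Least[of i "\<lambda>i. E (z + 2 + int i) \<le> 1"] that unfolding y_def by force
  have y0: "y > 0" using Ey E2 by (cases y) auto
  define v where "v = z + 2 + int y"
  have v: "z + 2 < v" "v \<le> w" using y0 yle \<open>z + 2 < w\<close> unfolding v_def by auto
  have Ebef: "E x \<ge> 2" if "z + 2 \<le> x" "x < v" for x
    using before[of "nat (x - z - 2)"] that unfolding v_def by auto
  have nv: "\<not> f v" using step[of "v - 1"] Ebef[of "v - 1"] Ey v unfolding v_def[symmetric]
    by (auto split: if_splits)
  have Ev1: "E (v - 1) = 2" using step[of "v - 1"] Ebef[of "v - 1"] Ey v nv unfolding v_def[symmetric]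
    by (auto split: if_splits)
  have bk: "\<not> f (x - 3)" if "\<not> f x" "z + 3 \<le> x" "x \<le> v" for x
    using back0[of "x - 1"] that Ebef[of "x - 1"] v by auto
  have nv1: "\<not> f (v - 1)"
  proof
    assume "f (v - 1)"
    then have "E (v - 2) = 1" using step[of "v - 2"] Ev1 by auto
    then have "v = z + 3" using Ebef[of "v - 2"] v by (cases "z + 2 \<le> v - 2") auto
    then show False using bk[of v] nv hyps by auto
  qed
  have down: "x \<le> v \<Longrightarrow> z \<le> x \<Longrightarrow> \<not> f x \<Longrightarrow> \<exists>y\<in>{z..z+2}. 3 dvd x - y \<and> \<not> f y" for x
  proof (induction "nat (x - z)" arbitrary: x rule: less_induct)
    case less
    show ?case
    proof (cases "x \<le> z + 2")
      case True
      then show ?thesis using less by (intro bexI[of _ x]) auto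
    next
      case False
      then have "\<exists>y\<in>{z..z+2}. 3 dvd (x - 3) - y \<and> \<not> f y"
        using less.hyps[of "x - 3"] less.prems bk[of x] by auto
      then obtain y where y: "y \<in> {z..z+2}" "3 dvd (x - 3) - y" "\<not> f y" by blast
      from y(2) have "3 dvd x - y" by presburger
      with y show ?thesis by blast
    qed
  qed
  have only: "y = z + 1" if "y \<in> {z..z+2}" "\<not> f y" for y
  proof -
    have "y = z \<or> y = z + 1 \<or> y = z + 2" using that(1) by auto
    then show ?thesis using that(2) hyps by auto
  qed
  \<comment> \<open>Among \<open>z\<close>, \<open>z + 1\<close>, \<open>z + 2\<close> only the
    middle one is a non-member, so the two consecutive numbers \<open>v - 1\<close> and
    \<open>v\<close> would both be congruent to it modulo 3.\<close>
  have "3 dvd v - (z + 1)" using down[of v] nv v only by fastforce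
  moreover have "3 dvd v - 1 - (z + 1)" using down[of "v - 1"] nv1 v only by fastforce
  ultimately show False by presburger
qed

text \<open>The equality case of the count in \<open>two_gaps_bound\<close>, where both end gaps are
  3. There \<open>z\<close> is the first member after the lower gap at which the walk is back at 2,
  and \<open>w\<close> the last member up to \<open>m\<close> with value below 2. By
  \<open>c1\<close> and \<open>c2\<close> the two ends of the sumset are copies of parts of
  \<open>S\<close>; \<open>c3\<close> and \<open>c4\<close> name sums that are missing. Together
  they force a period: 3 if \<open>w = z - 1\<close>, and 4 otherwise.\<close>

lemma two_gaps_biprog:
  fixes S :: "int set" and m n w z :: int
  defines "E \<equiv> balance S"
  assumes fin: "finite S" and mem: "0 \<in> S" "3 \<in> S" "m \<in> S" "n \<in> S"
    and n: "n = m + 3"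
    and low: "\<And>x. x \<in> S \<Longrightarrow> x = 0 \<or> 3 \<le> x" and high: "\<And>x. x \<in> S \<Longrightarrow> x = n \<or> x \<le> m"
    and z: "z \<in> S" "z - 1 \<in> S" "z + 1 \<notin> S" "z - 2 \<notin> S" "E z = 2" "4 \<le> z" "z \<le> m"
    and w: "w \<in> S" "w + 1 \<in> S" "w - 1 \<notin> S" "w + 2 \<notin> S" "E w = 1" "w < m" and Em: "E m = 2"
    and zw: "z - 1 \<le> w"
    and zlow: "\<And>x. 1 \<le> x \<Longrightarrow> x < z \<Longrightarrow> E x \<le> 1"
    and whigh: "\<And>x. w \<le> x \<Longrightarrow> x \<le> m \<Longrightarrow> 1 \<le> E x"
    and c1: "\<And>x. x \<in> sums_of S \<Longrightarrow> n + w \<le> x \<Longrightarrow> x - n \<in> S"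
    and c2: "\<And>x. x \<in> sums_of S \<Longrightarrow> x \<le> z \<Longrightarrow> x \<in> S"
    and c3: "\<And>x. z \<le> x \<Longrightarrow> x < w \<Longrightarrow> x + 1 \<notin> S \<Longrightarrow> 2 \<le> E x \<Longrightarrow> n - 2 + x \<notin> sums_of S"
    and c4: "\<And>x. z \<le> x \<Longrightarrow> x < w \<Longrightarrow> x + 1 \<notin> S \<Longrightarrow> E x \<le> 1 \<Longrightarrow> x + 4 \<notin> sums_of S"
  shows "biprog S"
proof -
  have step: "E (x + 1) = E x + (if x + 1 \<in> S then 1 else - 1)" for x
    unfolding E_def by (rule balance_step[OF fin])
  \<comment> \<open>Up to \<open>z\<close> sums are members (\<open>c2\<close>), so 3 may be added
    there. From \<open>w + 3\<close> on, the sum with \<open>m = n - 3\<close> equals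
    \<open>n\<close> plus a member (\<open>c1\<close>), so 3 may be subtracted.\<close>
  have up: "x + 3 \<in> S" if "x \<in> S" "x \<le> z - 3" for x
    using c2[of "3 + x"] that mem(2) by (auto simp: add.commute)
  have dn: "x - 3 \<in> S" if "x \<in> S" "w + 3 \<le> x" for x
  proof -
    have "m + x - n \<in> S" using that mem(3) by (intro c1) (auto simp: n)
    then show ?thesis by (simp add: n)
  qed
  show ?thesis
  proof (cases "w = z - 1")
    case True
    \<comment> \<open>The third residue class modulo 3 contains \<open>z - 2\<close> and
      \<open>w + 2\<close>. Steps of 3 would carry a member of that class to one of these two
      non-members.\<close>
    have cls: "3 dvd x - w \<or> 3 dvd x - z" if "x \<in> S" for x
    proof (rule ccontr)
      assume "\<not> ?thesis"
      then have d: "3 dvd x - (w + 2)" "3 dvd x - (z - 2)" unfolding True by presburger+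
      show False
      proof (cases "x \<le> z")
        case True
        have "x \<le> z - 2" using d \<open>\<not> (3 dvd x - w \<or> 3 dvd x - z)\<close> True \<open>w = z - 1\<close>
          by presburger
        then have "z - 2 \<in> S" using ascend[of 3 S z x "z - 2"] up that d by simp
        then show False using z by simp
      next
        case False
        then have "w + 2 \<le> x" using True by simp
        then have "w + 2 \<in> S" using descend[of 3 S w x "w + 2"] dn that d by simp
        then show False using w by simp
      qed
    qed
    have ex: "\<exists>p\<in>S. 3 dvd p - r \<and> (\<forall>x\<in>S. 3 dvd x - r \<longrightarrow> x \<noteq> p \<longrightarrow> x - 3 \<in> S)"
      if r: "r \<in> S" "w \<le> r" "r \<le> z" for r
    proof -
      define p where "p = Min {x \<in> S. 3 dvd x - r}"
      have finP: "finite {x \<in> S. 3 dvd x - r}" using fin by simp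
      have "r \<in> {x \<in> S. 3 dvd x - r}" using r by simp
      then have "p \<in> {x \<in> S. 3 dvd x - r}" unfolding p_def using finP Min_in by blast
      then have p: "p \<in> S" "3 dvd p - r" by auto
      have pmin: "p \<le> x" if "x \<in> S" "3 dvd x - r" for x
        unfolding p_def using finP that by (intro Min_le) auto
      have "x - 3 \<in> S" if x: "x \<in> S" "3 dvd x - r" "x \<noteq> p" for x
      proof (cases "w + 3 \<le> x")
        case True then show ?thesis using dn x by simp
      next
        case False
        have "p < x" "3 dvd x - p" using pmin[OF x(1,2)] x p(2) by presburger+
        then have "p \<le> x - 3" "3 dvd p - (x - 3)" by presburger+
        then show ?thesis using ascend[of 3 S z p "x - 3"] up p False \<open>w = z - 1\<close> by simp
      qed
      then show ?thesis using p by blast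
    qed
    obtain p where p: "p \<in> S" "3 dvd p - w" "\<forall>x\<in>S. 3 dvd x - w \<longrightarrow> x \<noteq> p \<longrightarrow> x - 3 \<in> S"
      using ex[OF w(1) order.refl] True by auto
    obtain q where q: "q \<in> S" "3 dvd q - z" "\<forall>x\<in>S. 3 dvd x - z \<longrightarrow> x \<noteq> q \<longrightarrow> x - 3 \<in> S"
      using ex[OF z(1) _ order.refl] True by auto
    show ?thesis
    proof (rule biprogI[OF fin, of 3 p q])
      show "\<not> 3 dvd p - q" using p(2) q(2) True by presburger
      fix x assume x: "x \<in> S"
      show "3 dvd x - p \<or> 3 dvd x - q" using cls[OF x] p(2) q(2) by presburger
      assume "x \<noteq> p" "x \<noteq> q"
      then show "x - 3 \<in> S" using cls[OF x] p(3) q(3) x by blast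
    qed (use p q in simp_all)
  next
    case False
    then have "z \<le> w" using zw by simp
    moreover have "w \<noteq> z" using w z by auto
    moreover have "w \<noteq> z + 1" using w z by auto
    ultimately have zw2: "z + 2 \<le> w" by simp
    have Ez1: "E (z + 1) = 1" using step[of z] z by simp
    have Ew1: "E (w - 1) = 0" using step[of "w - 1"] w by simp
    have Ew2: "E (w - 2) = 1" using step[of "w - 2"] w(3) Ew1 by simp
    \<comment> \<open>If \<open>z + 2\<close> were a member, \<open>c3\<close> with the summand
      \<open>n\<close> would provide the backward propagation of non-members that is incompatible
      with the value 0 at \<open>w - 1\<close>.\<close>
    have z2: "z + 2 \<notin> S"
    proof
      assume "z + 2 \<in> S"
      show False
      proof (rule propagation_absurd[of E "\<lambda>x. x \<in> S" z "w - 1"])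
        fix x assume "z \<le> x" "x < w - 1" "x + 1 \<notin> S" "2 \<le> E x"
        then have "n - 2 + x \<notin> sums_of S" using c3 by simp
        then show "x - 2 \<notin> S" using mem(4) by (auto intro: sums_ofI')
      qed (use step z zw2 Ew1 \<open>z + 2 \<in> S\<close> in auto)
    qed
    have Ez2: "E (z + 2) = 0" using step[of "z + 1"] z2 Ez1 by (simp add: add.assoc)
    then have "w \<noteq> z + 2" using w by auto
    then have zw3: "z + 3 \<le> w" using zw2 by simp
    have Em1: "E (m - 1) = 1" using step[of "m - 1"] mem(3) Em by simp
    \<comment> \<open>Otherwise the walk would be at 2 in \<open>m - 2\<close>, and the rise from
      \<open>z + 2\<close> would produce the sum \<open>z + m + 1 = n - 2 + z\<close>, which
      \<open>c3\<close> excludes.\<close>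
    have m1: "m - 1 \<in> S"
    proof (rule ccontr)
      assume "m - 1 \<notin> S"
      then have "E (m - 2) = 2" using step[of "m - 2"] Em1 by simp
      then have "z + 2 + 1 + (m - 2) \<in> sums_of S"
        using Ez2 zw3 w unfolding E_def by (intro sums_of_window[OF fin]) simp_all
      moreover have "n - 2 + z \<notin> sums_of S" using c3[of z] z zw3 by simp
      ultimately show False by (simp add: n algebra_simps)
    qed
    then have "E (m - 2) = 0" using step[of "m - 2"] Em1 by simp
    then have mw: "m = w + 1" using whigh[of "m - 2"] w by force
    have w2: "w - 2 \<notin> S"
    proof
      assume "w - 2 \<in> S"
      \<comment> \<open>Mirror image of the argument for \<open>z + 2\<close>, with \<open>0\<close>
        and \<open>c4\<close> in place of \<open>n\<close> and \<open>c3\<close>. Traversed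
        backwards the walk changes sign, and the constant 2 adjusts its value at \<open>w\<close> to
        the one that \<open>propagation_absurd\<close> expects.\<close>
      show False
      proof (rule propagation_absurd[of "\<lambda>x. 2 - E (- x - 1)" "\<lambda>x. - x \<in> S" "- w" "- (z + 1)"])
        fix x :: int
        have e: "- x - 1 - 1 = - x - 2" "- (x + 1) = - x - 1" "- x - 2 + 1 = - x - 1" by simp_all
        show "2 - E (- (x + 1) - 1) = 2 - E (- x - 1) + (if - (x + 1) \<in> S then 1 else - 1)"
          using step[of "- x - 2", unfolded e(3)] unfolding e(1,2) by linarith
      next
        fix x assume x: "- w \<le> x" "x < - (z + 1)" "- (x + 1) \<notin> S" "2 \<le> 2 - E (- x - 1)"
        have e: "- x - 2 + 1 = - x - 1" "- (x + 1) = - x - 1" by simp_all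
        have nx: "- x - 1 \<notin> S" using x(3) unfolding e(2) .
        then have "E (- x - 2) \<le> 1" using step[of "- x - 2", unfolded e(1)] x(4) by simp
        moreover have "- x - 2 + 1 \<notin> S" unfolding e(1) by (rule nx)
        ultimately have "- x - 2 + 4 \<notin> sums_of S" using x(1,2) by (intro c4) linarith+
        then show "- (x - 2) \<notin> S" using mem(1) by (auto intro: sums_ofI')
      qed (use w z zw3 Ew1 \<open>w - 2 \<in> S\<close> in \<open>auto simp: algebra_simps\<close>)
    qed
    have "E (w - 3) = 2" using step[of "w - 3"] w2 Ew2 by simp
    have "w - 2 + 4 \<notin> sums_of S" using w(3) Ew2 zw3 by (intro c4) simp_all
    moreover have "w - 2 + 4 = w + 2" by simp
    ultimately have no: "w + 2 \<notin> sums_of S" by metis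
    have "S \<inter> {..0} = {0}" using low mem by force
    then have E0: "E 0 = 2" unfolding E_def balance_def by simp
    have "E 2 = 0" using balance_gap[OF fin, of 0 2] low E0 unfolding E_def by force
    then have E3: "E 3 = 1" using step[of 2] mem by simp
    \<comment> \<open>A walk still below 2 at 4 would rise from there to \<open>w - 3\<close> and so
      produce the missing sum \<open>w + 2\<close>. The value 2 at 4 then leaves only
      \<open>z = 4\<close>.\<close>
    have E4: "E 4 \<ge> 2"
    proof (rule ccontr)
      assume "\<not> E 4 \<ge> 2"
      then have "4 + 1 + (w - 3) \<in> sums_of S"
        using \<open>E (w - 3) = 2\<close> zw3 z unfolding E_def by (intro sums_of_window[OF fin]) simp_all
      moreover have "4 + 1 + (w - 3) = w + 2" by simp
      ultimately show False using no by metis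
    qed
    then have S4: "4 \<in> S" using step[of 3] E3 by (auto split: if_splits)
    have z4: "z = 4" using zlow[of 4] E4 z by force
    \<comment> \<open>One period: after a member with value 2 that is followed by a non-member, the
      next four places are out, out, in, in, and the walk is back at 2. The missing sums remove
      \<open>x + 2\<close> and \<open>x + 5\<close>; a window and \<open>c4\<close> supply
      \<open>x + 3\<close> and \<open>x + 4\<close>.\<close>
    have nxt: "x + 1 \<notin> S \<and> x + 2 \<notin> S \<and> x + 3 \<in> S \<and> x + 4 \<in> S \<and> E (x + 4) = 2 \<and> x + 4 \<le> w + 1 \<and>
        (x + 4 < w + 1 \<longrightarrow> x + 5 \<notin> S)"
      if x: "4 \<le> x" "x < w + 1" "E x = 2" "x + 1 \<notin> S" for x
    proof -
      have "x \<noteq> w" using x w by auto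
      then have xw: "x < w" using x by simp
      have "n - 2 + x \<notin> sums_of S" using x xw z4 by (intro c3) simp_all
      moreover have "n - 2 + x = w + 2 + x" by (simp add: n mw)
      ultimately have out: "w + 2 + x \<notin> sums_of S" by metis
      then have x2: "x + 2 \<notin> S" using w(1) sums_ofI'[of "x + 2" S w "w + 2 + x"] by auto
      have Ex1: "E (x + 1) = 1" using step[of x] x by simp
      have Ex2: "E (x + 2) = 0" using step[of "x + 1"] Ex1 x2 by (simp add: add.assoc)
      have "x + 1 \<noteq> w" "x + 2 \<noteq> w" using x x2 w(1) by auto
      then have xw3: "x + 3 \<le> w" using xw by simp
      have st3: "E (x + 3) = (if x + 3 \<in> S then 1 else - 1)" using step[of "x + 2"] Ex2 by (simp add: add.assoc)
      have x3: "x + 3 \<in> S"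
      proof (rule ccontr)
        assume no3: "x + 3 \<notin> S"
        have "x + 3 \<noteq> w" using no3 w(1) by auto
        moreover have "x + 3 \<noteq> w - 1"
        proof
          assume "x + 3 = w - 1"
          then have "E (x + 3) = E (w - 1)" by (rule arg_cong)
          then show False using Ew1 st3 no3 by simp
        qed
        ultimately have "x + 3 + 1 + (w - 2) \<in> sums_of S"
          using st3 no3 Ew2 xw3 unfolding E_def by (intro sums_of_window[OF fin]) simp_all
        moreover have "x + 3 + 1 + (w - 2) = w + 2 + x" by simp
        ultimately show False using out by metis
      qed
      have Ex3: "E (x + 3) = 1" using st3 x3 by simp
      have x4: "x + 4 \<in> S"
      proof (rule ccontr)
        assume no4: "x + 4 \<notin> S"
        have "x + 3 \<noteq> w"
        proof
          assume "x + 3 = w"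
          then have "w + 1 = x + 4" by simp
          then show False using w(2) no4 by metis
        qed
        then have "x + 3 + 4 \<notin> sums_of S" using no4 xw3 Ex3 x z4 by (intro c4) (simp_all add: add.assoc)
        then show False using x3 S4 by blast
      qed
      have "E (x + 4) = 2" using step[of "x + 3"] Ex3 x4 by (simp add: add.assoc)
      moreover have "x + 5 \<notin> S"
      proof -
        have "x + 1 + 4 \<notin> sums_of S" using x2 xw3 Ex1 x z4 by (intro c4) (simp_all add: add.assoc)
        then show ?thesis using mem(1) by (auto intro: sums_ofI')
      qed
      ultimately show ?thesis using x x2 x3 x4 xw3 by simp
    qed
    \<comment> \<open>Invariant of the iteration: the walk is at 2, and up to \<open>x\<close> the
      members from 3 on are exactly the numbers congruent to 0 or 3 modulo 4.\<close>
    define Q where "Q x \<longleftrightarrow> x \<in> S \<and> E x = 2 \<and> x \<le> w + 1 \<and> (x < w + 1 \<longrightarrow> x + 1 \<notin> S) \<and>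
      (\<forall>y\<in>S. 4 \<le> y \<longrightarrow> y \<le> x \<longrightarrow> 4 dvd y \<or> 4 dvd y - 3) \<and>
      (\<forall>y. 3 \<le> y \<longrightarrow> y \<le> x \<longrightarrow> 4 dvd y \<or> 4 dvd y - 3 \<longrightarrow> y \<in> S)" for x
    have "E 4 = 2" using z z4 by simp
    have Q4: "Q 4"
    proof -
      have "y = 3 \<or> y = 4" if "3 \<le> y" "y \<le> 4" for y :: int using that by linarith
      then show ?thesis unfolding Q_def using S4 mem(2) z zw3 z4 \<open>E 4 = 2\<close> by auto
    qed
    have Qstep: "Q (x + 4)" if "Q x" "4 \<le> x" "4 dvd x" "x < w + 1" for x
    proof -
      have N: "x + 1 \<notin> S" "x + 2 \<notin> S" "x + 3 \<in> S" "x + 4 \<in> S" "E (x + 4) = 2" "x + 4 \<le> w + 1"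
        "x + 4 < w + 1 \<longrightarrow> x + 5 \<notin> S"
        using nxt[of x] that unfolding Q_def by blast+
      have split: "y \<le> x \<or> y = x + 1 \<or> y = x + 2 \<or> y = x + 3 \<or> y = x + 4" if "y \<le> x + 4" for y
        using that by linarith
      have "4 dvd y \<or> 4 dvd y - 3" if "y \<in> S" "4 \<le> y" "y \<le> x + 4" for y
        using split[OF that(3)] that(1,2) N \<open>Q x\<close> \<open>4 dvd x\<close> unfolding Q_def by (auto simp: dvd_add_left_iff)
      moreover have "y \<in> S" if "3 \<le> y" "y \<le> x + 4" "4 dvd y \<or> 4 dvd y - 3" for y
      proof -
        have "y \<noteq> x + 1" "y \<noteq> x + 2" using that(3) \<open>4 dvd x\<close> by presburger+
        then show ?thesis using split[OF that(2)] that N \<open>Q x\<close> unfolding Q_def by blast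
      qed
      ultimately show ?thesis unfolding Q_def using N by (simp add: add.assoc)
    qed
    have iter: "4 + 4 * int i \<le> w + 1 \<Longrightarrow> Q (4 + 4 * int i)" for i
    proof (induction i)
      case 0 then show ?case using Q4 by simp
    next
      case (Suc i)
      then have "Q (4 + 4 * int i + 4)" by (intro Qstep) auto
      then show ?case by (simp add: algebra_simps)
    qed
    define i where "i = nat ((w - 3) div 4)"
    have "0 \<le> (w - 3) div 4" using zw3 z4 by (simp add: pos_imp_zdiv_nonneg_iff)
    then have "int i = (w - 3) div 4" unfolding i_def by simp
    then have i: "4 + 4 * int i \<le> w + 1" "w + 1 < 4 + 4 * int i + 4" by linarith+
    have Qi: "Q (4 + 4 * int i)" by (rule iter[OF i(1)])
    have wi: "4 + 4 * int i = w + 1"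
    proof (rule ccontr)
      assume "4 + 4 * int i \<noteq> w + 1"
      then have "Q (4 + 4 * int i + 4)" using Qi i by (intro Qstep) auto
      then show False using i unfolding Q_def by simp
    qed
    have "Q (w + 1)" using Qi wi by simp
    moreover have "4 dvd w + 1" using wi by presburger
    ultimately have Qw: "Q (w + 1)" "4 dvd w + 1" by simp_all
    have cls: "x = 0 \<or> x = w + 4 \<or> (3 \<le> x \<and> x \<le> w + 1 \<and> (4 dvd x \<or> 4 dvd x - 3))" if "x \<in> S" for x
    proof -
      have "x = 0 \<or> x = w + 4 \<or> (3 \<le> x \<and> x \<le> w + 1)" using low[OF that] high[OF that] n mw by auto
      moreover have "4 dvd x \<or> 4 dvd x - 3" if "3 \<le> x" "x \<le> w + 1"
        using that Qw(1) \<open>x \<in> S\<close> unfolding Q_def by (cases "x = 3") auto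
      ultimately show ?thesis by blast
    qed
    \<comment> \<open>The two progressions start at 0 and 3. The top \<open>w + 4\<close> is
      congruent to 3 and steps down to \<open>w\<close>.\<close>
    show ?thesis
    proof (rule biprogI[OF fin, of 4 0 3])
      fix x assume x: "x \<in> S"
      show "4 dvd x - 0 \<or> 4 dvd x - 3" using cls[OF x] Qw(2) by presburger
      assume "x \<noteq> 0" "x \<noteq> 3"
      then have "x = w + 4 \<or> x = 4 \<or> (3 \<le> x - 4 \<and> x \<le> w + 1 \<and> (4 dvd x \<or> 4 dvd x - 3))"
        using cls[OF x] by presburger
      then consider "x = w + 4" | "x = 4" | "3 \<le> x - 4" "x \<le> w + 1" "4 dvd x \<or> 4 dvd x - 3"
        by blast
      then show "x - 4 \<in> S"
      proof cases
        case 3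
        then have "4 dvd x - 4 \<or> 4 dvd x - 4 - 3" by presburger
        then show ?thesis using 3 Qw(1) unfolding Q_def by auto
      qed (use w mem in simp_all)
    qed (use mem in simp_all)
  qed
qed

text \<open>This is the situation where the set is too long, but deleting either end leaves a short
  progression. The ends of the sumset are counted by members of \<open>S\<close>; in the middle the
  missing sums are covered by a set whose size the walk determines, and the total is exactly 3k -
  3.\<close>

lemma two_gaps_bound:
  fixes S :: "int set" and a m n :: int
  defines "k \<equiv> int (card S)" and "E \<equiv> balance S"
  assumes fin: "finite S" and mem: "0 \<in> S" "a \<in> S" "m \<in> S" "n \<in> S"
    and ord: "0 < a" "a \<le> m" "m < n"
    and low: "\<And>x. x \<in> S \<Longrightarrow> x = 0 \<or> a \<le> x" and high: "\<And>x. x \<in> S \<Longrightarrow> x = n \<or> x \<le> m"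
    and n: "n \<ge> 2 * k - 1" and m: "m \<le> 2 * k - 4" and a: "n - a \<le> 2 * k - 4"
  shows "int (card (sums_of S)) \<ge> 3 * k - 3"
    and "int (card (sums_of S)) = 3 * k - 3 \<Longrightarrow> biprog S"
proof -
  define h where "h = E m"
  define g where "g = n - m"
  have step: "E (x + 1) = E x + (if x + 1 \<in> S then 1 else - 1)" for x
    unfolding E_def by (rule balance_step[OF fin])
  have range: "0 \<le> x \<and> x \<le> n" if "x \<in> S" for x using low[OF that] high[OF that] ord by auto
  have cardm: "S \<inter> {..m} = S - {n}" using high ord by auto
  have "card (S - {n}) = card S - 1" using fin mem by simp
  moreover have k1: "card S \<ge> 1" using fin mem by (simp add: Suc_le_eq card_gt_0_iff) blast
  ultimately have h: "h = 2 * (k - 1) - m" unfolding h_def E_def balance_def cardm k_def by simp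
  then have h2: "h \<ge> 2" using m by simp
  have "S \<inter> {..0} = {0}" using range mem by force
  then have E0: "E 0 = 2" unfolding E_def balance_def by simp
  have Elow: "E x = 2 - x" if "0 \<le> x" "x < a" for x
    using balance_gap[OF fin that(1)] low that E0 unfolding E_def by force
  have a3: "a \<ge> 3" using a n by linarith
  have Ea: "E a = 4 - a" using Elow[of "a - 1"] step[of "a - 1"] mem ord by simp
  have gh: "g = 1 + h + (n - 2 * k + 1)" unfolding g_def h by simp
  \<comment> \<open>The walk is at 2 in 0 and falls during the first gap; \<open>z\<close> is the
    first member from \<open>a\<close> on at which it is back at 2.\<close>
  define Z where "Z = {y \<in> S. a \<le> y \<and> E y \<ge> 2}"
  define z where "z = Min Z"
  have "finite Z" "m \<in> Z" unfolding Z_def using fin mem ord h2 h_def by auto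
  then have zZ: "z \<in> Z" and zmin: "\<And>y. y \<in> Z \<Longrightarrow> z \<le> y" and zm: "z \<le> m"
    unfolding z_def by (auto intro: Min_in)
  from zZ have zS: "z \<in> S" "a \<le> z" "E z \<ge> 2" unfolding Z_def by auto
  have "z \<noteq> a" using Ea zS a3 by auto
  then have za: "a < z" using zS by simp
  have zlow: "E x \<le> 1" if "1 \<le> x" "x < z" for x
  proof (cases "x < a")
    case True
    have "E x = 2 - x" by (rule Elow) (use that True in linarith)+
    then show ?thesis using that by linarith
  next
    case False
    then have ax: "a \<le> x" by simp
    obtain y where y: "y \<in> S" "a \<le> y" "y \<le> x" "E x = E y - (x - y)"
      using balance_pred[OF fin mem(2) ax] unfolding E_def by blast
    have "y \<notin> Z" using zmin[of y] y(3) that(2) by linarith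
    then have "E y \<le> 1" using y(1,2) unfolding Z_def by simp
    then show ?thesis using y by linarith
  qed
  have "E z = E (z - 1) + 1" using step[of "z - 1"] zS(1) by simp
  moreover have "E (z - 1) \<le> 1" using za a3 by (intro zlow) simp_all
  ultimately have Ez: "E z = 2" "E (z - 1) = 1" using zS(3) by linarith+
  have az1: "a \<le> z - 1" using za by simp
  obtain y where y: "y \<in> S" "a \<le> y" "y \<le> z - 1" "E (z - 1) = E y - (z - 1 - y)"
    using balance_pred[OF fin mem(2) az1] unfolding E_def by blast
  have "E y \<le> 1" using y(2,3) a3 by (intro zlow) simp_all
  then have "y = z - 1" using y(3,4) Ez by linarith
  then have z1S: "z - 1 \<in> S" using y by simp
  \<comment> \<open>Counterpart of \<open>z\<close> seen from above: after \<open>w\<close> all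
    members up to \<open>m\<close> have value at least 2.\<close>
  define W where "W = {y \<in> S. y \<le> m \<and> E y \<le> 1}"
  define w where "w = Max W"
  have finW: "finite W" unfolding W_def using fin by simp
  have zW: "z - 1 \<in> W" unfolding W_def using z1S zm Ez by simp
  have wW: "w \<in> W" unfolding w_def using finW zW by (intro Max_in) blast+
  have wmax: "y \<le> w" if "y \<in> W" for y unfolding w_def using finW that by (rule Max_ge)
  have zw: "z - 1 \<le> w" by (rule wmax[OF zW])
  from wW have wS: "w \<in> S" "w \<le> m" "E w \<le> 1" unfolding W_def by simp_all
  have "w \<noteq> m" using wS(3) h2 h_def by fastforce
  then have wm: "w < m" using wS(2) by simp
  have wafter: "E y \<ge> 2" if "y \<in> S" "w < y" "y \<le> m" for y
  proof (rule ccontr)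
    assume "\<not> E y \<ge> 2"
    then have "y \<in> W" unfolding W_def using that by simp
    then show False using wmax[of y] that(2) by linarith
  qed
  obtain y where y: "y \<in> S" "w < y" "y \<le> m" "E y = E w - (y - w) + 2"
    using balance_succ[OF fin mem(3) wm] unfolding E_def by blast
  have y1: "y = w + 1" and Ew: "E w = 1" using y(2,4) wafter[OF y(1,2,3)] wS(3) by linarith+
  then have w1S: "w + 1 \<in> S" using y(1) by simp
  have whigh: "E x \<ge> 1" if "w \<le> x" "x \<le> m" for x
  proof (cases "x = m")
    case True then show ?thesis using h2 h_def by simp
  next
    case False
    then have xm: "x < m" using that by simp
    obtain y where y: "y \<in> S" "x < y" "y \<le> m" "E y = E x - (y - x) + 2"
      using balance_succ[OF fin mem(3) xm] unfolding E_def by blast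
    then show ?thesis using wafter[of y] that y by linarith
  qed
  have lip: "E x \<le> E y + (x - y)" if "y \<le> x" for x y unfolding E_def by (rule balance_upper[OF fin that])
  have mw: "m \<ge> w + h - 1" using lip[of w m] wm Ew h_def by linarith
  have z2a: "z \<ge> 2 * a - 2" using lip[of "a - 1" "z - 1"] za Elow[of "a - 1"] ord Ez by auto
  \<comment> \<open>The falls of the walk between \<open>z\<close> and \<open>w\<close>. Each can
    account for one missing sum, so their number enters the count.\<close>
  define D where "D = {x \<in> {z..w - 1}. x + 1 \<notin> S}"
  have finD: "finite D" by (rule finite_subset[of _ "{z..w - 1}"]) (auto simp: D_def)
  define N where "N x = int (card (S \<inter> {..x}))" for x
  have EN: "E x = 2 * N x - x" for x unfolding E_def N_def balance_def by simp
  have cardD: "int (card D) = N w - N z + 1"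
  proof (cases "z \<le> w")
    case True
    have "bij_betw (\<lambda>x. x + 1) D ({z<..w} - S)"
      unfolding D_def by (rule bij_betwI[of _ _ _ "\<lambda>x. x - 1"]) auto
    then have "card D = card ({z<..w} - S)" by (rule bij_betw_same_card)
    moreover have "card ({z<..w} - S) = card {z<..w} - card ({z<..w} \<inter> S)" by (rule card_Diff_subset_Int) auto
    moreover have "card ({z<..w} \<inter> S) \<le> card {z<..w}" by (rule card_mono) auto
    ultimately have "int (card D) = (w - z) - int (card (S \<inter> {z<..w}))"
      using True by (simp add: Int_commute)
    moreover have "int (card (S \<inter> {z<..w})) = N w - N z" unfolding N_def by (rule card_window[OF fin True])
    ultimately show ?thesis using EN[of w] EN[of z] Ew Ez by linarith
  next
    case False
    then have "w = z - 1" using zw by simp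
    moreover from this have "D = {}" unfolding D_def by auto
    ultimately show ?thesis using EN[of w] EN[of z] Ew Ez by simp
  qed
  define M where "M = {c \<in> {z<..<n + w}. c \<notin> sums_of S}"
  \<comment> \<open>Places that may be missing: \<open>U\<close> is the allowance caused by the top
    gap, and \<open>f\<close> sends a fall to a possible missing sum, taken relative to
    \<open>m\<close> where the walk is high and relative to \<open>a\<close> where it is
    low.\<close>
  define U where "U = (\<lambda>x. m + 1 + x) ` {w + h - 1..w + g - 2}"
  define f where "f x = (if E x \<ge> 2 then m + 1 + x else a + x + 1)" for x
  have finM: "finite M" by (rule finite_subset[of _ "{z<..<n + w}"]) (auto simp: M_def)
  \<comment> \<open>A missing \<open>c\<close> of at least \<open>m + 2\<close> is written as
    \<open>m + 1 + x\<close>; the window from \<open>x\<close> to \<open>m\<close> forces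
    \<open>E x >= h\<close> unless \<open>x > m\<close>, and \<open>x + 1\<close> is a non-member. A
    smaller \<open>c\<close> is written as \<open>a + x\<close>; the window starting at
    \<open>a - 1\<close> forces \<open>E x <= 3 - a\<close>, and \<open>x\<close> is a
    non-member.\<close>
  have Mcov: "M \<subseteq> insert (z + 1) (U \<union> f ` D)"
  proof
    fix c assume "c \<in> M"
    then have c: "z < c" "c < n + w" "c \<notin> sums_of S" unfolding M_def by auto
    show "c \<in> insert (z + 1) (U \<union> f ` D)"
    proof (cases "m + 2 \<le> c")
      case True
      define x where "x = c - m - 1"
      have x: "1 \<le> x" "x \<le> w + g - 2" "c = m + 1 + x" using True c unfolding x_def g_def by auto
      have hx: "E x \<ge> h \<or> x > m"
        using sums_of_window[OF fin, of x m] c(3) x(3) unfolding h_def E_def by (force simp: algebra_simps)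
      have "x + 1 \<notin> S" using c(3) x(3) mem(3) by (auto intro: sums_ofI' simp: algebra_simps)
      show ?thesis
      proof (cases "x < w")
        case True
        then have "z \<le> x" using zlow[of x] hx x wm h2 by (cases "x < z") auto
        then have "x \<in> D" unfolding D_def using True \<open>x + 1 \<notin> S\<close> by simp
        moreover have "f x = c" unfolding f_def using hx h2 x True wm by auto
        ultimately show ?thesis by blast
      next
        case False
        then have "x \<ge> w + h - 1" using hx mw lip[of w x] Ew by auto
        then show ?thesis using x unfolding U_def by auto
      qed
    next
      case False
      define x where "x = c - a"
      have x: "z + 1 - a \<le> x" "c = a + x" "x \<le> m + 1 - a" using c False unfolding x_def by auto
      have xa: "x \<ge> a - 1" using x z2a by linarith
      have hx: "E x \<le> 3 - a"
        using sums_of_window[OF fin, of "a - 1" x] c(3) x(2) xa Elow[of "a - 1"] ord unfolding E_def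
        by (force simp: algebra_simps)
      have xS: "x \<notin> S" using c(3) x(2) mem(2) by (auto intro: sums_ofI' simp: algebra_simps)
      show ?thesis
      proof (cases "x < z")
        case True
        then have "x \<le> z + 1 - a" using hx lip[of x "z - 1"] Ez by auto
        then show ?thesis using x by auto
      next
        case False
        have "x < w" using whigh[of x] hx x a3 by (cases "x < w") auto
        moreover have "x \<noteq> z" using xS zS by auto
        ultimately have "x - 1 \<in> D" unfolding D_def using False xS by auto
        moreover have "E (x - 1) \<le> 1" using step[of "x - 1"] xS hx a3 by auto
        then have "f (x - 1) = c" unfolding f_def using x by auto
        ultimately show ?thesis by blast
      qed
    qed
  qed
  have finU: "finite U" unfolding U_def by simp
  have "card U = card {w + h - 1..w + g - 2}" unfolding U_def by (rule card_image) (auto simp: inj_on_def)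
  then have cardU: "int (card U) = g - h" using gh n by simp
  have cov1: "card (insert (z + 1) (U \<union> f ` D)) \<le> Suc (card (U \<union> f ` D))" by (rule card_insert_le_m1) auto
  have cov2: "card (U \<union> f ` D) \<le> card U + card (f ` D)" by (rule card_Un_le)
  have cov3: "card (f ` D) \<le> card D" by (rule card_image_le[OF finD])
  have cov: "int (card (insert (z + 1) (U \<union> f ` D))) \<le> 1 + (g - h) + int (card D)"
    using cov1 cov2 cov3 cardU by linarith
  have cardM: "card M \<le> card (insert (z + 1) (U \<union> f ` D))"
    by (rule card_mono[OF _ Mcov]) (use finU finD in auto)
  \<comment> \<open>Three disjoint families of sums: 0 plus the members up to \<open>z\<close>, the
    middle interval without \<open>M\<close>, and \<open>n\<close> plus the members from
    \<open>w\<close> on.\<close>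
  define L1 where "L1 = S \<inter> {..z}"
  define L2 where "L2 = {z<..<n + w} - M"
  define L3 where "L3 = (\<lambda>y. n + y) ` (S \<inter> {w..})"
  have L1: "int (card L1) = N z" unfolding L1_def N_def by simp
  have MM: "M \<subseteq> {z<..<n + w}" unfolding M_def by auto
  have "card L2 = card {z<..<n + w} - card M"
    unfolding L2_def by (rule card_Diff_subset[OF finM MM])
  moreover have "card M \<le> card {z<..<n + w}" by (rule card_mono[OF _ MM]) simp
  ultimately have "int (card L2) = int (card {z<..<n + w}) - int (card M)" by simp
  moreover have "z < n + w" using zm ord wS range[OF wS(1)] by linarith
  ultimately have L2: "int (card L2) = n + w - 1 - z - int (card M)" by simp
  have "card L3 = card (S \<inter> {w..})" unfolding L3_def by (rule card_image) (auto simp: inj_on_def)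
  moreover have "S = (S \<inter> {..w}) \<union> (S \<inter> {w..})" "(S \<inter> {..w}) \<inter> (S \<inter> {w..}) = {w}" using wS by auto
  then have "card (S \<inter> {..w}) + card (S \<inter> {w..}) = card S + 1"
    using card_Un_Int[of "S \<inter> {..w}" "S \<inter> {w..}"] fin by simp
  ultimately have L3: "int (card L3) = k - N w + 1" unfolding N_def k_def by linarith
  have disj: "L1 \<inter> L2 = {}" "(L1 \<union> L2) \<inter> L3 = {}"
    unfolding L1_def L2_def L3_def using \<open>z < n + w\<close> by auto
  have finL: "finite L1" "finite L2" "finite L3" unfolding L1_def L2_def L3_def using fin by auto
  have sub: "L1 \<union> L2 \<union> L3 \<subseteq> sums_of S"
  proof -
    have "L1 \<subseteq> sums_of S" unfolding L1_def using mem(1) by (auto intro: sums_ofI'[of 0])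
    moreover have "L2 \<subseteq> sums_of S" unfolding L2_def M_def by auto
    moreover have "L3 \<subseteq> sums_of S" unfolding L3_def using mem(4) by auto
    ultimately show ?thesis by blast
  qed
  have cardL: "int (card (L1 \<union> L2 \<union> L3)) = N z + (n + w - 1 - z - int (card M)) + (k - N w + 1)"
    using L1 L2 L3 disj finL by (simp add: card_Un_disjoint)
  have cardS: "card (L1 \<union> L2 \<union> L3) \<le> card (sums_of S)" by (rule card_mono[OF _ sub]) (use fin in auto)
  \<comment> \<open>The values 1 and 2 of the walk at \<open>w\<close> and \<open>z\<close> convert
    positions into counts; all unknowns cancel and 3k - 3 remains.\<close>
  have wN: "w = 2 * N w - 1" "z = 2 * N z - 2" using EN[of w] EN[of z] Ew Ez by auto
  show main: "int (card (sums_of S)) \<ge> 3 * k - 3"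
    using cardL cardS cardM cov cardD wN gh by linarith
  assume eq: "int (card (sums_of S)) = 3 * k - 3"
  \<comment> \<open>Equality leaves no slack: the three families make up the whole sumset, and every
    place of the cover is really missing.\<close>
  have "card (L1 \<union> L2 \<union> L3) = card (sums_of S)" "card M = card (insert (z + 1) (U \<union> f ` D))"
    using cardL cardS cardM cov cardD wN gh eq by linarith+
  then have Seq: "L1 \<union> L2 \<union> L3 = sums_of S" and Meq: "M = insert (z + 1) (U \<union> f ` D)"
    using card_subset_eq[OF _ sub] card_subset_eq[OF _ Mcov] fin finU finD by auto
  have z1: "z + 1 \<notin> sums_of S" using Meq unfolding M_def by auto
  have w1: "n + w - 1 \<notin> sums_of S"
  proof -
    have "m + 1 + (w + g - 2) \<in> U" unfolding U_def using gh n by (intro imageI) simp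
    then have "n + w - 1 \<in> M" unfolding Meq g_def by (simp add: algebra_simps)
    then show ?thesis unfolding M_def by simp
  qed
  have z1S': "z + 1 \<notin> S" using z1 mem(1) by (auto intro: sums_ofI'[of 0])
  have w1S': "w - 1 \<notin> S" using w1 mem(4) by (auto intro: sums_ofI'[of n])
  have Dout: "f x \<notin> sums_of S" if "x \<in> D" for x
    using that Meq unfolding M_def by auto
  have za1: "z + 1 - a \<ge> a - 1" using z2a by simp
  have hz: "E (z + 1 - a) \<le> 3 - a"
    using sums_of_window[OF fin, of "a - 1" "z + 1 - a"] z1 za1 Elow[of "a - 1"] ord unfolding E_def
    by (force simp: algebra_simps)
  \<comment> \<open>Now that \<open>z + 1\<close>, all of \<open>U\<close> and the image of
    \<open>D\<close> are known to be missing, windows bound the walk near \<open>z\<close> and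
    \<open>w\<close> from the other side, which excludes \<open>a > 3\<close> and
    \<open>h > 2\<close>. With \<open>n = 2k - 1\<close> the top gap is then 3 as well.\<close>
  have ha: "a = 3 \<and> h = 2"
  proof (cases "w = z - 1")
    case True
    have "z - 2 \<notin> S" using w1S' True by simp
    then have "E (z - 2) = E (z - 3) - 1" using step[of "z - 3"] by simp
    moreover have "E (z - 1) = E (z - 2) + 1" using step[of "z - 2"] z1S by simp
    ultimately have Ez3: "E (z - 3) = 1" using Ez by linarith
    have "\<not> a \<ge> 4"
    proof
      assume "a \<ge> 4"
      then have "E (z - 3) \<le> E (z + 1 - a) + (a - 4)" using lip[of "z + 1 - a" "z - 3"] by simp
      then show False using Ez3 hz by linarith
    qed
    then have "a = 3" using a3 by simp
    moreover have "h \<le> 2"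
    proof (rule ccontr)
      assume "\<not> h \<le> 2"
      have "m + 1 + (w + h - 1) \<in> U" unfolding U_def using gh n by (intro imageI) simp
      then have no: "m + w + h \<notin> sums_of S" using Meq unfolding M_def by (auto simp: algebra_simps)
      have "E (w + h - 1) \<ge> h"
        using sums_of_window[OF fin, of "w + h - 1" m] no mw unfolding h_def E_def
        by (force simp: algebra_simps)
      moreover have "E (w + 2) \<le> 1" using step[of "w + 1"] step[of w] w1S Ew z1S' True by (auto simp: algebra_simps)
      then have "E (w + h - 1) \<le> 1 + (h - 3)" using lip[of "w + 2" "w + h - 1"] \<open>\<not> h \<le> 2\<close> by auto
      ultimately show False by simp
    qed
    ultimately show ?thesis using h2 by simp
  next
    case False
    then have zw': "z \<le> w" using zw by simp
    moreover have "w \<noteq> z" using Ez Ew by auto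
    ultimately have zw'': "z < w" by simp
    then have zD: "z \<in> D" unfolding D_def using z1S' by simp
    have "m + 1 + z \<notin> sums_of S" using Dout[OF zD] Ez unfolding f_def by simp
    then have "h \<le> 2"
      using sums_of_window[OF fin, of z m] zm Ez unfolding h_def E_def by (force simp: algebra_simps)
    moreover have Ew1: "E (w - 1) = 0" using step[of "w - 1"] wS Ew by simp
    then have Ew2: "E (w - 2) = 1" using step[of "w - 2"] w1S' by simp
    have "w - 1 \<noteq> z" using Ew1 Ez by auto
    then have wD: "w - 2 \<in> D" unfolding D_def using zw'' w1S' by auto
    have out: "a + (w - 1) \<notin> sums_of S" using Dout[OF wD] Ew2 unfolding f_def by (simp add: algebra_simps)
    have "E (w - 1) \<le> 3 - a"
      using sums_of_window[OF fin, of "a - 1" "w - 1"] out za zw'' Elow[of "a - 1"] ord unfolding E_def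
      by (force simp: algebra_simps)
    ultimately show ?thesis using Ew1 a3 h2 by simp
  qed
  then have a3': "a = 3" and h2': "h = 2" by auto
  have nk: "n = 2 * k - 1" using a n a3' by linarith
  have g3: "g = 3" using gh h2' nk by simp
  have nm: "n = m + 3" using g3 unfolding g_def by simp
  have w2: "w + 2 \<notin> S"
  proof -
    have "n + w - 1 = m + (w + 2)" using nm by simp
    then show ?thesis using w1 mem(3) by (metis sums_ofI)
  qed
  have z2: "z - 2 \<notin> S"
  proof -
    have "z + 1 = a + (z - 2)" using a3' by simp
    then show ?thesis using z1 mem(2) by (metis sums_ofI)
  qed
  have c1: "x - n \<in> S" if "x \<in> sums_of S" "n + w \<le> x" for x
    using that \<open>z < n + w\<close> unfolding Seq[symmetric] L1_def L2_def L3_def by auto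
  have c2: "x \<in> S" if "x \<in> sums_of S" "x \<le> z" for x
    using that \<open>z < n + w\<close> unfolding Seq[symmetric] L1_def L2_def L3_def by auto
  have c3: "n - 2 + x \<notin> sums_of S" if "z \<le> x" "x < w" "x + 1 \<notin> S" "2 \<le> E x" for x
    using Dout[of x] that nm unfolding D_def f_def by (auto simp: algebra_simps)
  have c4: "x + 4 \<notin> sums_of S" if "z \<le> x" "x < w" "x + 1 \<notin> S" "E x \<le> 1" for x
    using Dout[of x] that a3' unfolding D_def f_def by (auto simp: algebra_simps)
  show "biprog S"
  proof (rule two_gaps_biprog[OF fin, of m n z w, folded E_def])
    show "3 \<in> S" using mem(2) a3' by simp
    show "x = 0 \<or> 3 \<le> x" if "x \<in> S" for x using low[OF that] a3' by simp
    show "x = n \<or> x \<le> m" if "x \<in> S" for x by (rule high[OF that])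
    show "4 \<le> z" using z2a a3' by simp
    show "E m = 2" using h2' h_def by simp
  qed (fact mem nm zS z1S z1S' z2 Ez zm wS w1S w1S' w2 Ew wm zw zlow whigh c1 c2 c3 c4)+
qed

section \<open>Sets built additively from 0 and 1\<close>

definition good_below :: "nat \<Rightarrow> bool"
  where "good_below K \<longleftrightarrow> (\<forall>B. finite B \<longrightarrow> 2 \<le> card B \<longrightarrow> card B < K \<longrightarrow>
    (card (sums_of B) + 3 \<le> 3 * card B \<longrightarrow> structured B) \<and>
    (card (sums_of B) + 4 \<le> 3 * card B \<longrightarrow> short B))"

text \<open>Normal form of a set with minimum 0 in which only the smallest positive member is not a
  sum of two positive ones; division by that member turns it into 1. Prefixes inherit the property,
  so induction along the set is possible.\<close>

definition chain :: "int set \<Rightarrow> bool"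
  where "chain A \<longleftrightarrow> finite A \<and> 0 \<in> A \<and> 1 \<in> A \<and> (\<forall>x\<in>A. 0 \<le> x) \<and>
    (\<forall>x\<in>A. 1 < x \<longrightarrow> x \<in> sums_of (A - {0}))"

lemma chain_prefix:
  assumes "chain A" "1 \<le> y"
  shows "chain (A \<inter> {..y})"
proof -
  have "x \<in> sums_of (A \<inter> {..y} - {0})" if "x \<in> A" "x \<le> y" "1 < x" for x
  proof -
    have "x \<in> sums_of (A - {0})" using assms(1) that unfolding chain_def by blast
    then obtain p q where "p \<in> A - {0}" "q \<in> A - {0}" "x = p + q" by (rule sums_ofE)
    then have pq: "p \<in> A" "p \<noteq> 0" "q \<in> A" "q \<noteq> 0" "x = p + q" by simp_all
    moreover have "0 \<le> p" "0 \<le> q" using pq assms(1) unfolding chain_def by auto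
    ultimately show ?thesis using that by (intro sums_ofI'[of p _ q]) auto
  qed
  then show ?thesis using assms unfolding chain_def by auto
qed

lemma shortE:
  assumes "short B" "x\<^sub>0 \<in> B" "y\<^sub>0 \<in> B" "x\<^sub>0 \<noteq> y\<^sub>0"
  obtains d where "0 < d" "\<And>x y. x \<in> B \<Longrightarrow> y \<in> B \<Longrightarrow> d dvd x - y"
    "\<And>x y. x \<in> B \<Longrightarrow> y \<in> B \<Longrightarrow> x - y \<le> d * (2 * int (card B) - 2)"
proof -
  obtain u t where ut: "\<And>x. x \<in> B \<Longrightarrow> \<exists>i. 0 \<le> i \<and> i \<le> 2 * int (card B) - 2 \<and> x = u + i * t"
    using assms(1) unfolding short_def by blast
  have "t \<noteq> 0" using ut[OF assms(2)] ut[OF assms(3)] assms(4) by auto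
  show thesis
  proof
    show "0 < \<bar>t\<bar>" using \<open>t \<noteq> 0\<close> by simp
    fix x y assume "x \<in> B" "y \<in> B"
    then obtain i j where ij: "0 \<le> i" "i \<le> 2 * int (card B) - 2" "x = u + i * t"
      "0 \<le> j" "j \<le> 2 * int (card B) - 2" "y = u + j * t" using ut by blast
    have e: "x - y = (i - j) * t" using ij by (simp add: algebra_simps)
    show "\<bar>t\<bar> dvd x - y" unfolding e by simp
    have "(i - j) * t \<le> \<bar>(i - j) * t\<bar>" by (rule abs_ge_self)
    also have "\<dots> = \<bar>i - j\<bar> * \<bar>t\<bar>" by (rule abs_mult)
    finally have "x - y \<le> \<bar>i - j\<bar> * \<bar>t\<bar>" unfolding e .
    moreover have "\<bar>i - j\<bar> * \<bar>t\<bar> \<le> (2 * int (card B) - 2) * \<bar>t\<bar>"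
      using ij by (intro mult_right_mono) auto
    ultimately show "x - y \<le> \<bar>t\<bar> * (2 * int (card B) - 2)" by (simp add: mult.commute)
  qed
qed

text \<open>Within each class the spacing is at least 4. If both classes occur, their minima differ
  and so do their maxima, which costs 2 in the sum of the two spans, hence the \<open>- 1\<close>
  after halving. Equality forces the maxima to be \<open>hi\<close> and
  \<open>hi - 1\<close>.\<close>

lemma two_class_bound:
  fixes V :: "int set"
  assumes "finite V" "2 \<le> card V" "4 \<le> d" "\<And>x. x \<in> V \<Longrightarrow> lo \<le> x \<and> x \<le> hi"
    and "\<And>x. x \<in> V \<Longrightarrow> d dvd x - p \<or> d dvd x - q"
  shows "2 * (int (card V) - 2) \<le> hi - lo - 1"
    and "2 * (int (card V) - 2) = hi - lo - 1 \<Longrightarrow> hi - 1 \<in> V"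
proof -
  define P where "P = {x \<in> V. d dvd x - p}"
  define Q where "Q = V - P"
  have fin: "finite P" "finite Q" unfolding P_def Q_def using assms(1) by auto
  have VPQ: "V = P \<union> Q" "P \<inter> Q = {}" unfolding P_def Q_def by auto
  then have card: "card V = card P + card Q" using fin by (simp add: card_Un_disjoint)
  have dP: "d dvd x - y" if "x \<in> P" "y \<in> P" for x y
  proof -
    have "d dvd x - p" "d dvd y - p" using that unfolding P_def by auto
    from dvd_diff[OF this] show ?thesis by simp
  qed
  have dQ: "d dvd x - y" if "x \<in> Q" "y \<in> Q" for x y
  proof -
    have "d dvd x - q" "d dvd y - q" using that assms(5) unfolding P_def Q_def by auto
    from dvd_diff[OF this] show ?thesis by simp
  qed
  have P: "d * (int (card P) - 1) \<le> Max P - Min P" "lo \<le> Min P" "Max P \<le> hi" "Max P \<in> P" "Min P \<in> P"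
    if "P \<noteq> {}"
  proof -
    show MM: "Max P \<in> P" "Min P \<in> P" using Max_in[OF fin(1) that] Min_in[OF fin(1) that] .
    then show "lo \<le> Min P" "Max P \<le> hi" using assms(4) unfolding P_def by auto
    show "d * (int (card P) - 1) \<le> Max P - Min P"
    proof (rule card_le_of_dvd(1)[OF fin(1) that, where lo = lo and hi = hi])
      show "lo \<le> x \<and> x \<le> hi" if "x \<in> P" for x using that assms(4) unfolding P_def by blast
    qed (use assms(3) dP in auto)
  qed
  have Q: "d * (int (card Q) - 1) \<le> Max Q - Min Q" "lo \<le> Min Q" "Max Q \<le> hi" "Max Q \<in> Q" "Min Q \<in> Q"
    if "Q \<noteq> {}"
  proof -
    show MM: "Max Q \<in> Q" "Min Q \<in> Q" using Max_in[OF fin(2) that] Min_in[OF fin(2) that] .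
    then show "lo \<le> Min Q" "Max Q \<le> hi" using assms(4) unfolding Q_def by auto
    show "d * (int (card Q) - 1) \<le> Max Q - Min Q"
    proof (rule card_le_of_dvd(1)[OF fin(2) that, where lo = lo and hi = hi])
      show "lo \<le> x \<and> x \<le> hi" if "x \<in> Q" for x using that assms(4) unfolding Q_def by blast
    qed (use assms(3) dQ in auto)
  qed
  have four: "4 * (int c - 1) \<le> d * (int c - 1)" if "c \<ge> 1" for c
    using assms(3) that by (intro mult_right_mono) auto
  consider "Q = {}" | "P = {}" | "P \<noteq> {}" "Q \<noteq> {}" by blast
  then have "2 * (int (card V) - 2) \<le> hi - lo - 1 \<and> (2 * (int (card V) - 2) = hi - lo - 1 \<longrightarrow> hi - 1 \<in> V)"
  proof cases
    case 1
    then have c: "card V = card P" using card by auto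
    then have ne: "P \<noteq> {}" and c1: "1 \<le> card P" using assms(2) by auto
    have "4 * (int (card V) - 1) \<le> hi - lo"
      unfolding c using P(1-3)[OF ne] four[OF c1] by linarith
    moreover have "2 \<le> int (card V)" using assms(2) by simp
    ultimately have "2 * (int (card V) - 2) < hi - lo - 1" by presburger
    then show ?thesis by simp
  next
    case 2
    then have c: "card V = card Q" using card by auto
    then have ne: "Q \<noteq> {}" and c1: "1 \<le> card Q" using assms(2) by auto
    have "4 * (int (card V) - 1) \<le> hi - lo"
      unfolding c using Q(1-3)[OF ne] four[OF c1] by linarith
    moreover have "2 \<le> int (card V)" using assms(2) by simp
    ultimately have "2 * (int (card V) - 2) < hi - lo - 1" by presburger
    then show ?thesis by simp
  next
    case 3
    have c1: "1 \<le> card P" "1 \<le> card Q" using 3 fin by (simp_all add: Suc_le_eq card_gt_0_iff)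
    have ne: "Min P \<noteq> Min Q" "Max P \<noteq> Max Q"
      using P(4,5)[OF 3(1)] Q(4,5)[OF 3(2)] VPQ(2) by auto
    have sumc: "int (card V) = int (card P) + int (card Q)" using card by simp
    have "Min P + Min Q \<ge> 2 * lo + 1" using P(2)[OF 3(1)] Q(2)[OF 3(2)] ne(1) by linarith
    moreover have mx: "Max P + Max Q \<le> 2 * hi - 1" using P(3)[OF 3(1)] Q(3)[OF 3(2)] ne(2) by linarith
    moreover have "4 * (int (card V) - 2) \<le> (Max P - Min P) + (Max Q - Min Q)"
      using order_trans[OF four[OF c1(1)] P(1)[OF 3(1)]] order_trans[OF four[OF c1(2)] Q(1)[OF 3(2)]] sumc
      by presburger
    ultimately have le: "2 * (int (card V) - 2) \<le> hi - lo - 1"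
      and eq: "2 * (int (card V) - 2) = hi - lo - 1 \<Longrightarrow> Max P + Max Q = 2 * hi - 1" by presburger+
    have "hi - 1 \<in> V" if "Max P + Max Q = 2 * hi - 1"
    proof -
      have "Max P = hi - 1 \<or> Max Q = hi - 1" using that P(3)[OF 3(1)] Q(3)[OF 3(2)] ne(2) by linarith
      then show ?thesis using P(4)[OF 3(1)] Q(4)[OF 3(2)] VPQ(1) by auto
    qed
    then show ?thesis using le eq by blast
  qed
  then show "2 * (int (card V) - 2) \<le> hi - lo - 1"
    "2 * (int (card V) - 2) = hi - lo - 1 \<Longrightarrow> hi - 1 \<in> V" by blast+
qed

lemma top_sums:
  fixes A :: "int set" and m n :: int
  assumes "finite A" "n \<in> A" "m \<in> A" "m < n" "\<And>x. x \<in> A \<Longrightarrow> x = n \<or> x \<le> m"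
  shows "card (sums_of (A - {n})) + 2 \<le> card (sums_of A)"
    and "card (sums_of A) \<le> card (sums_of (A - {n})) + 2 \<Longrightarrow>
      sums_of A = insert (2 * n) (insert (n + m) (sums_of (A - {n})))"
proof -
  let ?T = "A - {n}"
  have le: "x \<le> m" if "x \<in> ?T" for x using assms(5) that by auto
  let ?U = "insert (2 * n) (insert (n + m) (sums_of ?T))"
  have "sums_of ?T \<subseteq> sums_of A" by (rule sums_of_mono) blast
  moreover have "2 * n \<in> sums_of A" by (rule sums_ofI'[OF assms(2,2)]) simp
  moreover have "n + m \<in> sums_of A" by (rule sums_ofI[OF assms(2,3)])
  ultimately have sub: "?U \<subseteq> sums_of A" by blast
  have bound: "x \<le> 2 * m" if "x \<in> sums_of ?T" for x
    using that
  proof (rule sums_ofE)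
    fix p q assume "p \<in> ?T" "q \<in> ?T" "x = p + q"
    then show ?thesis using le[of p] le[of q] by linarith
  qed
  have "2 * n \<notin> sums_of ?T" "n + m \<notin> sums_of ?T" "2 * n \<noteq> n + m"
    using assms(4) bound[of "2 * n"] bound[of "n + m"] by linarith+
  moreover have finT: "finite (sums_of ?T)" using assms(1) by simp
  ultimately have "card ?U = card (sums_of ?T) + 2" by simp
  moreover have finA: "finite (sums_of A)" using assms(1) by simp
  ultimately show "card (sums_of ?T) + 2 \<le> card (sums_of A)" using card_mono[OF finA sub] by simp
  assume "card (sums_of A) \<le> card (sums_of ?T) + 2"
  then have "card (sums_of A) \<le> card ?U" using \<open>card ?U = _\<close> by simp
  then show "sums_of A = ?U" using card_seteq[OF finA sub] by blast
qed

text \<open>If the top contributes only its two obvious sums, every other \<open>n + x\<close> is a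
  sum \<open>p + q\<close> of lower members. Then \<open>n - x = (n - p) + (n - q)\<close> with
  smaller positive distances, and divisibility follows by induction on the distance.\<close>

lemma top_chain:
  fixes A :: "int set" and m n :: int
  assumes "finite A" "n \<in> A" "m \<in> A" "m < n" "\<And>x. x \<in> A \<Longrightarrow> x = n \<or> x \<le> m"
    and "card (sums_of A) \<le> card (sums_of (A - {n})) + 2"
  shows "x \<in> A \<Longrightarrow> (n - m) dvd n - x"
proof -
  let ?T = "A - {n}" and ?U = "insert (2 * n) (insert (n + m) (sums_of (A - {n})))"
  have le: "x \<le> m" if "x \<in> ?T" for x using assms(5) that by auto
  have eq: "?U = sums_of A" by (rule top_sums(2)[OF assms, symmetric])
  show "(n - m) dvd n - x" if "x \<in> A" for x
    using that
  proof (induction "nat (n - x)" arbitrary: x rule: less_induct)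
    case less
    show ?case
    proof (cases "x = n \<or> x = m")
      case False
      then have "x < m" using less.prems assms(5)[OF less.prems] by auto
      have "n + x \<in> sums_of ?T"
      proof -
        have "n + x \<in> ?U" unfolding eq by (rule sums_ofI[OF assms(2) less.prems])
        then show ?thesis using False by auto
      qed
      then obtain p q where pq: "p \<in> ?T" "q \<in> ?T" "n + x = p + q" by (rule sums_ofE)
      have "(n - m) dvd n - p" "(n - m) dvd n - q"
        using pq le[OF pq(1)] le[OF pq(2)] assms(4) by (auto intro!: less.hyps)
      then have "(n - m) dvd (n - p) + (n - q)" by (rule dvd_add)
      moreover have "(n - p) + (n - q) = n - x" using pq(3) by simp
      ultimately show ?thesis by metis
    qed auto
  qed
qed

lemma good_belowD:
  assumes "good_below K" "finite B" "2 \<le> card B" "card B < K"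
  shows "card (sums_of B) + 3 \<le> 3 * card B \<Longrightarrow> structured B"
    and "card (sums_of B) + 4 \<le> 3 * card B \<Longrightarrow> short B"
  using assms unfolding good_below_def by blast+

lemma chain_balance:
  assumes "chain S"
  shows "balance S (- 1) = 1" "balance S 0 = 2" "balance S 1 = 3"
proof -
  have S: "finite S" "0 \<in> S" "1 \<in> S" "\<forall>x\<in>S. 0 \<le> x" using assms unfolding chain_def by blast+
  have "S \<inter> {..-1} = {}" using S(4) by force
  then show "balance S (- 1) = 1" unfolding balance_def by simp
  then show E0: "balance S 0 = 2" using balance_step[OF S(1), of "- 1"] S(2) by simp
  show "balance S 1 = 3" using balance_step[OF S(1), of 0] E0 S(3) by simp
qed

lemma second_largest:
  assumes "finite S" "n \<in> S" "\<And>x. x \<in> S \<Longrightarrow> x \<le> (n::int)" "y \<in> S" "y \<noteq> n"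
  obtains m where "m \<in> S" "m < n" "y \<le> m" "\<forall>x\<in>S. x = n \<or> x \<le> m" "S - {n} = S \<inter> {..m}"
proof -
  have fin: "finite (S - {n})" and yS: "y \<in> S - {n}" using assms by auto
  define m where "m = Max (S - {n})"
  have "m \<in> S - {n}" unfolding m_def using fin yS by (intro Max_in) blast+
  then have m: "m \<in> S" "m < n" using assms(3) by force+
  have le: "\<forall>x\<in>S. x = n \<or> x \<le> m" unfolding m_def using fin by auto
  then have "S - {n} = S \<inter> {..m}" using m by auto
  moreover have "y \<le> m" using le assms(4,5) by blast
  ultimately show thesis using that m le by blast
qed

text \<open>Cut at the first failure \<open>y\<close>: the part up to \<open>y\<close> is a chain
  too long for its size, so by \<open>IHZ\<close> it has many sums, and the part from the
  predecessor \<open>x\<close> on has few enough to be short with some step \<open>d\<close>. Step 1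
  cannot reach \<open>n\<close>, and steps of 2 or more are too sparse.\<close>

lemma chain_balance_ge:
  fixes S :: "int set" and n y :: int
  assumes good: "good_below (card S)" and ch: "chain S"
    and small: "card (sums_of S) + 3 \<le> 3 * card S"
    and IHZ: "\<And>A x. chain A \<Longrightarrow> card A < card S \<Longrightarrow> card (sums_of A) + 3 \<le> 3 * card A \<Longrightarrow>
      x \<in> A \<Longrightarrow> x \<le> 2 * int (card A) - 2"
    and n: "n \<in> S" "\<And>x. x \<in> S \<Longrightarrow> x \<le> n" "2 * int (card S) - 1 \<le> n"
    and y0: "y0 \<in> S" "y0 < n"
  shows "2 \<le> balance S y0"
proof (rule ccontr)
  assume neg: "\<not> 2 \<le> balance S y0"
  have fin: "finite S" and S01: "0 \<in> S" "1 \<in> S" and nonneg: "\<forall>x\<in>S. 0 \<le> x"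
    using ch unfolding chain_def by blast+
  define V where "V = {y \<in> S. y < n \<and> balance S y \<le> 1}"
  define y where "y = Min V"
  have finV: "finite V" unfolding V_def using fin by simp
  have "y0 \<in> V" unfolding V_def using y0 neg by simp
  then have yV: "y \<in> V" unfolding y_def using finV by (intro Min_in) blast+
  have ymin: "y \<le> z" if "z \<in> V" for z unfolding y_def using finV that by (rule Min_le)
  have yS: "y \<in> S" "y < n" "balance S y \<le> 1" using yV unfolding V_def by simp_all
  have "y \<noteq> 0" "y \<noteq> 1" using yS(3) chain_balance[OF ch] by auto
  then have y2: "2 \<le> y" using yS nonneg by force
  then have "0 \<le> y - 1" by simp
  then obtain x where x: "x \<in> S" "0 \<le> x" "x \<le> y - 1" "\<forall>z\<in>S. z \<le> y - 1 \<longrightarrow> z \<le> x"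
    using balance_pred[OF fin S01(1)] by blast
  have "x \<notin> V" using ymin[of x] x(3) by force
  then have Ex: "2 \<le> balance S x" using x yS(2) unfolding V_def by simp
  have cons: "z \<le> x \<or> y \<le> z" if "z \<in> S" for z using x(4) that by force
  define A where "A = S \<inter> {..y}"
  define B where "B = S \<inter> {x..}"
  have xy: "x < y" using x by simp
  note split = card_sums_split[OF fin x(1) yS(1) xy cons, folded A_def B_def]
  have finAB: "finite A" "finite B" unfolding A_def B_def using fin by auto
  have Ey: "balance S y = 2 * int (card A) - y" unfolding balance_def A_def by simp
  have "A = insert y (S \<inter> {..x})" unfolding A_def using cons yS(1) xy by force
  moreover have "y \<notin> S \<inter> {..x}" using xy by simp
  ultimately have "card A = Suc (card (S \<inter> {..x}))" using fin by simp
  then have cx: "int (card (S \<inter> {..x})) = int (card A) - 1" by simp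
  then have Ex': "balance S x = 2 * (int (card A) - 1) - x" unfolding balance_def by simp
  have "A \<subset> S" unfolding A_def using n(1) yS by force
  then have cA: "card A < card S" using fin by (rule psubset_card_mono[rotated])
  have chA: "chain A" unfolding A_def using ch y2 by (intro chain_prefix) simp_all
  \<comment> \<open>\<open>balance S y <= 1\<close> says exactly that \<open>y\<close> exceeds
    \<open>2 * card A - 2\<close>.\<close>
  have bigA: "\<not> card (sums_of A) + 3 \<le> 3 * card A"
  proof
    assume "card (sums_of A) + 3 \<le> 3 * card A"
    moreover have "y \<in> A" unfolding A_def using yS by simp
    ultimately have "y \<le> 2 * int (card A) - 2" using IHZ[OF chA cA] by blast
    then show False using Ey yS(3) by presburger
  qed
  have sB: "card (sums_of B) + 4 \<le> 3 * card B" using split bigA small by presburger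
  have "{0, 1, y} \<subseteq> A" unfolding A_def using S01 yS y2 by auto
  then have "card {0, 1, y} \<le> card A" using finAB by (intro card_mono)
  then have A3: "3 \<le> card A" using y2 by simp
  then have cB: "card B < card S" "2 \<le> card B" using split(2) cA by presburger+
  have "short B" by (rule good_belowD(2)[OF good finAB(2) cB(2,1) sB])
  moreover have xB: "x \<in> B" and yB: "y \<in> B" and nB: "n \<in> B" unfolding B_def using x yS n xy by auto
  ultimately obtain d where d: "0 < d" "\<And>x y. x \<in> B \<Longrightarrow> y \<in> B \<Longrightarrow> d dvd x - y"
    "\<And>x y. x \<in> B \<Longrightarrow> y \<in> B \<Longrightarrow> x - y \<le> d * (2 * int (card B) - 2)"
    using shortE[of B x y] xy by blast
  \<comment> \<open>For \<open>d = 1\<close>, \<open>x <= 2|A| - 4\<close> and |A| + |B| = k + 2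
    would give \<open>n <= 2k - 2\<close>.\<close>
  have d2: "2 \<le> d"
  proof (rule ccontr)
    assume "\<not> 2 \<le> d"
    then have "d = 1" using d(1) by simp
    then have "n - x \<le> 2 * int (card B) - 2" using d(3)[OF nB xB] by simp
    moreover have "int (card A) + int (card B) = int (card S) + 2" using split(2) by presburger
    ultimately show False using n(3) Ex Ex' by presburger
  qed
  have "y \<noteq> n" using yS by simp
  then obtain m where m: "m \<in> S" "m < n" "y \<le> m" "\<forall>x\<in>S. x = n \<or> x \<le> m" "S - {n} = S \<inter> {..m}"
    using second_largest[OF fin n(1,2) yS(1)] by blast
  have mB: "m \<in> B" unfolding B_def using m xy by simp
  have cT: "card (S - {n}) = card S - 1" using fin n(1) by simp
  have Spos: "0 < card S" using fin n(1) card_gt_0_iff by blast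
  \<comment> \<open>If the set without its top still has few sums, \<open>IHZ\<close> bounds
    \<open>m\<close>, and the members from \<open>y\<close> to \<open>m\<close>, spaced by at least
    2, are too few. Otherwise the top adds only two sums, and \<open>top_chain\<close> applied to 0
    and 1 gives \<open>n - m = 1\<close>, which \<open>d\<close> would have to divide.\<close>
  show False
  proof (cases "card (sums_of (S - {n})) + 3 \<le> 3 * card (S - {n})")
    case True
    have "chain (S - {n})" unfolding m(5) using m(3) y2 by (intro chain_prefix[OF ch]) simp
    moreover have "m \<in> S - {n}" using m by simp
    ultimately have "m \<le> 2 * int (card (S - {n})) - 2" using True cT Spos by (intro IHZ) simp_all
    then have mle: "m \<le> 2 * int (card S) - 4" using cT Spos by simp
    define V where "V = S \<inter> {x<..m}"
    have "x \<le> m" using m(3) xy by simp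
    then have cV: "int (card V) = int (card (S \<inter> {..m})) - (int (card A) - 1)"
      unfolding V_def using card_window[OF fin, of x m] cx by simp
    then have cV': "int (card V) = int (card S) - int (card A)" using cT Spos unfolding m(5) by simp
    have "y \<in> V" unfolding V_def using yS xy m by simp
    have VB: "V \<subseteq> B" unfolding V_def B_def by auto
    have "d * (int (card V) - 1) \<le> Max V - Min V" "Max V - Min V \<le> m - y"
    proof -
      have *: "finite V" "V \<noteq> {}" unfolding V_def using fin \<open>y \<in> V\<close>[unfolded V_def] by auto
      have **: "y \<le> z \<and> z \<le> m" if "z \<in> V" for z using that cons[of z] unfolding V_def by auto
      have ***: "d dvd v - z" if "v \<in> V" "z \<in> V" for v z using d(2) VB that by blast
      show "d * (int (card V) - 1) \<le> Max V - Min V" by (rule card_le_of_dvd(1)[OF * d(1) ** ***])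
      show "Max V - Min V \<le> m - y" by (rule card_le_of_dvd(2)[OF * d(1) ** ***])
    qed
    moreover have "2 * (int (card V) - 1) \<le> d * (int (card V) - 1)"
    proof -
      have "card V \<noteq> 0" using \<open>y \<in> V\<close> fin unfolding V_def by auto
      then show ?thesis using d2 by (intro mult_right_mono) simp_all
    qed
    ultimately have "2 * (int (card V) - 1) \<le> m - y" by linarith
    then show False using cV' mle Ey yS(3) by presburger
  next
    case False
    then have "card (sums_of S) \<le> card (sums_of (S - {n})) + 2" using small cT Spos by simp
    then have tc: "(n - m) dvd n - v" if "v \<in> S" for v
      using top_chain[OF fin n(1) m(1,2)] m(4) that by blast
    have "(n - m) dvd (n - 0) - (n - 1)" by (rule dvd_diff[OF tc tc]) (fact S01)+
    then have "n - m = 1" using m(2) by simp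
    then have "d dvd 1" using d(2)[OF nB mB] by simp
    then show False using d2 by simp
  qed
qed

lemma prog_dvd: "b \<in> prog t u l \<Longrightarrow> \<bar>t\<bar> dvd b - u"
  unfolding prog_def by auto

lemma prog_neighbour:
  assumes "b \<in> prog t u l" "2 \<le> l"
  shows "\<exists>c\<in>prog t u l. \<bar>c - b\<bar> = \<bar>t\<bar>"
proof -
  obtain i where i: "i < l" "b = u + int i * t" using assms(1) unfolding prog_def by blast
  show ?thesis
  proof (cases "i = 0")
    case True
    then have "u + int 1 * t \<in> prog t u l" unfolding prog_def using assms(2) by (intro imageI) simp
    then show ?thesis using i True by (intro bexI[of _ "u + int 1 * t"]) simp_all
  next
    case False
    then have "u + int (i - 1) * t \<in> prog t u l" unfolding prog_def using i(1) by (intro imageI) simp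
    moreover have "u + int (i - 1) * t - b = - t" using False i(2) by (simp add: of_nat_diff algebra_simps)
    ultimately show ?thesis by (intro bexI[of _ "u + int (i - 1) * t"]) simp_all
  qed
qed

text \<open>A smallest counterexample to \<open>chain_short\<close>. Counting sums below, between
  and above \<open>m\<close> and \<open>n\<close> shows that some number up to \<open>m\<close> is
  missing. Cutting at the first missing one leaves an upper part to which the induction hypothesis
  gives a structure, and each possible structure is incompatible with the density that the walk
  prescribes.\<close>

lemma chain_absurd:
  fixes S :: "int set" and n :: int
  assumes good: "good_below (card S)" and ch: "chain S"
    and small: "card (sums_of S) + 3 \<le> 3 * card S"
    and IHZ: "\<And>A x. chain A \<Longrightarrow> card A < card S \<Longrightarrow> card (sums_of A) + 3 \<le> 3 * card A \<Longrightarrow>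
      x \<in> A \<Longrightarrow> x \<le> 2 * int (card A) - 2"
    and n: "n \<in> S" "\<And>x. x \<in> S \<Longrightarrow> x \<le> n" "2 * int (card S) - 1 \<le> n"
  shows False
proof -
  define k where "k = int (card S)"
  define E where "E = balance S"
  have fin: "finite S" and S01: "0 \<in> S" "1 \<in> S" and nonneg: "\<And>x. x \<in> S \<Longrightarrow> 0 \<le> x"
    and dec: "\<And>x. x \<in> S \<Longrightarrow> 1 < x \<Longrightarrow> x \<in> sums_of (S - {0})"
    using ch unfolding chain_def by blast+
  have step: "E (x + 1) = E x + (if x + 1 \<in> S then 1 else - 1)" for x
    unfolding E_def by (rule balance_step[OF fin])
  have "card {0, 1 :: int} \<le> card S" using S01 fin by (intro card_mono) auto
  then have n3: "3 \<le> n" using n(3) by simp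
  have decE: "\<exists>u v. u \<in> S \<and> v \<in> S \<and> 1 \<le> u \<and> 1 \<le> v \<and> x = u + v" if "x \<in> S" "1 < x" for x
  proof -
    have "x \<in> sums_of (S - {0})" by (rule dec[OF that])
    then obtain u v where "u \<in> S - {0}" "v \<in> S - {0}" "x = u + v" by (rule sums_ofE)
    then show ?thesis using nonneg[of u] nonneg[of v] by (intro exI[of _ u] exI[of _ v]) auto
  qed
  have "1 < n" using n3 by simp
  then obtain u v where uv: "u \<in> S" "v \<in> S" "1 \<le> u" "1 \<le> v" "n = u + v" using decE[OF n(1)] by blast
  have "u \<noteq> n" using uv by simp
  then obtain m where m: "m \<in> S" "m < n" "u \<le> m" "\<forall>x\<in>S. x = n \<or> x \<le> m" "S - {n} = S \<inter> {..m}"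
    using second_largest[OF fin n(1,2) uv(1)] by blast
  have "v \<noteq> n" using uv by simp
  then have nm2: "n \<le> 2 * m" using m(3,4) uv by force
  have Ege: "2 \<le> E y" if "y \<in> S" "y < n" for y
    unfolding E_def using good ch small IHZ n that by (rule chain_balance_ge)
  define h where "h = E m"
  have Spos: "0 < card S" using fin S01(1) card_gt_0_iff by blast
  have cm: "int (card (S \<inter> {..m})) = k - 1"
    unfolding m(5)[symmetric] k_def using fin n(1) Spos by simp
  then have hm: "h = 2 * (k - 1) - m" unfolding h_def E_def balance_def by simp
  have h2: "2 \<le> h" unfolding h_def by (rule Ege[OF m(1,2)])
  have gap: "h + 1 \<le> n - m" using n(3) hm unfolding k_def by presburger
  have hlem: "h + 1 \<le> m" using gap nm2 by presburger
  have S2: "2 \<in> S"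
  proof -
    obtain y where y: "y \<in> S" "1 < y" "\<forall>z\<in>S. 1 < z \<longrightarrow> y \<le> z"
      using balance_succ[OF fin n(1) \<open>1 < n\<close>] by blast
    obtain u v where uv: "u \<in> S" "v \<in> S" "1 \<le> u" "1 \<le> v" "y = u + v" using decE[OF y(1,2)] by blast
    have "\<not> 1 < u" "\<not> 1 < v" using y(3) uv by force+
    then have "y = 2" using uv by simp
    then show ?thesis using y by simp
  qed
  have S34: "3 \<in> S \<or> 4 \<in> S"
  proof -
    have "2 < n" using n3 by simp
    then obtain y where y: "y \<in> S" "2 < y" "\<forall>z\<in>S. 2 < z \<longrightarrow> y \<le> z"
      using balance_succ[OF fin n(1)] by blast
    have "1 < y" using y by simp
    then obtain u v where uv: "u \<in> S" "v \<in> S" "1 \<le> u" "1 \<le> v" "y = u + v" using decE[OF y(1)] by blast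
    have "\<not> 2 < u" "\<not> 2 < v" using y(3) uv by force+
    then have "y = 3 \<or> y = 4" using uv y(2) by presburger
    then show ?thesis using y by auto
  qed
  define M where "M = {c \<in> {0..m}. c \<notin> sums_of S}"
  have finM: "finite M" unfolding M_def by (rule finite_subset[of _ "{0..m}"]) auto
  \<comment> \<open>The window starting at -1 gives \<open>E c <= 1\<close> for a missing
    \<open>c\<close>. The next member has value at least 2, so it can only be \<open>c + 1\<close>.
    The summands 0, 1, 2 exclude \<open>c\<close>, \<open>c - 1\<close>, \<open>c - 2\<close> from
    \<open>S\<close>.\<close>
  have miss: "c + 1 \<in> S \<and> E (c + 1) = 2 \<and> E c = 1 \<and> c + 1 \<le> m \<and> c \<notin> S \<and> c - 1 \<notin> S \<and> c - 2 \<notin> S \<and> 3 \<le> c"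
    if "c \<in> M" for c
  proof -
    have c: "0 \<le> c" "c \<le> m" "c \<notin> sums_of S" using that unfolding M_def by auto
    have "\<not> balance S (- 1) < balance S c"
    proof
      assume "balance S (- 1) < balance S c"
      then have "- 1 + 1 + c \<in> sums_of S" using c by (intro sums_of_window[OF fin]) simp_all
      then show False using c(3) by simp
    qed
    then have Ec: "E c \<le> 1" unfolding E_def using chain_balance(1)[OF ch] by simp
    have out: "c - x \<notin> S" if "x \<in> S" for x
      using c(3) sums_ofI'[OF that, of "c - x" c] by auto
    have cS: "c \<notin> S" "c - 1 \<notin> S" "c - 2 \<notin> S" using out[OF S01(1)] out[OF S01(2)] out[OF S2] by simp_all
    have "c \<noteq> m" using cS m by auto
    then have "c < m" using c by simp
    then obtain y where y: "y \<in> S" "c < y" "y \<le> m" "E y = E c - (y - c) + 2"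
      using balance_succ[OF fin m(1), folded E_def] by blast
    have "2 \<le> E y" using y m(2) by (intro Ege) simp_all
    then have yc: "y = c + 1" "E c = 1" using y(2,4) Ec by presburger+
    have "c \<noteq> 0" "c \<noteq> 1" "c \<noteq> 2" using cS S01 S2 by auto
    then show ?thesis using y yc cS c(1) by auto
  qed
  define Xs where "Xs = {c \<in> {m<..<n}. c \<in> sums_of S}"
  have finXs: "finite Xs" unfolding Xs_def by (rule finite_subset[of _ "{m<..<n}"]) auto
  have m0: "0 \<le> m" using nonneg m by simp
  \<comment> \<open>The sums up to \<open>m\<close>, those strictly between \<open>m\<close> and
    \<open>n\<close>, and \<open>n + S\<close> are disjoint; with \<open>m = 2 * (k - 1) - h\<close>
    the bound 3k - 3 leaves this much for \<open>Xs\<close>.\<close>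
  have count: "int (card Xs) \<le> h - 2 + int (card M)"
  proof -
    let ?H = "(\<lambda>y. n + y) ` S" and ?L = "{0..m} - M"
    have "M \<subseteq> {0..m}" unfolding M_def by auto
    then have "card ?L = card {0..m} - card M" "card M \<le> card {0..m}"
      using card_Diff_subset[OF finM] card_mono[of "{0..m}" M] by blast+
    then have cL: "int (card ?L) = m + 1 - int (card M)" using m0 by simp
    have cH: "card ?H = card S" by (rule card_image) (auto simp: inj_on_def)
    have disj: "?L \<inter> Xs = {}" unfolding Xs_def by auto
    have disj2: "(?L \<union> Xs) \<inter> ?H = {}"
    proof -
      have "\<forall>x\<in>?L \<union> Xs. x < n" using m(2) unfolding Xs_def by auto
      moreover have "\<forall>x\<in>?H. n \<le> x" using nonneg by auto
      ultimately show ?thesis by (meson disjoint_iff linorder_not_le)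
    qed
    have "?L \<subseteq> sums_of S" "Xs \<subseteq> sums_of S" unfolding M_def Xs_def by blast+
    moreover have "?H \<subseteq> sums_of S" using n(1) by (blast intro: sums_ofI)
    ultimately have "?L \<union> Xs \<union> ?H \<subseteq> sums_of S" by blast
    then have "card (?L \<union> Xs \<union> ?H) \<le> card (sums_of S)" using fin by (intro card_mono) auto
    moreover have "card (?L \<union> Xs \<union> ?H) = card ?L + card Xs + card ?H"
      using disj disj2 finXs fin by (simp add: card_Un_disjoint)
    ultimately have "int (card ?L) + int (card Xs) + int (card ?H) \<le> 3 * k - 3" using small unfolding k_def by linarith
    then show ?thesis using cL cH hm unfolding k_def by presburger
  qed
  have XsI: "c \<in> Xs" if "m < c" "c < n" "c \<in> sums_of S" for c using that unfolding Xs_def by simp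
  \<comment> \<open>The walk is at 2 in 0, so it stays below \<open>h\<close> on the first
    \<open>h - 2\<close> places and the windows up to \<open>m\<close> produce the sums
    \<open>m + 1 + x\<close> there. One further sum is found at offset \<open>h - 2\<close> or
    \<open>h - 1\<close>.\<close>
  have Xsge: "h - 1 \<le> int (card Xs)"
  proof -
    have win: "m + 1 + x \<in> sums_of S" if "0 \<le> x" "x \<le> m" "E x < h" for x
    proof -
      have "x + 1 + m \<in> sums_of S" using that unfolding h_def E_def by (intro sums_of_window[OF fin]) simp_all
      then show ?thesis by (simp add: algebra_simps)
    qed
    have E2: "E x \<le> 2 + x" if "0 \<le> x" for x
      using balance_upper[OF fin that] chain_balance(2)[OF ch] unfolding E_def by simp
    have "\<exists>e. (e = h - 2 \<or> e = h - 1) \<and> m + 1 + e \<in> sums_of S"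
    proof (cases "E (h - 2) < h")
      case True
      then show ?thesis using win[of "h - 2"] h2 hlem by auto
    next
      case False
      then have e: "E (h - 2) = h" using E2[of "h - 2"] h2 by simp
      show ?thesis
      proof (cases "h - 1 \<in> S")
        case True
        then have "m + 1 + (h - 2) \<in> sums_of S" by (intro sums_ofI'[OF m(1) True]) simp
        then show ?thesis by blast
      next
        case False
        then have "E (h - 1) < h" using step[of "h - 2"] e by simp
        then show ?thesis using win[of "h - 1"] h2 hlem by auto
      qed
    qed
    then obtain e where e: "e = h - 2 \<or> e = h - 1" "m + 1 + e \<in> sums_of S" by blast
    let ?I = "(\<lambda>x. m + 1 + x) ` (insert e {0..h - 3})"
    have "?I \<subseteq> Xs"
    proof
      fix c assume "c \<in> ?I"
      then obtain x where x0: "c = m + 1 + x" "x \<in> insert e {0..h - 3}" by blast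
      then have x: "c = m + 1 + x" "x = e \<or> (0 \<le> x \<and> x \<le> h - 3)" by simp_all
      have "E x < h" if "0 \<le> x" "x \<le> h - 3" using E2[of x] that by simp
      then have "c \<in> sums_of S" using x e(2) win[of x] hlem by auto
      moreover have "m < c" "c < n" using x e(1) h2 gap by auto
      ultimately show "c \<in> Xs" by (intro XsI)
    qed
    then have "card ?I \<le> card Xs" by (rule card_mono[OF finXs])
    moreover have "card ?I = card (insert e {0..h - 3})" by (rule card_image) (auto simp: inj_on_def)
    moreover have "e \<notin> {0..h - 3}" using e(1) by auto
    then have "card (insert e {0..h - 3}) = Suc (card {0..h - 3})" by (intro card_insert_disjoint) simp
    ultimately show ?thesis using h2 by simp
  qed
  have "M \<noteq> {}" using count Xsge by auto
  define c0 where "c0 = Min M"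
  have c0M: "c0 \<in> M" unfolding c0_def by (rule Min_in[OF finM \<open>M \<noteq> {}\<close>])
  have c0min: "c0 \<le> c" if "c \<in> M" for c unfolding c0_def using finM that by (rule Min_le)
  \<comment> \<open>The distance from \<open>y0\<close> to its predecessor is at least 4, since
    \<open>c0\<close>, \<open>c0 - 1\<close> and \<open>c0 - 2\<close> are non-members.\<close>
  define y0 where "y0 = c0 + 1"
  have y0: "y0 \<in> S" "E y0 = 2" "y0 \<le> m" "4 \<le> y0" and c0n: "c0 \<notin> S" "c0 - 1 \<notin> S" "c0 - 2 \<notin> S"
    using miss[OF c0M] unfolding y0_def by auto
  have "0 \<le> c0" using y0 unfolding y0_def by simp
  then obtain x0 where x0: "x0 \<in> S" "0 \<le> x0" "x0 \<le> c0" "\<forall>z\<in>S. z \<le> c0 \<longrightarrow> z \<le> x0"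
    using balance_pred[OF fin S01(1)] by blast
  have "x0 \<noteq> c0" "x0 \<noteq> c0 - 1" "x0 \<noteq> c0 - 2" using x0(1) c0n by auto
  then have xy: "x0 + 4 \<le> y0" using x0(3) unfolding y0_def by simp
  then have xlt: "x0 < y0" by simp
  have cons: "z \<le> x0 \<or> y0 \<le> z" if "z \<in> S" for z using x0(4) that unfolding y0_def by force
  define A where "A = S \<inter> {..y0}"
  define B where "B = S \<inter> {x0..}"
  note split = card_sums_split[OF fin x0(1) y0(1) xlt cons, folded A_def B_def]
  have finAB: "finite A" "finite B" unfolding A_def B_def using fin by auto
  have Ey: "y0 = 2 * int (card A) - 2" using y0(2) unfolding E_def balance_def A_def by simp
  have "A = insert y0 (S \<inter> {..x0})" unfolding A_def using cons y0(1) xlt by force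
  moreover have "y0 \<notin> S \<inter> {..x0}" using xlt by simp
  ultimately have "card A = Suc (card (S \<inter> {..x0}))" using fin by simp
  then have cx: "int (card (S \<inter> {..x0})) = int (card A) - 1" by simp
  have "x0 < n" using xlt y0(3) m(2) by simp
  then have "2 \<le> E x0" using x0(1) by (intro Ege)
  then have x0le: "x0 \<le> 2 * int (card A) - 4" using cx unfolding E_def balance_def by simp
  \<comment> \<open>All numbers below the first missing \<open>c0\<close> are sums of members up to
    \<open>y0\<close>. Together with \<open>y0 + A\<close> they are
    \<open>c0 + |A| = 3|A| - 3\<close> many, because \<open>y0 = 2|A| - 2\<close>.\<close>
  have bigA: "3 * int (card A) - 3 \<le> int (card (sums_of A))"
  proof -
    let ?H = "(\<lambda>v. y0 + v) ` A"
    have "{0..<c0} \<subseteq> sums_of A"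
    proof
      fix c assume c: "c \<in> {0..<c0}"
      then have "c \<notin> M" using c0min[of c] by auto
      then have "c \<in> sums_of S" using c y0(3) unfolding M_def y0_def by auto
      then obtain u v where uv: "u \<in> S" "v \<in> S" "c = u + v" by (rule sums_ofE)
      then have "u \<in> A" "v \<in> A" using nonneg[of u] nonneg[of v] c unfolding A_def y0_def by auto
      then show "c \<in> sums_of A" using uv by auto
    qed
    moreover have "y0 \<in> A" using y0(1) unfolding A_def by simp
    then have "?H \<subseteq> sums_of A" by (blast intro: sums_ofI)
    ultimately have "card ({0..<c0} \<union> ?H) \<le> card (sums_of A)" using finAB by (intro card_mono) auto
    moreover have "card ?H = card A" by (rule card_image) (auto simp: inj_on_def)
    moreover have "{0..<c0} \<inter> ?H = {}"
    proof -
      have "\<forall>x\<in>?H. y0 \<le> x" using nonneg unfolding A_def by auto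
      moreover have "\<forall>x\<in>{0..<c0}. x < y0" unfolding y0_def by auto
      ultimately show ?thesis by (meson disjoint_iff linorder_not_le)
    qed
    then have "card ({0..<c0} \<union> ?H) = card {0..<c0} + card ?H" using finAB by (intro card_Un_disjoint) auto
    ultimately show ?thesis using Ey \<open>0 \<le> c0\<close> unfolding y0_def by simp
  qed
  have sB: "card (sums_of B) + 3 \<le> 3 * card B" using split bigA small by linarith
  have "{0, 1, y0} \<subseteq> A" unfolding A_def using S01 y0 by auto
  then have "card {0, 1, y0} \<le> card A" using finAB by (intro card_mono)
  then have A3: "3 \<le> card A" using y0 by simp
  have "A \<subset> S" unfolding A_def using n(1) y0 m(2) by force
  then have cA: "card A < card S" using fin by (rule psubset_card_mono[rotated])
  have cB: "card B < card S" "2 \<le> card B" using split(2) A3 cA by presburger+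
  have str: "structured B" by (rule good_belowD(1)[OF good finAB(2) cB(2,1) sB])
  define Y where "Y = S \<inter> {x0<..m}"
  have finY: "finite Y" unfolding Y_def using fin by simp
  have Yr: "y0 \<le> z \<and> z \<le> m" if "z \<in> Y" for z using that cons[of z] unfolding Y_def by auto
  have xlm: "x0 \<le> m" using xlt y0(3) by simp
  have cY: "int (card Y) = k - int (card A)" unfolding Y_def using card_window[OF fin xlm] cx cm by simp
  have span: "m - y0 = 2 * int (card Y) - h" using cY hm Ey by simp
  have yY: "y0 \<in> Y" "m \<in> Y" unfolding Y_def using y0 xlt m xlm by auto
  have Y1: "1 \<le> card Y" using yY finY by (metis One_nat_def Suc_leI card_gt_0_iff empty_iff)
  have Beq: "B = insert x0 (insert n Y)" unfolding B_def Y_def using x0 n(1) m(4) \<open>x0 < n\<close> m(2) xlm by force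
  have nY: "n \<notin> Y" "x0 \<notin> Y" unfolding Y_def using m(2) by auto
  have cB': "card B = card Y + 2" unfolding Beq using nY finY \<open>x0 < n\<close> by simp
  \<comment> \<open>A second missing sum would delimit a part \<open>W\<close> of \<open>Y\<close>
    whose average spacing is below 2, too dense for the residue conditions considered next.\<close>
  have second: "\<exists>W\<subseteq>Y. 2 \<le> card W \<and> (\<exists>hi. (\<forall>z\<in>W. y0 \<le> z \<and> z \<le> hi) \<and> hi - y0 = 2 * int (card W) - 4)"
    if "2 \<le> card M"
  proof -
    have "\<not> M \<subseteq> {c0}" using that card_mono[of "{c0}" M] by auto
    then obtain c1 where c1: "c1 \<in> M" "c1 \<noteq> c0" by blast
    then have c01: "c0 < c1" using c0min[of c1] by simp
    note ms = miss[OF c1(1)]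
    define W where "W = S \<inter> {x0<..c1}"
    have "x0 \<le> c1" using x0(3) c01 by simp
    then have "int (card W) = int (card (S \<inter> {..c1})) - (int (card A) - 1)"
      unfolding W_def using card_window[OF fin] cx by simp
    moreover have "2 * int (card (S \<inter> {..c1})) - c1 = 1" using ms unfolding E_def balance_def by simp
    ultimately have cW: "(c1 - 3) - y0 = 2 * int (card W) - 4" using Ey by simp
    have rng: "y0 \<le> z \<and> z \<le> c1 - 3" if "z \<in> W" for z
    proof -
      have "z \<noteq> c1" "z \<noteq> c1 - 1" "z \<noteq> c1 - 2" using that ms unfolding W_def by auto
      then show ?thesis using that cons[of z] unfolding W_def by auto
    qed
    have "y0 \<in> W" unfolding W_def using y0(1) xlt c01 unfolding y0_def by auto
    then have "y0 \<le> c1 - 3" using rng by blast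
    then have "2 \<le> card W" using cW by simp
    moreover have "W \<subseteq> Y" unfolding W_def Y_def using ms by auto
    ultimately show ?thesis using rng cW by blast
  qed
  \<comment> \<open>With at most one missing number, at most \<open>h - 1\<close> sums lie between
    \<open>m\<close> and \<open>n\<close>. The sums \<open>m + 1\<close> and \<open>m + 2\<close>,
    and for \<open>h = 3\<close> also \<open>m + 3\<close> obtained from 3 or 4, are too
    many.\<close>
  have final: False if "card M \<le> 1" "h = 2 \<or> (h = 3 \<and> m - 1 \<in> S)"
  proof -
    have le: "int (card Xs) \<le> h - 1" using count that(1) by simp
    have X12: "m + 1 \<in> Xs" "m + 2 \<in> Xs" using m(1) S01 S2 gap h2 by (auto intro!: XsI)
    from that(2) show False
    proof
      assume h2': "h = 2"
      have "card {m + 1, m + 2} \<le> card Xs" using X12 finXs by (intro card_mono) auto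
      then show False using le h2' by simp
    next
      assume h3: "h = 3 \<and> m - 1 \<in> S"
      have "m + 3 \<in> sums_of S"
        using S34 m(1) h3 sums_ofI'[of m S 3 "m + 3"] sums_ofI'[of "m - 1" S 4 "m + 3"] by auto
      then have "m + 3 \<in> Xs" using gap h3 by (intro XsI) auto
      then have "card {m + 1, m + 2, m + 3} \<le> card Xs" using X12 finXs by (intro card_mono) auto
      then show False using le h3 by simp
    qed
  qed
  have alpha: False if "card Y = 1"
  proof (rule final)
    show "card M \<le> 1"
    proof (rule ccontr)
      assume "\<not> card M \<le> 1"
      then have "2 \<le> card M" by simp
      from second[OF this] obtain W where W: "W \<subseteq> Y" "2 \<le> card W" by blast
      then show False using that card_mono[OF finY W(1)] by simp
    qed
    show "h = 2 \<or> (h = 3 \<and> m - 1 \<in> S)" using span that y0(3) h2 by simp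
  qed
  \<comment> \<open>A single class modulo \<open>d >= 2\<close> has spacing at least 2; this
    contradicts \<open>second\<close> and, through \<open>span\<close>, leaves only
    \<open>h = 2\<close>.\<close>
  have beta: False if d: "2 \<le> d" "\<And>v z. v \<in> Y \<Longrightarrow> z \<in> Y \<Longrightarrow> d dvd v - z" for d :: int
  proof (rule final)
    have bd: "2 * (int (card W) - 1) \<le> hi - y0"
      if W: "W \<subseteq> Y" "1 \<le> card W" "\<And>z. z \<in> W \<Longrightarrow> y0 \<le> z \<and> z \<le> hi" for W hi
    proof -
      have *: "finite W" "W \<noteq> {}" using W finY finite_subset by auto
      have dd: "d dvd v - z" if "v \<in> W" "z \<in> W" for v z using that d(2) W(1) by blast
      have d0: "0 < d" using d(1) by simp
      have "2 * (int (card W) - 1) \<le> d * (int (card W) - 1)"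
        using d(1) W(2) by (intro mult_right_mono) simp_all
      then show ?thesis
        using card_le_of_dvd(1)[OF * d0 W(3) dd] card_le_of_dvd(2)[OF * d0 W(3) dd] by linarith
    qed
    show "card M \<le> 1"
    proof (rule ccontr)
      assume "\<not> card M \<le> 1"
      then have "2 \<le> card M" by simp
      from second[OF this] obtain W hi where W: "W \<subseteq> Y" "2 \<le> card W"
        "\<forall>z\<in>W. y0 \<le> z \<and> z \<le> hi" "hi - y0 = 2 * int (card W) - 4" by blast
      have "2 * (int (card W) - 1) \<le> hi - y0"
      proof (rule bd[OF W(1)])
        show "1 \<le> card W" using W(2) by simp
        show "y0 \<le> z \<and> z \<le> hi" if "z \<in> W" for z using W(3) that by blast
      qed
      then show False using W(4) by simp
    qed
    have "2 * (int (card Y) - 1) \<le> m - y0" by (rule bd[OF subset_refl Y1 Yr])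
    then show "h = 2 \<or> (h = 3 \<and> m - 1 \<in> S)" using span h2 by simp
  qed
  \<comment> \<open>Two classes modulo \<open>d >= 4\<close> have average spacing about 2. The
    bound, weaker than for one class, also admits \<open>h = 3\<close>, but only with equality, and
    then \<open>two_class_bound\<close> puts \<open>m - 1\<close> into \<open>Y\<close>.\<close>
  have gamma: False if d: "4 \<le> d" "\<And>z. z \<in> Y \<Longrightarrow> d dvd z - p \<or> d dvd z - q" for d p q :: int
  proof (cases "card Y = 1")
    case True then show ?thesis by (rule alpha)
  next
    case False
    then have Y2: "2 \<le> card Y" using Y1 by simp
    have tc: "2 * (int (card Y) - 2) \<le> m - y0 - 1"
      "2 * (int (card Y) - 2) = m - y0 - 1 \<Longrightarrow> m - 1 \<in> Y"
      by (rule two_class_bound[OF finY Y2 d(1) Yr d(2)]; assumption)+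
    show ?thesis
    proof (rule final)
      show "card M \<le> 1"
      proof (rule ccontr)
        assume "\<not> card M \<le> 1"
        then have "2 \<le> card M" by simp
        from second[OF this] obtain W hi where W: "W \<subseteq> Y" "2 \<le> card W"
          "\<forall>z\<in>W. y0 \<le> z \<and> z \<le> hi" "hi - y0 = 2 * int (card W) - 4" by blast
        have finW: "finite W" using W(1) finY finite_subset by auto
        have "2 * (int (card W) - 2) \<le> hi - y0 - 1"
        proof (rule two_class_bound(1)[OF finW W(2) d(1)])
          show "y0 \<le> z \<and> z \<le> hi" if "z \<in> W" for z using W(3) that by blast
          show "d dvd z - p \<or> d dvd z - q" if "z \<in> W" for z using d(2) W(1) that by blast
        qed
        then show False using W(4) by simp
      qed
      show "h = 2 \<or> (h = 3 \<and> m - 1 \<in> S)"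
      proof (cases "h = 2")
        case False
        then have h3: "h = 3" and eq: "2 * (int (card Y) - 2) = m - y0 - 1"
          using tc(1) span h2 by presburger+
        have "m - 1 \<in> Y" by (rule tc(2)[OF eq])
        then show ?thesis using h3 unfolding Y_def by blast
      qed simp
    qed
  qed
  have xB: "x0 \<in> B" and nB: "n \<in> B" and YB: "Y \<subseteq> B" unfolding Beq by auto
  \<comment> \<open>If \<open>x0\<close> has a neighbour in its progression, the gap above
    \<open>x0\<close> gives |t| >= 4 and \<open>gamma\<close> applies. If \<open>x0\<close> is
    alone, the rest is one progression, and the gap below \<open>n\<close> makes its step large
    enough for \<open>beta\<close>.\<close>
  have one: False if bp: "x0 \<in> prog t u l" "B = prog t u l \<union> prog t v l'" "l + l' = card B" for t u v l l'
  proof -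
    have tdvd: "\<bar>t\<bar> dvd z - u \<or> \<bar>t\<bar> dvd z - v" if "z \<in> B" for z
      using that prog_dvd unfolding bp(2) by blast
    show False
    proof (cases "2 \<le> l")
      case True
      then obtain c where c: "c \<in> prog t u l" "\<bar>c - x0\<bar> = \<bar>t\<bar>" using prog_neighbour[OF bp(1)] by blast
      have t0: "t \<noteq> 0"
      proof
        assume "t = 0"
        then have "B \<subseteq> {u, v}" unfolding bp(2) prog_def by auto
        then have "card B \<le> card {u, v}" by (intro card_mono) auto
        also have "\<dots> \<le> 2" by (simp add: card_insert_if)
        finally show False using cB' Y1 by simp
      qed
      have "c \<in> B" using c(1) bp(2) by blast
      moreover have "c \<noteq> x0" using c(2) t0 by auto
      ultimately have "y0 \<le> c" using cons[of c] unfolding B_def by auto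
      then have "4 \<le> \<bar>t\<bar>" using c(2) xy by simp
      then show False using gamma[of "\<bar>t\<bar>" u v] tdvd YB by blast
    next
      case False
      have "l \<noteq> 0" using bp(1) unfolding prog_def by auto
      then have "l = 1" using False by simp
      then have "prog t u l = {u}" unfolding prog_def by auto
      then have rest: "z \<in> prog t v l'" if "z \<in> B" "z \<noteq> x0" for z using bp that by auto
      show False
      proof (cases "card Y = 1")
        case True then show False by (rule alpha)
      next
        case False
        have l': "2 \<le> l'" using bp(3) \<open>l = 1\<close> cB' Y1 by simp
        have "n \<in> prog t v l'" using rest nB \<open>x0 < n\<close> by simp
        then obtain c where c: "c \<in> prog t v l'" "\<bar>c - n\<bar> = \<bar>t\<bar>" using prog_neighbour l' by blast
        have dv: "\<bar>t\<bar> dvd a - z" if "a \<in> Y" "z \<in> Y" for a z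
        proof -
          have "a \<noteq> x0" "z \<noteq> x0" using that nY by auto
          then have "\<bar>t\<bar> dvd a - v" "\<bar>t\<bar> dvd z - v" using that rest YB prog_dvd by blast+
          from dvd_diff[OF this] show ?thesis by simp
        qed
        have t0: "t \<noteq> 0"
        proof
          assume "t = 0"
          then have "B \<subseteq> {u, v}" unfolding bp(2) prog_def by auto
          then have "card B \<le> card {u, v}" by (intro card_mono) auto
          also have "\<dots> \<le> 2" by (simp add: card_insert_if)
          finally show False using cB' Y1 by simp
        qed
        have "c \<in> B" using c(1) bp(2) by blast
        moreover have "c \<noteq> n" using c(2) t0 by auto
        ultimately have "c \<le> m" using m(4) unfolding B_def by blast
        then have "2 \<le> \<bar>t\<bar>" using c(2) gap h2 by simp
        then show False using beta dv by blast
      qed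
    qed
  qed
  from str consider "short B" | "biprog B" | "triangle B" unfolding structured_def by blast
  then show False
  proof cases
    case 1
    obtain d where d: "0 < d" "\<And>x y. x \<in> B \<Longrightarrow> y \<in> B \<Longrightarrow> d dvd x - y"
      "\<And>x y. x \<in> B \<Longrightarrow> y \<in> B \<Longrightarrow> x - y \<le> d * (2 * int (card B) - 2)"
      using shortE[OF 1 xB nB] \<open>x0 < n\<close> by blast
    show False
    proof (cases "2 \<le> d")
      case True
      then show False using beta d(2) YB by blast
    next
      case False
      then have "d = 1" using d(1) by simp
      then have "n - x0 \<le> 2 * int (card B) - 2" using d(3)[OF nB xB] by simp
      moreover have "int (card A) + int (card B) = int (card S) + 2" using split(2) by presburger
      ultimately show False using n(3) x0le by presburger
    qed
  next
    case 2
    then obtain t u v l l' where bp: "l + l' = card B" "B = prog t u l \<union> prog t v l'"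
      unfolding biprog_def by blast
    from xB have "x0 \<in> prog t u l \<or> x0 \<in> prog t v l'" using bp(2) by blast
    then show False
    proof
      assume "x0 \<in> prog t u l"
      then show False using one bp by blast
    next
      assume x: "x0 \<in> prog t v l'"
      have "B = prog t v l' \<union> prog t u l" "l' + l = card B" using bp by auto
      then show False using one[OF x] by blast
    qed
  next
    case 3
    then obtain u a b where tr: "card B = 6" "B = {u, u + a, u + b, u + 2 * a, u + a + b, u + 2 * b}"
      unfolding triangle_def by blast
    have "card Y = 4" using tr(1) cB' by simp
    then have sp: "m - y0 \<le> 6" using span h2 by simp
    have el: "z = x0 \<or> z = n \<or> (y0 \<le> z \<and> z \<le> m)" if "z \<in> B" for z
      using that Yr unfolding Beq by auto
    have ab: "a \<noteq> 0" "b \<noteq> 0" "a \<noteq> b"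
      using tr(1) unfolding tr(2) by (auto simp: card_insert_if split: if_splits)
    have els: "u = x0 \<or> u = n \<or> (y0 \<le> u \<and> u \<le> m)"
      "u + a = x0 \<or> u + a = n \<or> (y0 \<le> u + a \<and> u + a \<le> m)"
      "u + b = x0 \<or> u + b = n \<or> (y0 \<le> u + b \<and> u + b \<le> m)"
      "u + 2 * a = x0 \<or> u + 2 * a = n \<or> (y0 \<le> u + 2 * a \<and> u + 2 * a \<le> m)"
      "u + a + b = x0 \<or> u + a + b = n \<or> (y0 \<le> u + a + b \<and> u + a + b \<le> m)"
      "u + 2 * b = x0 \<or> u + 2 * b = n \<or> (y0 \<le> u + 2 * b \<and> u + 2 * b \<le> m)"
      using el unfolding tr(2) by blast+
    have g3: "m + 3 \<le> n" using gap h2 by simp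
    have xin: "x0 = u \<or> x0 = u + a \<or> x0 = u + b \<or> x0 = u + 2 * a \<or> x0 = u + a + b \<or> x0 = u + 2 * b"
      using xB unfolding tr(2) by simp
    have nin: "n = u \<or> n = u + a \<or> n = u + b \<or> n = u + 2 * a \<or> n = u + a + b \<or> n = u + 2 * b"
      using nB unfolding tr(2) by simp
    \<comment> \<open>Seen from its smallest corner with generators a < b, the triangle has its four
      inner values between a and a + b above that corner, so their span is b. The end gaps give a >=
      4 and b - a >= 3, hence b >= 7 against the span of at most 6.\<close>
    show False using els ab sp xy g3 y0(3) xin nin by (smt (verit))
  qed
qed

lemma chain_short:
  "good_below (card S) \<Longrightarrow> chain S \<Longrightarrow> card (sums_of S) + 3 \<le> 3 * card S \<Longrightarrow> x \<in> S \<Longrightarrow>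
    x \<le> 2 * int (card S) - 2"
proof (induction "card S" arbitrary: S x rule: less_induct)
  case less
  have fin: "finite S" and "0 \<in> S" using less.prems unfolding chain_def by blast+
  define n where "n = Max S"
  have n: "n \<in> S" "\<And>y. y \<in> S \<Longrightarrow> y \<le> n" unfolding n_def using fin \<open>0 \<in> S\<close> Max_in by auto
  have IHZ: "y \<le> 2 * int (card A) - 2"
    if "chain A" "card A < card S" "card (sums_of A) + 3 \<le> 3 * card A" "y \<in> A" for A y
    using less.hyps[OF that(2) _ that(1,3,4)] less.prems(1) that(2) unfolding good_below_def by auto
  have "\<not> 2 * int (card S) - 1 \<le> n"
    using chain_absurd[OF less.prems(1-3) IHZ n] by blast
  then show ?case using n(2)[OF less.prems(4)] by simp
qed

section \<open>Adding a new minimum to a structured set\<close>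

lemma step_difference:
  fixes a b c j D :: int
  assumes "a + j * D = b + c * D" "b < a" "0 < D" "0 \<le> j"
  shows "\<exists>r. 1 \<le> r \<and> r \<le> c \<and> a - b = r * D \<and> j = c - r"
proof (intro exI[of _ "c - j"] conjI)
  show e: "a - b = (c - j) * D" using assms(1) by (simp add: algebra_simps)
  then have "0 < (c - j) * D" using assms(2) by simp
  then show "1 \<le> c - j" using assms(3) by (simp add: zero_less_mult_iff)
qed (use assms in simp_all)

lemma prog_1: "prog t u (Suc 0) = {u}"
  by (auto simp: prog_def)

lemma prog_2: "prog t u 2 = {u, u + t}"
  by (auto simp: prog_def numeral_2_eq_2 lessThan_Suc)

lemma prog_3: "prog t u 3 = {u, u + t, u + 2 * t}"
  by (auto simp: prog_def numeral_3_eq_3 lessThan_Suc)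

lemma prog_Suc: "prog t u (Suc l) = insert u (prog t (u + t) l)"
  unfolding prog_def lessThan_Suc_eq_insert_0 image_insert image_image
  by (auto simp: algebra_simps)

lemma prog_reverse: "prog t u l = prog (- t) (u + (int l - 1) * t) l"
proof -
  have "prog t' u' l \<subseteq> prog (- t') (u' + (int l - 1) * t') l" for t' u'
  proof
    fix x assume "x \<in> prog t' u' l"
    then obtain i where i: "i < l" "x = u' + int i * t'" unfolding prog_def by auto
    have "x = u' + (int l - 1) * t' + int (l - 1 - i) * (- t')"
      using i by (simp add: of_nat_diff algebra_simps)
    moreover have "l - 1 - i < l" using i by simp
    ultimately show "x \<in> prog (- t') (u' + (int l - 1) * t') l" unfolding prog_def by blast
  qed
  from this[of t u] this[of "- t" "u + (int l - 1) * t"] show ?thesis by auto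
qed

lemma mem_prog: "x \<in> prog t u l \<longleftrightarrow> (\<exists>i. 0 \<le> i \<and> i < int l \<and> x = u + i * t)"
proof
  assume "x \<in> prog t u l"
  then obtain i where "i < l" "x = u + int i * t" unfolding prog_def by blast
  then show "\<exists>i. 0 \<le> i \<and> i < int l \<and> x = u + i * t" by (intro exI[of _ "int i"]) simp
next
  assume "\<exists>i. 0 \<le> i \<and> i < int l \<and> x = u + i * t"
  then obtain i where "0 \<le> i" "i < int l" "x = u + i * t" by blast
  then show "x \<in> prog t u l" unfolding prog_def by (intro image_eqI[of _ _ "nat i"]) auto
qed

lemma biprogI_progs:
  "S = prog t u l \<union> prog t v m \<Longrightarrow> 0 < l \<Longrightarrow> 0 < m \<Longrightarrow> card S = l + m \<Longrightarrow> biprog S"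
  unfolding biprog_def by metis

lemma card_insert_zero_pos:
  assumes "finite W" "\<And>x. x \<in> W \<Longrightarrow> 0 < (x::int)"
  shows "card (insert 0 W) = card W + 1"
  using assms by (subst card_insert_disjoint) auto

text \<open>At most two members of \<open>W\<close> may fail to be sums of members, and the minimum
  \<open>p\<close> always fails. Each of the next members \<open>p + D\<close>, \<open>q\<close>,
  \<open>q + D\<close>, ... either uses up the second failure or is a sum, which yields a linear
  equation between \<open>p\<close>, \<open>q\<close> and \<open>D\<close>. A few such equations fix
  the ratios or exhibit the set as two progressions or a triangle.\<close>

lemma progs_insert_zero:
  fixes p q D :: int and l m :: nat
  assumes W: "W = prog D p l \<union> prog D q m" and card: "card W = l + m"
    and lm: "0 < l" "0 < m" and D: "0 < D" and pq: "0 < p" "p < q"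
    and indec: "card (W - sums_of W) \<le> 2"
  shows "structured (insert 0 W)"
proof -
  define S where "S = insert 0 W"
  define L where "L = int l"
  define M where "M = int m"
  have L1: "1 \<le> L" and M1: "1 \<le> M" unfolding L_def M_def using lm by auto
  have fin: "finite W" unfolding W prog_def by simp
  have mem: "x \<in> W \<longleftrightarrow> (\<exists>i. 0 \<le> i \<and> i < L \<and> x = p + i * D) \<or> (\<exists>i. 0 \<le> i \<and> i < M \<and> x = q + i * D)" for x
    unfolding W L_def M_def by (simp add: mem_prog)
  have pI: "p + i * D \<in> W" if "0 \<le> i" "i < L" for i using that mem by blast
  have qI: "q + i * D \<in> W" if "0 \<le> i" "i < M" for i using that mem by blast
  have pos: "0 < x" if "x \<in> W" for x
  proof -
    from that obtain i where i: "0 \<le> i" "x = p + i * D \<or> x = q + i * D" unfolding mem by blast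
    have "0 \<le> i * D" using i(1) D by simp
    then show ?thesis using i(2) pq by linarith
  qed
  have cS: "card S = l + m + 1" unfolding S_def using card_insert_zero_pos[OF fin pos] card by simp
  have sm: "(\<exists>j. 0 \<le> j \<and> j \<le> 2 * L - 2 \<and> x = 2 * p + j * D) \<or>
      (\<exists>j. 0 \<le> j \<and> j \<le> L + M - 2 \<and> x = p + q + j * D) \<or>
      (\<exists>j. 0 \<le> j \<and> j \<le> 2 * M - 2 \<and> x = 2 * q + j * D)" if xs: "x \<in> sums_of W" for x
  proof -
    from xs obtain y z where yz: "y \<in> W" "z \<in> W" "x = y + z" by (rule sums_ofE)
    from yz(1) obtain i where i: "(0 \<le> i \<and> i < L \<and> y = p + i * D) \<or> (0 \<le> i \<and> i < M \<and> y = q + i * D)"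
      unfolding mem by blast
    from yz(2) obtain j where j: "(0 \<le> j \<and> j < L \<and> z = p + j * D) \<or> (0 \<le> j \<and> j < M \<and> z = q + j * D)"
      unfolding mem by blast
    from i j show ?thesis
    proof (elim disjE)
      assume a: "0 \<le> i \<and> i < L \<and> y = p + i * D" "0 \<le> j \<and> j < L \<and> z = p + j * D"
      have "x = 2 * p + (i + j) * D" using a yz(3) by (simp add: algebra_simps)
      moreover have "0 \<le> i + j" "i + j \<le> L + L - 2" using a by simp_all
      ultimately show ?thesis by (intro disjI1 exI[of _ "i + j"]) simp
    next
      assume a: "0 \<le> i \<and> i < L \<and> y = p + i * D" "0 \<le> j \<and> j < M \<and> z = q + j * D"
      have "x = p + q + (i + j) * D" using a yz(3) by (simp add: algebra_simps)
      moreover have "0 \<le> i + j" "i + j \<le> L + M - 2" using a by simp_all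
      ultimately show ?thesis by (intro disjI2 disjI1 exI[of _ "i + j"]) simp
    next
      assume a: "0 \<le> i \<and> i < M \<and> y = q + i * D" "0 \<le> j \<and> j < L \<and> z = p + j * D"
      have "x = p + q + (i + j) * D" using a yz(3) by (simp add: algebra_simps)
      moreover have "0 \<le> i + j" "i + j \<le> M + L - 2" using a by simp_all
      ultimately show ?thesis by (intro disjI2 disjI1 exI[of _ "i + j"]) simp
    next
      assume a: "0 \<le> i \<and> i < M \<and> y = q + i * D" "0 \<le> j \<and> j < M \<and> z = q + j * D"
      have "x = 2 * q + (i + j) * D" using a yz(3) by (simp add: algebra_simps)
      moreover have "0 \<le> i + j" "i + j \<le> M + M - 2" using a by simp_all
      ultimately show ?thesis by (intro disjI2 exI[of _ "i + j"]) simp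
    qed
  qed
  have three: False if "x \<in> W" "y \<in> W" "z \<in> W" "x \<notin> sums_of W" "y \<notin> sums_of W" "z \<notin> sums_of W"
    "x \<noteq> y" "x \<noteq> z" "y \<noteq> z" for x y z
  proof -
    have "card {x, y, z} \<le> card (W - sums_of W)" using that fin by (intro card_mono) auto
    then show False using indec that by simp
  qed
  \<comment> \<open>\<open>e\<close> is a common unit of \<open>p\<close>, \<open>q\<close> and
    \<open>D\<close>. Since \<open>card S = L + M + 1\<close>, indices up to
    \<open>2 * L + 2 * M\<close> are permitted.\<close>
  have shortI: "structured S" if "p = \<alpha> * e" "q = \<beta> * e" "D = \<delta> * e" "0 \<le> \<alpha>" "0 \<le> \<beta>" "0 \<le> \<delta>"
    "\<alpha> + (L - 1) * \<delta> \<le> 2 * L + 2 * M" "\<beta> + (M - 1) * \<delta> \<le> 2 * L + 2 * M" for \<alpha> \<beta> \<delta> e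
  proof -
    have "\<exists>i. 0 \<le> i \<and> i \<le> 2 * int (card S) - 2 \<and> x = 0 + i * e" if "x \<in> S" for x
    proof -
      from that consider "x = 0" | i where "0 \<le> i" "i < L" "x = p + i * D"
        | i where "0 \<le> i" "i < M" "x = q + i * D" unfolding S_def using mem by blast
      then show ?thesis
      proof cases
        case 1 then show ?thesis using cS by (intro exI[of _ 0]) simp
      next
        case (2 i)
        have "i * \<delta> \<le> (L - 1) * \<delta>" "0 \<le> i * \<delta>" using 2 \<open>0 \<le> \<delta>\<close> by (auto intro: mult_right_mono)
        then show ?thesis using 2 \<open>p = _\<close> \<open>D = _\<close> \<open>0 \<le> \<alpha>\<close> \<open>\<alpha> + _ \<le> _\<close> cS unfolding L_def M_def
          by (intro exI[of _ "\<alpha> + i * \<delta>"]) (simp add: algebra_simps)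
      next
        case (3 i)
        have "i * \<delta> \<le> (M - 1) * \<delta>" "0 \<le> i * \<delta>" using 3 \<open>0 \<le> \<delta>\<close> by (auto intro: mult_right_mono)
        then show ?thesis using 3 \<open>q = _\<close> \<open>D = _\<close> \<open>0 \<le> \<beta>\<close> \<open>\<beta> + _ \<le> _\<close> cS unfolding L_def M_def
          by (intro exI[of _ "\<beta> + i * \<delta>"]) (simp add: algebra_simps)
      qed
    qed
    then show ?thesis unfolding structured_def short_def by blast
  qed
  have bi: "structured S" if "S = prog t u a \<union> prog t v b" "0 < a" "0 < b" "a + b = l + m + 1" for t u v a b
    unfolding structured_def using biprogI_progs[OF that(1-3)] that(4) cS by simp
  have p0: "p \<in> W" using pI[of 0] L1 by simp
  have q0: "q \<in> W" using qI[of 0] M1 by simp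
  have nn: "0 \<le> j * D" if "0 \<le> j" for j using that D by simp
  have Fp: "p \<notin> sums_of W"
  proof
    assume "p \<in> sums_of W"
    from sm[OF this] show False using pq nn by fastforce
  qed
  consider "p = D" | "q = D" | "p \<noteq> D" "q \<noteq> D" by blast
  then have "structured S"
  proof cases
    case 1
    have "S = prog D 0 (Suc l) \<union> prog D q m" unfolding S_def W prog_Suc using 1 by simp
    then show ?thesis by (rule bi) (use lm  in simp_all)
  next
    case 2
    have "S = prog D p l \<union> prog D 0 (Suc m)" unfolding S_def W prog_Suc using 2 by simp
    then show ?thesis by (rule bi) (use lm  in simp_all)
  next
    case ne: 3
    \<comment> \<open>Comparison of coefficients: a positive excess \<open>a - b\<close> that is
      made up by at most \<open>c\<close> steps of size \<open>D\<close> is one of \<open>D\<close>,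
      ..., \<open>c * D\<close>. The cases \<open>c = 1, 2, 3\<close> suffice.\<close>
    have one: "a - b = D" if "a + j * D = b + D" "b < a" "0 \<le> j" for a b j
      using step_difference[of a j D b 1] that D by auto
    have two: "a - b = D \<or> (a - b = 2 * D \<and> j = 0)" if ab: "a + j * D = b + 2 * D" "b < a" "0 \<le> j" for a b j
    proof -
      obtain r where r: "1 \<le> r" "r \<le> 2" "a - b = r * D" "j = 2 - r"
        using step_difference[OF ab(1,2) D ab(3)] by blast
      then have "r = 1 \<or> r = 2" by presburger
      then show ?thesis using r by auto
    qed
    have thr: "a - b = D \<or> a - b = 2 * D \<or> a - b = 3 * D" if ab: "a + j * D = b + 3 * D" "b < a" "0 \<le> j" for a b j
    proof -
      obtain r where r: "1 \<le> r" "r \<le> 3" "a - b = r * D"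
        using step_difference[OF ab(1,2) D ab(3)] by blast
      then have "r = 1 \<or> r = 2 \<or> r = 3" by presburger
      then show ?thesis using r by auto
    qed
    have F2: "p + D = 2 * q" if "p + D \<in> sums_of W"
    proof -
      from sm[OF that] consider j where "0 \<le> j" "p + D = 2 * p + j * D" | j where "0 \<le> j" "p + D = p + q + j * D"
        | j where "0 \<le> j" "p + D = 2 * q + j * D" by blast
      then show ?thesis
      proof cases
        case (1 j) then show ?thesis using one[of "2 * p" j p] ne pq by simp
      next
        case (2 j) then show ?thesis using one[of "p + q" j p] ne pq by simp
      next
        case (3 j)
        then have "2 * q - p = D" using pq by (intro one[of "2 * q" j p]) simp_all
        then show ?thesis by linarith
      qed
    qed
    \<comment> \<open>A sum that involves the second progression exceeds \<open>q\<close>, so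
      \<open>q\<close> can only come from two members of the first one.\<close>
    have F3: "\<exists>j. 0 \<le> j \<and> j \<le> 2 * L - 2 \<and> q = 2 * p + j * D" if "q \<in> sums_of W"
    proof -
      have "\<not> (\<exists>j. 0 \<le> j \<and> q = p + q + j * D)" "\<not> (\<exists>j. 0 \<le> j \<and> q = 2 * q + j * D)"
        using nn pq by fastforce+
      then show ?thesis using sm[OF that] by blast
    qed
    have F4: "\<exists>j. 0 \<le> j \<and> j \<le> 2 * L - 2 \<and> q + D = 2 * p + j * D" if "q + D \<in> sums_of W"
    proof -
      have "\<not> (\<exists>j. 0 \<le> j \<and> q + D = p + q + j * D)" using one[of "p + q" _ q] ne pq by fastforce
      moreover have "\<not> (\<exists>j. 0 \<le> j \<and> q + D = 2 * q + j * D)" using one[of "2 * q" _ q] ne pq by fastforce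
      ultimately show ?thesis using sm[OF that] by blast
    qed
    have p1W: "p + D \<in> W" if "2 \<le> L" using pI[of 1] that by simp
    have p2W: "p + 2 * D \<in> W" if "3 \<le> L" using pI[of 2] that by simp
    have q1W: "q + D \<in> W" if "2 \<le> M" using qI[of 1] that by simp
    have q2W: "q + 2 * D \<in> W" if "3 \<le> M" using qI[of 2] that by simp
    have A1: "W = insert p (prog D q m)" if "L = 1" using that unfolding W L_def by (simp add: prog_1)
    have A2: "W = insert p (insert (p + D) (prog D q m))" if "L = 2"
    proof -
      have "l = 2" using that unfolding L_def by simp
      then show ?thesis unfolding W by (simp add: prog_2)
    qed
    have B1: "prog D q m = {q}" if "M = 1" using that unfolding M_def by (simp add: prog_1)
    have B2: "prog D q m = {q, q + D}" if "M = 2"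
    proof -
      have "m = 2" using that unfolding M_def by simp
      then show ?thesis by (simp add: prog_2)
    qed
    have B3: "prog D q m = {q, q + D, q + 2 * D}" if "M = 3"
    proof -
      have "m = 3" using that unfolding M_def by simp
      then show ?thesis by (simp add: prog_3)
    qed
    have P2: "p = 2 * D \<or> q = 2 * D \<or> 2 * q = p + 2 * D"
      if "p + 2 * D \<in> sums_of W" "p + D \<noteq> 2 * q"
    proof -
      from sm[OF that(1)] consider j where "0 \<le> j" "p + 2 * D = 2 * p + j * D"
        | j where "0 \<le> j" "p + 2 * D = p + q + j * D"
        | j where "0 \<le> j" "p + 2 * D = 2 * q + j * D" by blast
      then show ?thesis
      proof cases
        case (1 j) then show ?thesis using two[of "2 * p" j p] ne pq by simp
      next
        case (2 j) then show ?thesis using two[of "p + q" j p] ne pq by simp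
      next
        case (3 j) then show ?thesis using two[of "2 * q" j p] pq that(2) by simp
      qed
    qed
    consider (c1) "L = 1" | (c2) "2 \<le> L" "M = 1" | (c3) "2 \<le> L" "2 \<le> M" using L1 M1 by linarith
    then show ?thesis
    proof cases
      case c1
      have l1: "l = 1" using c1 unfolding L_def by simp
      show ?thesis
      proof (cases "M = 1")
        case True
        then have "S = prog p 0 2 \<union> prog p q (Suc 0)" unfolding S_def A1[OF c1] B1[OF True] prog_1 prog_2 by auto
        then show ?thesis by (rule bi) (use l1 True M_def in simp_all)
      next
        case False
        then have M2: "2 \<le> M" using M1 by simp
        \<comment> \<open>The first progression is the point \<open>p\<close> and contributes only
          \<open>2 * p\<close>. As \<open>p\<close>, \<open>q\<close>, \<open>q + D\<close> cannot
          all fail, one of the last two equals \<open>2 * p\<close>.\<close>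
        have qD: "q = 2 * p \<or> q + D = 2 * p"
        proof (rule ccontr)
          assume no: "\<not> ?thesis"
          have "q \<notin> sums_of W" using F3 no c1 by fastforce
          moreover have "q + D \<notin> sums_of W" using F4 no c1 by fastforce
          ultimately show False using three[OF p0 q0 q1W[OF M2] Fp] pq D by simp
        qed
        show ?thesis
        proof (cases "M = 2")
          case True
          have S: "S = {0, p, q, q + D}" unfolding S_def A1[OF c1] B2[OF True] by auto
          from qD have "S = prog p 0 3 \<union> prog p (if q = 2 * p then q + D else q) (Suc 0)"
            unfolding S prog_1 prog_3 by auto
          then show ?thesis by (rule bi) (use l1 True M_def in simp_all)
        next
          case False
          then have M3: "3 \<le> M" using M2 by simp
          have "q + 2 * D \<in> sums_of W"
          proof (rule ccontr)
            assume no: "q + 2 * D \<notin> sums_of W"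
            from qD show False
            proof
              assume "q = 2 * p"
              then have "q + D \<notin> sums_of W" using F4 c1 D by fastforce
              then show False using three[OF p0 q1W[OF M2] q2W[OF M3] Fp _ no] pq D by simp
            next
              assume "q + D = 2 * p"
              then have "q \<notin> sums_of W" using F3 c1 D by fastforce
              then show False using three[OF p0 q0 q2W[OF M3] Fp _ no] pq D by simp
            qed
          qed
          from sm[OF this] consider "q + 2 * D = 2 * p"
            | j where "0 \<le> j" "q + 2 * D = p + q + j * D" | j where "0 \<le> j" "q + 2 * D = 2 * q + j * D"
            using c1 by fastforce
          then have "p = 2 * D \<or> q = 2 * D"
          proof cases
            case 1 then show ?thesis using qD D by auto
          next
            case (2 j) then show ?thesis using two[of "p + q" j q] ne pq by simp
          next
            case (3 j) then show ?thesis using two[of "2 * q" j q] ne pq by simp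
          qed
          then show ?thesis
          proof
            assume p2: "p = 2 * D"
            then have "q = 4 * D \<or> q = 3 * D" using qD by linarith
            then show ?thesis using shortI[of 2 D 4 1] shortI[of 2 D 3 1] p2 c1 M1 by auto
          next
            assume q2: "q = 2 * D"
            then have "q + D = 2 * p" using qD ne by auto
            \<comment> \<open>Here \<open>2 * p = 3 * D\<close>, so half of \<open>D\<close>, which
              is \<open>p - D\<close>, serves as the unit.\<close>
            then have "p = 3 * (p - D)" "q = 4 * (p - D)" "D = 2 * (p - D)" using q2 by presburger+
            then show ?thesis using shortI[of 3 "p - D" 4 2] c1 M1 by simp
          qed
        qed
      qed
    next
      case c2
      have m1: "m = 1" using c2 unfolding M_def by simp
      show ?thesis
      proof (cases "p + D = 2 * q")
        case pD: True
        then have Dq: "q < D" using pq by simp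
        show ?thesis
        proof (cases "q = 2 * p")
          case True
          then have D3: "D = 3 * p" using pD by simp
          \<comment> \<open>In units of \<open>p\<close> the first progression is 1 + 3i, while the
            sums are 2 + 3j, 3 + 3j and the single value 4. So all its members from
            \<open>i = 2\<close> on fail, and the progression cannot be long.\<close>
          have no: "p + i * D \<notin> sums_of W" if "2 \<le> i" for i
          proof
            assume "p + i * D \<in> sums_of W"
            from sm[OF this] obtain j where "p + i * D = 2 * p + j * D \<or> p + i * D = p + q + j * D \<or> p + i * D = 2 * q"
              using c2(2) by fastforce
            then have "(1 + 3 * i) * p = (2 + 3 * j) * p \<or> (1 + 3 * i) * p = (3 + 3 * j) * p \<or> (1 + 3 * i) * p = 4 * p"
              unfolding D3 True by (simp add: algebra_simps)
            then have "1 + 3 * i = 2 + 3 * j \<or> 1 + 3 * i = 3 + 3 * j \<or> 1 + 3 * i = 4" using pq by simp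
            then show False using that by presburger
          qed
          have "L \<le> 3"
          proof (rule ccontr)
            assume "\<not> L \<le> 3"
            then show False using three[OF p0 pI[of 2] pI[of 3] Fp no[of 2] no[of 3]] D by simp
          qed
          then show ?thesis using shortI[of 1 p 2 3] True D3 c2 by simp
        next
          case False
          have "q \<notin> sums_of W"
          proof
            assume "q \<in> sums_of W"
            then obtain j where j: "0 \<le> j" "q = 2 * p + j * D" using F3 by blast
            then have "j \<noteq> 0" using False by auto
            then have "1 * D \<le> j * D" using j D by (intro mult_right_mono) auto
            then show False using j Dq pq by linarith
          qed
          note nq = this
          show ?thesis
          proof (cases "L = 2")
            case True
            have "S = {0, p, p + D, q}" unfolding S_def A2[OF True] B1[OF c2(2)] by auto
            then have "S = prog q 0 3 \<union> prog q p (Suc 0)" unfolding prog_1 prog_3 using pD by auto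
            then show ?thesis by (rule bi) (use True m1 L_def in simp_all)
          next
            case False
            then have L3: "3 \<le> L" using c2 by simp
            have "p + 2 * D \<in> sums_of W"
            proof (rule ccontr)
              assume "p + 2 * D \<notin> sums_of W"
              then show False using three[OF p0 q0 p2W[OF L3] Fp nq] pq D pD by simp
            qed
            from sm[OF this] consider j where "0 \<le> j" "p + 2 * D = 2 * p + j * D"
              | j where "0 \<le> j" "p + 2 * D = p + q + j * D" | "p + 2 * D = 2 * q" using c2(2) by fastforce
            then show ?thesis
            proof cases
              case (1 j) then show ?thesis using two[of "2 * p" j p] pq Dq by simp
            next
              case (2 j) then show ?thesis using two[of "p + q" j p] pq Dq by simp
            next
              case 3 then show ?thesis using pD D by simp
            qed
          qed
        qed
      next
        case npD: False
        then have np1: "p + D \<notin> sums_of W" using F2 by blast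
        have "q \<in> sums_of W"
        proof (rule ccontr)
          assume nq: "q \<notin> sums_of W"
          have "q = p + D"
          proof (rule ccontr)
            assume "q \<noteq> p + D"
            then show False using three[OF p0 p1W[OF c2(1)] q0 Fp np1 nq] pq D by simp
          qed
          moreover have "card W < l + m"
          proof -
            have "prog D q m = {p + D}" using B1[OF c2(2)] calculation by simp
            moreover have "p + D \<in> prog D p l" unfolding mem_prog using c2(1) unfolding L_def by (intro exI[of _ 1]) simp
            ultimately have "W = prog D p l" unfolding W by auto
            moreover have "card (prog D p l) \<le> l" unfolding prog_def by (rule order_trans[OF card_image_le]) simp_all
            ultimately show ?thesis using lm by simp
          qed
          ultimately show False using card by simp
        qed
        then obtain j where j: "0 \<le> j" "j \<le> 2 * L - 2" "q = 2 * p + j * D" using F3 by blast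
        show ?thesis
        proof (cases "L = 2")
          case True
          have S: "S = {0, p, p + D, q}" unfolding S_def A2[OF True] B1[OF c2(2)] by auto
          have l2: "l = 2" using True unfolding L_def by simp
          have "j = 0 \<or> j = 1 \<or> j = 2" using j True by presburger
          then show ?thesis
          proof (elim disjE)
            assume "j = 0"
            then have "S = prog p 0 3 \<union> prog p (p + D) (Suc 0)" unfolding S prog_1 prog_3 using j by auto
            then show ?thesis by (rule bi) (use l2 m1  in simp_all)
          next
            assume "j = 1"
            then have "S = prog p 0 2 \<union> prog p (p + D) 2" unfolding S prog_2 using j by auto
            then show ?thesis by (rule bi) (use l2 m1  in simp_all)
          next
            assume "j = 2"
            then have "S = prog (p + D) 0 3 \<union> prog (p + D) p (Suc 0)" unfolding S prog_1 prog_3 using j by auto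
            then show ?thesis by (rule bi) (use l2 m1  in simp_all)
          qed
        next
          case False
          then have L3: "3 \<le> L" using c2 by simp
          have "p + 2 * D \<in> sums_of W"
          proof (rule ccontr)
            assume "p + 2 * D \<notin> sums_of W"
            then show False using three[OF p0 p1W[OF c2(1)] p2W[OF L3] Fp np1] D by simp
          qed
          from P2[OF this npD] show ?thesis
          proof (elim disjE)
            assume p2: "p = 2 * D"
            have "q = (4 + j) * D" unfolding j(3) p2 by (simp add: algebra_simps)
            then show ?thesis by (rule shortI[OF p2, where \<delta> = 1]) (use j(1,2) c2 in simp_all)
          next
            assume q2: "q = 2 * D"
            then have "2 * p + j * D = 0 + 2 * D" using j(3) by simp
            then have "2 * p = D" using two[of "2 * p" j 0] j(1) pq ne by auto
            then have "D = 2 * p" "q = 4 * p" using q2 by simp_all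
            then show ?thesis by (intro shortI[of 1 p 4 2]) (use c2 L3 in simp_all)
          next
            assume q2: "2 * q = p + 2 * D"
            have "3 * p + 2 * (j * D) = 2 * D" using q2 j(3) by linarith
            then have "3 * p + (2 * j) * D = 0 + 2 * D" by (simp add: mult.assoc)
            then have "3 * p = D \<or> (3 * p = 2 * D \<and> 2 * j = 0)" using two[of "3 * p" "2 * j" 0] j(1) pq by auto
            moreover have "3 * p \<noteq> D"
            proof
              assume "3 * p = D"
              then have D3: "D = 3 * p" by simp
              have "2 * q = 7 * p" using q2 unfolding D3 by simp
              moreover have "2 * q = (4 + 6 * j) * p" unfolding j(3) D3 by (simp add: algebra_simps)
              ultimately have "7 * p = (4 + 6 * j) * p" by simp
              then have "7 = 4 + 6 * j" using pq by simp
              then show False by presburger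
            qed
            ultimately have p3: "3 * p = 2 * D" "j = 0" by auto
            \<comment> \<open>From \<open>3 * p = 2 * D\<close> the common unit is
              \<open>D - p\<close>, half of \<open>p\<close> and a third of
              \<open>D\<close>.\<close>
            define e where "e = D - p"
            have e: "D = 3 * e" "p = 2 * e" "q = 4 * e" unfolding e_def using p3 j(3) by simp_all
            have e0: "0 < e" using e pq by simp
            have "L \<le> 3"
            proof (rule ccontr)
              assume "\<not> L \<le> 3"
              then have p3W: "p + 3 * D \<in> W" by (intro pI) auto
              have "p + 3 * D \<notin> sums_of W"
              proof
                assume "p + 3 * D \<in> sums_of W"
                from sm[OF this] obtain j where "p + 3 * D = 2 * p + j * D \<or> p + 3 * D = p + q + j * D \<or> p + 3 * D = 2 * q"
                  using c2(2) by fastforce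
                then have "11 * e = (4 + 3 * j) * e \<or> 11 * e = (6 + 3 * j) * e \<or> 11 * e = 8 * e"
                  unfolding e by (simp add: algebra_simps)
                then have "11 = 4 + 3 * j \<or> 11 = 6 + 3 * j \<or> (11::int) = 8" using e0 by simp
                then show False by presburger
              qed
              then show False using three[OF p0 p1W[OF c2(1)] p3W Fp np1] D by simp
            qed
            then show ?thesis using shortI[of 2 e 4 3] e c2 by simp
          qed
        qed
      qed
    next
      case c3
      show ?thesis
      proof (cases "p + D = 2 * q")
        case pD: True
        then have Dq: "q < D" using pq by simp
        have q2: "q = 2 * p"
        proof (rule ccontr)
          assume nq: "q \<noteq> 2 * p"
          have big: "D \<le> j * D" if "1 \<le> j" for j using that D by simp
          have "q \<notin> sums_of W"
          proof
            assume "q \<in> sums_of W"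
            then obtain j where j: "0 \<le> j" "q = 2 * p + j * D" using F3 by blast
            then have "j \<noteq> 0" using nq by auto
            then show False using big[of j] j Dq pq by linarith
          qed
          moreover have "q + D \<notin> sums_of W"
          proof
            assume "q + D \<in> sums_of W"
            then obtain j where j: "0 \<le> j" "q + D = 2 * p + j * D" using F4 by blast
            have "j \<noteq> 0" using j pD pq by auto
            moreover have "j \<noteq> 1" using j nq by auto
            ultimately have "1 \<le> j - 1" using j by simp
            then have "D \<le> (j - 1) * D" by (rule big)
            moreover have "q = 2 * p + (j - 1) * D" using j by (simp add: algebra_simps)
            ultimately show False using Dq pq by linarith
          qed
          ultimately show False using three[OF p0 q0 q1W[OF c3(2)] Fp] pq D by simp
        qed
        then have D3: "D = 3 * p" using pD by simp
        have cases3: "(\<exists>j. x = (2 + 3 * j) \<and> j \<le> 2 * L - 2) \<or> (\<exists>j. x = 3 + 3 * j) \<or> (\<exists>j. x = 4 + 3 * j \<and> j \<le> 2 * M - 2)"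
          if "x * p \<in> sums_of W" for x
        proof -
          from sm[OF that] have "(\<exists>j. j \<le> 2 * L - 2 \<and> x * p = (2 + 3 * j) * p) \<or> (\<exists>j. x * p = (3 + 3 * j) * p) \<or>
            (\<exists>j. j \<le> 2 * M - 2 \<and> x * p = (4 + 3 * j) * p)"
            unfolding q2 D3 by (auto simp: algebra_simps)
          then show ?thesis using pq by auto
        qed
        \<comment> \<open>In units of \<open>p\<close> the first progression is 1 + 3i, and sums in
          this residue class come only from two members of the second progression, so they end at
          \<open>i = 2 * M - 1\<close>. Two members beyond that, together with \<open>p\<close>,
          would be three failures.\<close>
        have Lb: "L \<le> 2 * M + 1"
        proof (rule ccontr)
          assume "\<not> L \<le> 2 * M + 1"
          have no: "p + i * D \<notin> sums_of W" if "2 * M \<le> i" for i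
          proof
            assume "p + i * D \<in> sums_of W"
            then have "(1 + 3 * i) * p \<in> sums_of W" unfolding D3 by (simp add: algebra_simps)
            from cases3[OF this] show False using that by presburger
          qed
          have ne2: "p \<noteq> p + 2 * M * D" "p \<noteq> p + (2 * M + 1) * D" "p + 2 * M * D \<noteq> p + (2 * M + 1) * D"
            using D M1 by auto
          show False using three[OF p0 pI[of "2 * M"] pI[of "2 * M + 1"] Fp no[of "2 * M"] no[of "2 * M + 1"] ne2]
            \<open>\<not> L \<le> 2 * M + 1\<close> M1 by simp
        qed
        have Mb: "M \<le> 2 * L"
        proof (rule ccontr)
          assume "\<not> M \<le> 2 * L"
          have no: "q + i * D \<notin> sums_of W" if "2 * L - 1 \<le> i" for i
          proof
            assume "q + i * D \<in> sums_of W"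
            then have "(2 + 3 * i) * p \<in> sums_of W" unfolding D3 q2 by (simp add: algebra_simps)
            from cases3[OF this] show False using that by presburger
          qed
          have "0 \<le> (2 * L - 1) * D" "0 \<le> 2 * L * D" using L1 D by auto
          then have ne2: "p \<noteq> q + (2 * L - 1) * D" "p \<noteq> q + 2 * L * D" "q + (2 * L - 1) * D \<noteq> q + 2 * L * D"
            using D pq by auto
          show False using three[OF p0 qI[of "2 * L - 1"] qI[of "2 * L"] Fp no[of "2 * L - 1"] no[of "2 * L"] ne2]
            \<open>\<not> M \<le> 2 * L\<close> L1 by simp
        qed
        show ?thesis using shortI[of 1 p 2 3] q2 D3 Lb Mb by simp
      next
        case npD: False
        then have np1: "p + D \<notin> sums_of W" using F2 by blast
        have others: "x \<in> sums_of W" if "x \<in> W" "x \<noteq> p" "x \<noteq> p + D" for x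
        proof (rule ccontr)
          assume "x \<notin> sums_of W"
          then show False using three[OF p0 p1W[OF c3(1)] that(1) Fp np1] that D by simp
        qed
        have qne: "q + i * D \<noteq> p + D" "q + i * D \<noteq> p" if "0 \<le> i" "i < M" for i
        proof -
          have disj: "prog D p l \<inter> prog D q m = {}"
          proof -
            have c: "card (prog D p l) = l" "card (prog D q m) = m" using card_prog D by auto
            have "finite (prog D p l)" "finite (prog D q m)" unfolding prog_def by auto
            then have "card (prog D p l \<inter> prog D q m) = 0"
              using card_Un_Int[of "prog D p l" "prog D q m"] c card unfolding W by simp
            then show ?thesis using \<open>finite (prog D p l)\<close> by simp
          qed
          have "q + i * D \<in> prog D q m" using that unfolding mem_prog M_def by blast
          moreover have "p + D \<in> prog D p l" unfolding mem_prog using c3(1) unfolding L_def by (intro exI[of _ 1]) simp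
          moreover have "p \<in> prog D p l" unfolding mem_prog using c3(1) unfolding L_def by (intro exI[of _ 0]) simp
          ultimately show "q + i * D \<noteq> p + D" "q + i * D \<noteq> p" using disj by auto
        qed
        have qs: "q + i * D \<in> sums_of W" if "0 \<le> i" "i < M" for i
          using others[OF qI[OF that] qne(2,1)[OF that]] .
        have "q \<in> sums_of W" using qs[of 0] M1 by simp
        then obtain j where j: "0 \<le> j" "q = 2 * p + j * D" using F3 by blast
        have "q + D \<in> sums_of W" using qs[of 1] c3 by simp
        then obtain j' where j': "0 \<le> j'" "j' \<le> 2 * L - 2" "q + D = 2 * p + j' * D" using F4 by blast
        have "(j + 1) * D = j' * D" using j j' by (simp add: algebra_simps)
        then have jL: "j \<le> 2 * L - 3" using D j' by simp
        show ?thesis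
        proof (cases "L = 2")
          case True
          have l2: "l = 2" using True unfolding L_def by simp
          have j01: "j = 0 \<or> j = 1" using j jL True by presburger
          \<comment> \<open>For \<open>L = 2\<close> the sums of two members of the first
            progression end at \<open>2 * p + 2 * D\<close>. The member
            \<open>q + r * D = 2 * p + 3 * D\<close> must be a sum of another kind, which determines
            \<open>p\<close> relative to \<open>D\<close>.\<close>
          have deep: "structured S" if r: "0 \<le> r" "r < M" "j + r = 3" for r
          proof -
            have "j * D + r * D = 3 * D" unfolding distrib_right[symmetric] r(3) ..
            then have e: "q + r * D = 2 * p + 3 * D" using j(2) by linarith
            have in3: "2 * p + 3 * D \<in> sums_of W" using qs[OF r(1,2)] e by simp
            have "p = 2 * D \<or> 2 * p = D \<or> (j = 0 \<and> (p = 3 * D \<or> 2 * p = 3 * D))"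
            proof -
              from sm[OF in3] consider i where "0 \<le> i" "i \<le> 2" "2 * p + 3 * D = 2 * p + i * D"
                | i where "0 \<le> i" "2 * p + 3 * D = p + q + i * D" | i where "0 \<le> i" "2 * p + 3 * D = 2 * q + i * D"
                using True by auto
              then show ?thesis
              proof cases
                case (1 i)
                then have "(3 - i) * D = 0" by (simp add: algebra_simps)
                then show ?thesis using 1 D by simp
              next
                case (2 i)
                show ?thesis
                proof (cases "j = 0")
                  case True
                  then have "p + i * D = 0 + 3 * D" using 2 j by simp
                  then show ?thesis using thr[of p i 0] 2(1) pq ne True by auto
                next
                  case False
                  then have "p + i * D = 0 + 2 * D" using 2 j j01 by (simp add: algebra_simps)
                  then show ?thesis using two[of p i 0] 2(1) pq ne by auto
                qed
              next
                case (3 i)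
                show ?thesis
                proof (cases "j = 0")
                  case True
                  then have "2 * p + i * D = 0 + 3 * D" using 3 j by simp
                  then show ?thesis using thr[of "2 * p" i 0] 3(1) pq ne True by auto
                next
                  case False
                  then have "2 * p + i * D = 0 + D" using 3 j j01 by (simp add: algebra_simps)
                  then show ?thesis using one[of "2 * p" i 0] 3(1) pq by auto
                qed
              qed
            qed
            then show ?thesis
            proof (elim disjE conjE)
              assume p2: "p = 2 * D"
              have "q = (4 + j) * D" unfolding j(2) p2 by (simp add: algebra_simps)
              then show ?thesis by (rule shortI[OF p2, where \<delta> = 1]) (use j(1) j01 c3 True in auto)
            next
              assume p2: "2 * p = D"
              have "q = (2 + 2 * j) * p" unfolding j(2) p2[symmetric] by (simp add: algebra_simps)
              moreover have "p = 1 * p" by simp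
              ultimately show ?thesis by (intro shortI[of 1 p "2 + 2 * j" 2]) (use p2 j01 c3 True in auto)
            next
              assume "j = 0" "p = 3 * D"
              then show ?thesis using shortI[of 3 D 6 1] j c3 True by auto
            next
              assume "j = 0" "2 * p = 3 * D"
              then have "p = 3 * (p - D)" "q = 6 * (p - D)" "D = 2 * (p - D)" using j by presburger+
              then show ?thesis by (rule shortI) (use c3 True in simp_all)
            qed
          qed
          consider "M = 2" | "M = 3" "j = 0" | "3 \<le> M" "j = 1" | "4 \<le> M" "j = 0" using c3 j01 by linarith
          then show ?thesis
          proof cases
            case 1
            have m2: "m = 2" using 1 unfolding M_def by simp
            have S: "S = {0, p, p + D, q, q + D}" unfolding S_def A2[OF True] B2[OF 1] by auto
            from j01 show ?thesis
            proof
              assume "j = 0"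
              then have "S = prog p 0 3 \<union> prog p (p + D) 2" unfolding S prog_2 prog_3 using j by auto
              then show ?thesis by (rule bi) (use l2 m2  in simp_all)
            next
              assume "j = 1"
              then have "S = prog (p + D) 0 3 \<union> prog (p + D) p 2" unfolding S prog_2 prog_3 using j by auto
              then show ?thesis by (rule bi) (use l2 m2  in simp_all)
            qed
          next
            case 2
            have m3: "m = 3" using 2 unfolding M_def by simp
            \<comment> \<open>With \<open>q = 2 * p\<close> this is the exceptional triangle with
              corner 0 and generators \<open>p\<close> and \<open>p + D\<close>.\<close>
            have "S = {0, p, p + D, q, q + D, q + 2 * D}" unfolding S_def A2[OF True] B3[OF 2(1)] by auto
            also have "\<dots> = {0, 0 + p, 0 + (p + D), 0 + 2 * p, 0 + p + (p + D), 0 + 2 * (p + D)}"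
              using j 2 by (simp add: algebra_simps)
            finally have "S = {0, 0 + p, 0 + (p + D), 0 + 2 * p, 0 + p + (p + D), 0 + 2 * (p + D)}" .
            then have "triangle S" unfolding triangle_def using cS l2 m3 by fastforce
            then show ?thesis unfolding structured_def by blast
          next
            case 3 then show ?thesis by (intro deep[of 2]) auto
          next
            case 4 then show ?thesis by (intro deep[of 3]) auto
          qed
        next
          case False
          then have L3: "3 \<le> L" using c3 by simp
          have "p + 2 * D \<in> sums_of W" using others[OF p2W[OF L3]] D by simp
          from P2[OF this npD] show ?thesis
          proof (elim disjE)
            assume p2: "p = 2 * D"
            have "q = (4 + j) * D" unfolding j(2) p2 by (simp add: algebra_simps)
            then show ?thesis by (rule shortI[OF p2, where \<delta> = 1]) (use j(1) jL c3 in simp_all)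
          next
            assume q2: "q = 2 * D"
            then have "2 * p + j * D = 0 + 2 * D" using j(2) by simp
            then have "2 * p = D" using two[of "2 * p" j 0] j(1) pq ne by auto
            then have "D = 2 * p" "q = 4 * p" using q2 by simp_all
            then show ?thesis by (intro shortI[of 1 p 4 2]) (use c3 L3 in simp_all)
          next
            assume q2: "2 * q = p + 2 * D"
            have "3 * p + 2 * (j * D) = 2 * D" using q2 j(2) by linarith
            then have "3 * p + (2 * j) * D = 0 + 2 * D" by (simp add: mult.assoc)
            then have "3 * p = D \<or> (3 * p = 2 * D \<and> 2 * j = 0)" using two[of "3 * p" "2 * j" 0] j(1) pq by auto
            moreover have "3 * p \<noteq> D"
            proof
              assume "3 * p = D"
              then have D3: "D = 3 * p" by simp
              have "2 * q = 7 * p" using q2 unfolding D3 by simp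
              moreover have "2 * q = (4 + 6 * j) * p" unfolding j(2) D3 by (simp add: algebra_simps)
              ultimately have "7 * p = (4 + 6 * j) * p" by simp
              then have "7 = 4 + 6 * j" using pq by simp
              then show False by presburger
            qed
            ultimately have p3: "3 * p = 2 * D" "j = 0" by auto
            define e where "e = D - p"
            have e: "D = 3 * e" "p = 2 * e" "q = 4 * e" unfolding e_def using p3 j(2) by simp_all
            have e0: "0 < e" using e pq by simp
            have cases3: "(\<exists>j. x = (4 + 3 * j) \<and> j \<le> 2 * L - 2) \<or> (\<exists>j. x = 6 + 3 * j) \<or> (\<exists>j. x = 8 + 3 * j \<and> j \<le> 2 * M - 2)"
              if "x * e \<in> sums_of W" for x
            proof -
              from sm[OF that] have "(\<exists>j. j \<le> 2 * L - 2 \<and> x * e = (4 + 3 * j) * e) \<or> (\<exists>j. x * e = (6 + 3 * j) * e) \<or>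
                (\<exists>j. j \<le> 2 * M - 2 \<and> x * e = (8 + 3 * j) * e)"
                unfolding e by (auto simp: algebra_simps)
              then show ?thesis using e0 by auto
            qed
            have "p + (L - 1) * D \<in> sums_of W"
            proof (rule others[OF pI])
              have "1 * D < (L - 1) * D" using L3 D by (intro mult_strict_right_mono) auto
              then show "p + (L - 1) * D \<noteq> p" "p + (L - 1) * D \<noteq> p + D" using D by auto
            qed (use L1 in auto)
            then have "(2 + 3 * (L - 1)) * e \<in> sums_of W" unfolding e by (simp add: algebra_simps)
            from cases3[OF this] have Lb: "L \<le> 2 * M + 1" by presburger
            have "q + (M - 1) * D \<in> sums_of W" using qs[of "M - 1"] M1 by simp
            then have "(4 + 3 * (M - 1)) * e \<in> sums_of W" unfolding e by (simp add: algebra_simps)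
            from cases3[OF this] have Mb: "M \<le> 2 * L - 1" by presburger
            show ?thesis using shortI[of 2 e 4 3] e Lb Mb by simp
          qed
        qed
      qed
    qed
  qed
  then show ?thesis unfolding S_def .
qed

lemma finite_prog: "finite (prog t u l)"
  unfolding prog_def by simp

lemma prog_start: "0 < l \<Longrightarrow> u \<in> prog t u l"
  unfolding mem_prog by (intro exI[of _ 0]) simp

lemma biprog_insert_zero:
  assumes "biprog W" "\<And>x. x \<in> W \<Longrightarrow> 0 < x" "card (W - sums_of W) \<le> 2"
  shows "structured (insert 0 W)"
proof -
  obtain t u v l m where lm: "0 < l" "0 < m" "l + m = card W" and W: "W = prog t u l \<union> prog t v m"
    using assms(1) unfolding biprog_def by blast
  have "\<exists>D u v. 0 < D \<and> W = prog D u l \<union> prog D v m"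
  proof (cases t "0 :: int" rule: linorder_cases)
    case less
    have "W = prog (- t) (u + (int l - 1) * t) l \<union> prog (- t) (v + (int m - 1) * t) m"
      unfolding W using prog_reverse[of t u l] prog_reverse[of t v m] by simp
    moreover have "0 < - t" using less by simp
    ultimately show ?thesis by blast
  next
    case equal
    then have "W \<subseteq> {u, v}" unfolding W prog_def by auto
    then have "card W \<le> card {u, v}" by (intro card_mono) auto
    also have "card {u, v} \<le> 2" by (simp add: card_insert_if)
    finally have "l = Suc 0" "m = Suc 0" using lm by simp_all
    then have "W = prog 1 u l \<union> prog 1 v m" unfolding W by (simp add: prog_1)
    then show ?thesis using zero_less_one by blast
  next
    case greater then show ?thesis using W by blast
  qed
  then obtain D u v where D: "0 < D" and W: "W = prog D u l \<union> prog D v m" by blast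
  have c: "card (prog D u l) = l" "card (prog D v m) = m" using card_prog D by auto
  have "card (prog D u l \<inter> prog D v m) = 0"
    using card_Un_Int[OF finite_prog finite_prog, of D u l D v m] c lm(3) unfolding W by simp
  then have "prog D u l \<inter> prog D v m = {}" using finite_prog by simp
  moreover have uv: "u \<in> prog D u l" "v \<in> prog D v m" using prog_start lm by auto
  ultimately have "u \<noteq> v" by auto
  moreover have "0 < u" "0 < v" using assms(2) uv unfolding W by blast+
  ultimately consider "0 < u" "u < v" | "0 < v" "v < u" by linarith
  then show ?thesis
  proof cases
    case 1
    then show ?thesis using progs_insert_zero[OF W _ lm(1,2) D _ _ assms(3)] lm(3) by simp
  next
    case 2
    have "W = prog D v m \<union> prog D u l" using W by blast
    then show ?thesis using progs_insert_zero[OF _ _ lm(2,1) D 2 assms(3)] lm(3) by simp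
  qed
qed

text \<open>Failures are counted as for two progressions. Only two being available, the equations
  fix the ratios of the smallest corner and the two generators, and the seven points are short in
  every case.\<close>

lemma triangle_insert_zero:
  assumes "triangle W" "\<And>x. x \<in> W \<Longrightarrow> 0 < x" "card (W - sums_of W) \<le> 2"
  shows "structured (insert 0 W)"
proof -
  define tri where "tri u a b = {u, u + a, u + b, u + 2 * a, u + a + b, u + 2 * b}" for u a b :: int
  \<comment> \<open>A triangle can be described from each of its corners; the smallest one, with
    generators \<open>0 < a < b\<close>, is selected.\<close>
  have swap: "tri u a b = tri u b a" for u a b unfolding tri_def by auto
  have rot: "tri u a b = tri (u + 2 * a) (- a) (b - a)" for u a b
    unfolding tri_def by (auto simp: algebra_simps)
  obtain u a b where W0: "W = tri u a b" and c6: "card W = 6"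
    using assms(1) unfolding triangle_def tri_def by blast
  have ab: "a \<noteq> 0" "b \<noteq> 0" "a \<noteq> b" "b \<noteq> 2 * a" "a \<noteq> 2 * b"
    using c6 unfolding W0 tri_def by (auto simp: card_insert_if split: if_splits)
  have "\<exists>v a b. 0 < a \<and> a < b \<and> W = tri v a b"
  proof -
    have pos: "\<exists>v a b. 0 < a \<and> a < b \<and> W = tri v a b" if "W = tri v a b" "0 < a" "0 < b" "a \<noteq> b" for v a b
      using that swap[of v a b] by (cases "a < b") (auto simp: not_less order_le_less)
    consider "0 < a" "0 < b" | "a < 0" "a < b" | "b < 0" "b < a" using ab by linarith
    then show ?thesis
    proof cases
      case 1 then show ?thesis using pos[OF W0] ab by blast
    next
      case 2 then show ?thesis using pos[of "u + 2 * a" "- a" "b - a"] W0 rot[of u a b] ab by simp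
    next
      case 3
      have "W = tri (u + 2 * b) (- b) (a - b)" using W0 rot[of u b a] swap[of u a b] by simp
      then show ?thesis using pos 3 ab by simp
    qed
  qed
  then obtain v a b where ab: "0 < a" "a < b" and W: "W = {v, v + a, v + b, v + 2 * a, v + a + b, v + 2 * b}"
    unfolding tri_def by blast
  have fin: "finite W" unfolding W by simp
  have v0: "0 < v" using assms(2) unfolding W by blast
  have b2a: "b \<noteq> 2 * a" using c6 unfolding W by (auto simp: card_insert_if split: if_splits)
  have cS: "card (insert 0 W) = 7" using card_insert_zero_pos[OF fin assms(2)] c6 by simp
  have sm: "z = 2*v \<or> z = 2*v+a \<or> z = 2*v+b \<or> z = 2*v+2*a \<or> z = 2*v+a+b \<or> z = 2*v+2*b \<or> z = 2*v+3*a \<or>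
      z = 2*v+2*a+b \<or> z = 2*v+a+2*b \<or> z = 2*v+3*b \<or> z = 2*v+4*a \<or> z = 2*v+3*a+b \<or> z = 2*v+2*a+2*b \<or>
      z = 2*v+a+3*b \<or> z = 2*v+4*b" if zs: "z \<in> sums_of W" for z
  proof -
    from zs obtain x y where "x \<in> W" "y \<in> W" "z = x + y" by (rule sums_ofE)
    then show ?thesis unfolding W by (elim insertE emptyE) simp_all
  qed
  have three: False if "x \<in> W" "y \<in> W" "z \<in> W" "x \<notin> sums_of W" "y \<notin> sums_of W" "z \<notin> sums_of W"
    "x \<noteq> y" "x \<noteq> z" "y \<noteq> z" for x y z
  proof -
    have "card {x, y, z} \<le> card (W - sums_of W)" using that fin by (intro card_mono) auto
    then show False using assms(3) that by simp
  qed
  \<comment> \<open>The extended set has 7 members, so the largest index allowed is 12; its largest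
    member is \<open>v + 2 * b\<close>.\<close>
  have shortI: "structured (insert 0 W)" if abc: "v = \<alpha> * e" "a = \<beta> * e" "b = \<gamma> * e" and bounds: "0 \<le> \<alpha>" "0 \<le> \<beta>" "\<beta> \<le> \<gamma>"
    "\<alpha> + 2 * \<gamma> \<le> 12" for \<alpha> \<beta> \<gamma> e
  proof -
    have ex: "\<exists>i. 0 \<le> i \<and> i \<le> 12 \<and> x = i * e" if "x = j * e" "0 \<le> j" "j \<le> 12" for x j using that by blast
    have "\<exists>i. 0 \<le> i \<and> i \<le> 12 \<and> x = i * e" if "x \<in> insert 0 W" for x
    proof -
      have "x = 0 * e \<or> x = \<alpha> * e \<or> x = (\<alpha> + \<beta>) * e \<or> x = (\<alpha> + \<gamma>) * e \<or>
          x = (\<alpha> + 2 * \<beta>) * e \<or> x = (\<alpha> + \<beta> + \<gamma>) * e \<or> x = (\<alpha> + 2 * \<gamma>) * e"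
        using that unfolding W abc by (elim insertE emptyE) (simp_all add: distrib_right)
      then show ?thesis using bounds by (elim disjE) (rule ex, assumption, simp, simp)+
    qed
    then have "\<forall>x\<in>insert 0 W. \<exists>i. 0 \<le> i \<and> i \<le> 2 * int (card (insert 0 W)) - 2 \<and> x = 0 + i * e"
      unfolding cS by simp
    then have "short (insert 0 W)" unfolding short_def by blast
    then show ?thesis unfolding structured_def by blast
  qed
  have vW: "v \<in> W" "v + a \<in> W" "v + b \<in> W" "v + 2 * a \<in> W" "v + 2 * b \<in> W" unfolding W by simp_all
  have nv: "v \<notin> sums_of W"
  proof
    assume "v \<in> sums_of W"
    from sm[OF this] show False using v0 ab by (elim disjE; linarith)
  qed
  show ?thesis
  proof (cases "v = a")
    case va: True
    show ?thesis
    proof (cases "v + b \<in> sums_of W")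
      case True
      from sm[OF this] have "b = 2 * a \<or> b = 3 * a \<or> b = 4 * a \<or> b = 5 * a" using ab unfolding va by (elim disjE; linarith)
      then show ?thesis using shortI[of 1 a 1 2] shortI[of 1 a 1 3] shortI[of 1 a 1 4] shortI[of 1 a 1 5] va by (elim disjE) simp_all
    next
      case False
      have "v + 2 * b \<in> sums_of W"
      proof (rule ccontr)
        assume "v + 2 * b \<notin> sums_of W"
        then show False using three[OF vW(1,3,5) nv False] ab by simp
      qed
      from sm[OF this] have "b = 2 * a \<or> b = 3 * a \<or> b = 4 * a \<or> 2 * b = 3 * a \<or> 2 * b = 5 * a"
        using ab unfolding va by (smt (verit))
      moreover have "a = 2 * (b - a)" "b = 3 * (b - a)" if "2 * b = 3 * a" using that by presburger+
      moreover have "a = 2 * (b - 2 * a)" "b = 5 * (b - 2 * a)" if "2 * b = 5 * a" using that by presburger+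
      ultimately consider "b = 2 * a" | "b = 3 * a" | "b = 4 * a" | "a = 2 * (b - a)" "b = 3 * (b - a)"
        | "a = 2 * (b - 2 * a)" "b = 5 * (b - 2 * a)" by blast
      then show ?thesis
      proof cases
        case 1 then show ?thesis using shortI[of 1 a 1 2] va by simp
      next
        case 2 then show ?thesis using shortI[of 1 a 1 3] va by simp
      next
        case 3 then show ?thesis using shortI[of 1 a 1 4] va by simp
      next
        case 4 then show ?thesis using va by (intro shortI[of 2 "b - a" 2 3]) simp_all
      next
        case 5 then show ?thesis using va by (intro shortI[of 2 "b - 2 * a" 2 5]) simp_all
      qed
    qed
  next
    case False
    have na: "v + a \<notin> sums_of W"
    proof
      assume "v + a \<in> sums_of W"
      from sm[OF this] show False using False v0 ab by (elim disjE; linarith)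
    qed
    \<comment> \<open>\<open>v\<close> and \<open>v + a\<close> are now the two failures, so the
      other members must be sums. Comparing \<open>v + b\<close>, \<open>v + 2 * a\<close> and
      \<open>v + 2 * b\<close> with the 15 possible sums leaves four ratios.\<close>
    have ex: "x \<in> sums_of W" if "x \<in> W" "x \<noteq> v" "x \<noteq> v + a" for x
    proof (rule ccontr)
      assume "x \<notin> sums_of W"
      then show False using three[OF vW(1,2) that(1) nv na] that ab by simp
    qed
    have s1: "v + b \<in> sums_of W" "v + 2 * a \<in> sums_of W" "v + 2 * b \<in> sums_of W"
      using vW ab by (auto intro!: ex)
    have c1: "v = b \<or> v = b - a \<or> v = b - 2 * a \<or> v = b - 3 * a \<or> v = b - 4 * a"
      using sm[OF s1(1)] v0 ab by (smt (verit))
    have c2: "v = 2 * a \<or> v = 2 * a - b" using sm[OF s1(2)] v0 ab False by (smt (verit))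
    have "b \<noteq> 6 * a \<or> v \<noteq> 2 * a" using sm[OF s1(3)] ab by (smt (verit))
    then have "(v = 2 * a \<and> (b = 3 * a \<or> b = 4 * a \<or> b = 5 * a)) \<or> (2 * b = 3 * a \<and> v = 2 * a - b)"
      using c1 c2 v0 ab b2a by (smt (verit))
    moreover have "a = 2 * (b - a)" "b = 3 * (b - a)" "2 * a - b = 1 * (b - a)" if "2 * b = 3 * a" using that by presburger+
    ultimately consider "v = 2 * a" "b = 3 * a" | "v = 2 * a" "b = 4 * a" | "v = 2 * a" "b = 5 * a"
      | "v = 1 * (b - a)" "a = 2 * (b - a)" "b = 3 * (b - a)" by metis
    then show ?thesis
    proof cases
      case 1 then show ?thesis by (intro shortI[of 2 a 1 3]) simp_all
    next
      case 2 then show ?thesis by (intro shortI[of 2 a 1 4]) simp_all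
    next
      case 3 then show ?thesis by (intro shortI[of 2 a 1 5]) simp_all
    next
      case 4 then show ?thesis by (rule shortI) simp_all
    qed
  qed
qed

section \<open>Sets with the fewest sums, and a point off the lattice of the others\<close>

lemma prog_Suc_last: "prog t u (Suc l) = insert (u + int l * t) (prog t u l)"
  unfolding prog_def lessThan_Suc by simp

text \<open>The top always adds two sums. Equality therefore persists when the top is removed, the
  rest is a progression by induction, and the top must continue it because it may add no third
  sum.\<close>

lemma sums_of_minimal:
  "finite A \<Longrightarrow> A \<noteq> {} \<Longrightarrow> 2 * card A \<le> card (sums_of A) + 1 \<and>
    (card (sums_of A) + 1 = 2 * card A \<longrightarrow> (\<exists>t u. A = prog t u (card A)))"
proof (induction "card A" arbitrary: A rule: less_induct)
  case less
  show ?case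
  proof (cases "card A = 1")
    case True
    then obtain x where A: "A = {x}" by (rule card_1_singletonE)
    have s: "sums_of {x} = {2 * x}" by (auto simp: sums_of_def)
    have "{x} = prog 0 x (card {x})" using prog_1[of 0 x] by simp
    then have "\<exists>t u. {x} = prog t u (card {x})" by blast
    then show ?thesis unfolding A s by simp
  next
    case False
    have "card A \<noteq> 0" using less.prems by simp
    then have c2: "2 \<le> card A" using False by simp
    define n where "n = Max A"
    have n: "n \<in> A" "\<And>y. y \<in> A \<Longrightarrow> y \<le> n" unfolding n_def using less.prems Max_in by auto
    define T where "T = A - {n}"
    have cT: "card A = Suc (card T)" unfolding T_def using card_Suc_Diff1[OF less.prems(1) n(1)] by simp
    have "T \<noteq> {}" using cT c2 by auto
    then obtain y where y: "y \<in> A" "y \<noteq> n" unfolding T_def by blast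
    obtain m where m: "m \<in> A" "m < n" "\<forall>x\<in>A. x = n \<or> x \<le> m"
      by (rule second_largest[OF less.prems(1) n y]) blast+
    have hi: "x = n \<or> x \<le> m" if "x \<in> A" for x using m(3) that by blast
    note ts = top_sums[OF less.prems(1) n(1) m(1,2) hi, folded T_def]
    have finT: "finite T" unfolding T_def using less.prems by simp
    have mT: "m \<in> T" unfolding T_def using m by simp
    have IH: "2 * card T \<le> card (sums_of T) + 1"
      "card (sums_of T) + 1 = 2 * card T \<longrightarrow> (\<exists>t u. T = prog t u (card T))"
      using less.hyps[OF _ finT \<open>T \<noteq> {}\<close>] cT by auto
    have le: "card (sums_of T) + 2 \<le> card (sums_of A)" using ts(1) by blast
    have "\<exists>t u. A = prog t u (card A)" if eq: "card (sums_of A) + 1 = 2 * card A"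
    proof -
      have eqT: "card (sums_of T) + 1 = 2 * card T" using eq le IH(1) cT by simp
      then obtain t0 u0 where T0: "T = prog t0 u0 (card T)" using IH(2) by blast
      have "card (sums_of A) \<le> card (sums_of T) + 2" using eq eqT cT by simp
      then have sA: "sums_of A = insert (2 * n) (insert (n + m) (sums_of T))" using ts(2) by blast
      have A: "A = insert n T" unfolding T_def using n(1) by blast
      show ?thesis
      proof (cases "card T = 1")
        case True
        then have "T = {m}" using mT card_1_singletonE by blast
        then have "A = prog (n - m) m 2" unfolding A prog_2 by auto
        moreover have "card A = 2" using cT True by simp
        ultimately show ?thesis by metis
      next
        case False
        moreover have "card T \<noteq> 0" using cT c2 by simp
        ultimately have T2: "2 \<le> card T" by simp
        have "\<exists>t u. 0 < t \<and> T = prog t u (card T)"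
        proof (cases t0 "0::int" rule: linorder_cases)
          case less
          then have "0 < - t0" by simp
          then show ?thesis using T0 prog_reverse[of t0 u0 "card T"] by metis
        next
          case equal
          then have "T \<subseteq> {u0}" using T0 unfolding prog_def by auto
          then have "card T \<le> 1" using card_mono[of "{u0}" T] by simp
          then show ?thesis using T2 by simp
        next
          case greater then show ?thesis using T0 by blast
        qed
        then obtain t u where t: "0 < t" and T: "T = prog t u (card T)" by blast
        have memT: "x \<in> T \<longleftrightarrow> (\<exists>i. 0 \<le> i \<and> i < int (card T) \<and> x = u + i * t)" for x
          using T mem_prog[of x t u "card T"] by simp
        define r where "r = int (card T) - 1"
        have r1: "1 \<le> r" unfolding r_def using T2 by simp
        have top: "u + r * t \<in> T" unfolding memT r_def using T2 by (intro exI[of _ "int (card T) - 1"]) simp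
        have "m \<le> u + r * t"
        proof -
          obtain i where i: "0 \<le> i" "i < int (card T)" "m = u + i * t" using mT memT by blast
          have "i * t \<le> r * t" using i t unfolding r_def by (intro mult_right_mono) auto
          then show ?thesis using i by simp
        qed
        moreover have "u + r * t \<le> m" using hi[of "u + r * t"] top unfolding T_def by blast
        ultimately have mu: "m = u + r * t" by simp
        have "u + (r - 1) * t \<in> T" unfolding memT r_def using T2 by (intro exI[of _ "int (card T) - 2"]) simp
        then have mt: "m - t \<in> T" unfolding mu by (simp add: algebra_simps)
        \<comment> \<open>A third sum with the top, hence already a sum of lower members and at most
          \<open>2 * m\<close>. So \<open>n - m <= t\<close>, and as \<open>t\<close> divides
          \<open>n - m\<close> the two are equal.\<close>
        have "n + (m - t) \<in> sums_of A" using n(1) mt unfolding T_def by (intro sums_ofI) simp_all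
        moreover have "n + (m - t) \<noteq> 2 * n" "n + (m - t) \<noteq> n + m" using m t by simp_all
        ultimately have "n + (m - t) \<in> sums_of T" unfolding sA by blast
        then obtain a b where ab: "a \<in> T" "b \<in> T" "n + (m - t) = a + b" by (rule sums_ofE)
        then have "a \<le> m" "b \<le> m" using hi unfolding T_def by blast+
        then have nt: "n - m \<le> t" using ab(3) by simp
        obtain i j where ij: "a = u + i * t" "b = u + j * t" using ab memT by meson
        have "n - m = (i + j - 2 * r + 1) * t" using ab(3) ij mu by (simp add: algebra_simps)
        then have "t dvd n - m" by simp
        then have "t \<le> n - m" using m(2) by (intro zdvd_imp_le) simp_all
        then have "n = m + t" using nt by simp
        then have "n = u + int (card T) * t" unfolding mu r_def by (simp add: algebra_simps)
        then have "A = prog t u (Suc (card T))" unfolding A prog_Suc_last using T by simp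
        then show ?thesis unfolding cT by blast
      qed
    qed
    then show ?thesis using le IH(1) cT by simp
  qed
qed

text \<open>With \<open>T\<close> in one class modulo \<open>d\<close> and \<open>x\<close> outside
  it, \<open>x + T\<close> avoids the sums of \<open>T\<close>. Together with \<open>2 * x\<close>
  there are at least (2|T| - 1) + |T| + 1 = 3|S| - 3 sums. Equality makes \<open>T\<close> a
  progression, with \<open>{x}\<close> as the second one.\<close>

lemma off_lattice:
  fixes S :: "int set" and x z d :: int
  assumes "finite S" "x \<in> S" "2 \<le> card (S - {x})" "2 * x \<notin> sums_of (S - {x})"
    and "z \<in> S - {x}" "\<And>y. y \<in> S - {x} \<Longrightarrow> d dvd y - z" "\<not> d dvd x - z"
  shows "3 * card S \<le> card (sums_of S) + 3"
    and "card (sums_of S) + 3 \<le> 3 * card S \<Longrightarrow> biprog S"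
proof -
  define T where "T = S - {x}"
  let ?H = "(\<lambda>y. x + y) ` T"
  have fin: "finite T" unfolding T_def using assms(1) by simp
  have cS: "card S = Suc (card T)" unfolding T_def using assms(1,2) by (metis card_Suc_Diff1)
  have "sums_of T \<inter> ?H = {}"
  proof (rule ccontr)
    assume "sums_of T \<inter> ?H \<noteq> {}"
    then obtain y where y: "y \<in> T" "x + y \<in> sums_of T" by blast
    from y(2) obtain p q where pq: "p \<in> T" "q \<in> T" "x + y = p + q" by (rule sums_ofE)
    have "d dvd ((p - z) + (q - z)) - (y - z)"
      using assms(6) pq y unfolding T_def by (intro dvd_diff[OF dvd_add]) auto
    moreover have "((p - z) + (q - z)) - (y - z) = x - z" using pq(3) by simp
    ultimately show False using assms(7) by metis
  qed
  moreover have "2 * x \<notin> ?H" unfolding T_def by auto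
  moreover have "2 * x \<notin> sums_of T" unfolding T_def by (rule assms(4))
  ultimately have "card (insert (2 * x) (sums_of T \<union> ?H)) = Suc (card (sums_of T) + card ?H)"
    using fin by (simp add: card_Un_disjoint)
  moreover have "card ?H = card T" by (rule card_image) (auto simp: inj_on_def)
  moreover have "insert (2 * x) (sums_of T \<union> ?H) \<subseteq> sums_of S"
  proof -
    have "sums_of T \<subseteq> sums_of S" by (rule sums_of_mono) (auto simp: T_def)
    moreover have "?H \<subseteq> sums_of S" using assms(2) unfolding T_def by (blast intro: sums_ofI)
    moreover have "2 * x \<in> sums_of S" by (rule sums_ofI'[OF assms(2,2)]) simp
    ultimately show ?thesis by blast
  qed
  then have "card (insert (2 * x) (sums_of T \<union> ?H)) \<le> card (sums_of S)"
    using assms(1) by (intro card_mono) auto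
  ultimately have le: "card (sums_of T) + card T + 1 \<le> card (sums_of S)" by simp
  have "T \<noteq> {}" using assms(5) unfolding T_def by blast
  note mn = sums_of_minimal[OF fin this]
  show "3 * card S \<le> card (sums_of S) + 3" using le mn cS by simp
  assume "card (sums_of S) + 3 \<le> 3 * card S"
  then have "card (sums_of T) + 1 = 2 * card T" using le mn cS by simp
  then obtain t u where T: "T = prog t u (card T)" using mn by blast
  have "S = prog t u (card T) \<union> prog t x (Suc 0)" unfolding prog_1 T[symmetric]
    using assms(2) unfolding T_def by blast
  moreover have "0 < card T" using assms(3) unfolding T_def by simp
  ultimately show "biprog S" by (rule biprogI_progs) (use cS in simp_all)
qed

section \<open>The induction on the size of an integer set\<close>

lemma short_of_bounds:
  assumes "\<And>x. x \<in> S \<Longrightarrow> \<exists>i. 0 \<le> i \<and> i \<le> 2 * int (card S) - 2 \<and> x = i * t"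
  shows "short S"
proof -
  have "\<forall>x\<in>S. \<exists>i. 0 \<le> i \<and> i \<le> 2 * int (card S) - 2 \<and> x = 0 + i * t" using assms by simp
  then show ?thesis unfolding short_def by blast
qed

text \<open>Adding 0 to \<open>W\<close> creates the sum 0 and those members of \<open>W\<close>
  that are not sums in \<open>W\<close>. If there is at most one of these, \<open>S\<close> is a
  multiple of a chain. If there are two or more, \<open>W\<close> inherits the bound 3k - 3 and the
  induction hypothesis applies. The last alternative stays open here and is combined later with its
  mirror image.\<close>

lemma remove_zero:
  fixes S :: "int set"
  assumes fin: "finite S" and S0: "0 \<in> S" "\<And>x. x \<in> S \<Longrightarrow> 0 \<le> x" and c3: "3 \<le> card S"
    and good: "good_below (card S)" and small: "card (sums_of S) + 3 \<le> 3 * card S"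
  shows "short S \<or> (structured S \<and> \<not> card (sums_of S) + 4 \<le> 3 * card S) \<or> short (S - {0})"
proof -
  define W where "W = S - {0}"
  have S: "S = insert 0 W" unfolding W_def using S0 by blast
  have finW: "finite W" unfolding W_def using fin by simp
  have pos: "0 < x" if "x \<in> W" for x using that S0(2)[of x] unfolding W_def by auto
  have cS: "card S = Suc (card W)" unfolding W_def using fin S0(1) by (metis card_Suc_Diff1)
  have "sums_of S = insert 0 (sums_of W \<union> (W - sums_of W))"
  proof -
    have "sums_of S \<subseteq> insert 0 (sums_of W \<union> W)" unfolding S by (auto simp: sums_of_def)
    moreover have "insert 0 (sums_of W \<union> W) \<subseteq> sums_of S"
      unfolding S by (auto intro: sums_ofI'[of 0] simp: sums_of_mono[THEN subsetD])
    ultimately show ?thesis by blast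
  qed
  moreover have "0 \<notin> sums_of W \<union> (W - sums_of W)"
  proof -
    have "0 < x" if "x \<in> sums_of W" for x
      using that by (rule sums_ofE) (use pos in \<open>simp add: add_pos_pos\<close>)
    then show ?thesis using pos by blast
  qed
  moreover have "card (sums_of W \<union> (W - sums_of W)) = card (sums_of W) + card (W - sums_of W)"
    using finW by (intro card_Un_disjoint) auto
  ultimately have count: "card (sums_of S) = Suc (card (sums_of W) + card (W - sums_of W))" using finW by simp
  show ?thesis
  proof (cases "card (W - sums_of W) \<le> 1")
    case True
    have "W \<noteq> {}" using cS c3 by auto
    define g where "g = Min W"
    have gW: "g \<in> W" and gmin: "\<And>x. x \<in> W \<Longrightarrow> g \<le> x" unfolding g_def using finW \<open>W \<noteq> {}\<close> Min_in by auto
    have g0: "0 < g" by (rule pos[OF gW])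
    have "g \<notin> sums_of W"
    proof
      assume "g \<in> sums_of W"
      then obtain p q where "p \<in> W" "q \<in> W" "g = p + q" by (rule sums_ofE)
      then show False using gmin[of p] pos[of q] by simp
    qed
    have dec: "x \<in> sums_of W" if "x \<in> W" "x \<noteq> g" for x
    proof (rule ccontr)
      assume "x \<notin> sums_of W"
      then have "card {g, x} \<le> card (W - sums_of W)" using \<open>g \<notin> sums_of W\<close> gW that finW by (intro card_mono) auto
      then show False using True that by simp
    qed
    \<comment> \<open>Every member of \<open>W\<close> except \<open>g\<close> is a sum of smaller
      ones, so all are multiples of \<open>g\<close>, and division by \<open>g\<close> gives a
      chain.\<close>
    have gd: "g dvd x" if "x \<in> W" for x
      using that
    proof (induction "nat x" arbitrary: x rule: less_induct)
      case less
      show ?case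
      proof (cases "x = g")
        case False
        obtain p q where pq: "p \<in> W" "q \<in> W" "x = p + q" using dec[OF less.prems False] by (rule sums_ofE)
        then have "g dvd p" "g dvd q" using pos[of p] pos[of q] by (auto intro!: less.hyps)
        then show ?thesis using pq(3) by simp
      qed simp
    qed
    define S1 where "S1 = {i. g * i \<in> S}"
    have "g dvd x" if "x \<in> S" for x using that gd[of x] unfolding S by auto
    then have SS1: "S = (\<lambda>i. 0 + g * i) ` S1" unfolding S1_def by (auto elim!: dvdE)
    have gn0: "g \<noteq> 0" using g0 by simp
    have c1: "card S1 = card S" using card_affine[OF gn0, of 0 S1] SS1 by simp
    have s1: "card (sums_of S1) = card (sums_of S)" using card_sums_of_affine[OF gn0, of 0 S1] SS1 by simp
    have "chain S1" unfolding chain_def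
    proof (intro conjI ballI impI)
      show "finite S1" using c1 c3 card_ge_0_finite[of S1] by simp
      show "0 \<in> S1" "1 \<in> S1" unfolding S1_def using S0 gW unfolding W_def by simp_all
      fix i assume i: "i \<in> S1"
      then have "0 \<le> g * i" using S0(2) unfolding S1_def by blast
      then show "0 \<le> i" using g0 by (simp add: zero_le_mult_iff)
      assume "1 < i"
      then have "g * i \<in> W" "g * i \<noteq> g" using i g0 unfolding S1_def W_def by auto
      then have "g * i \<in> sums_of W" by (rule dec)
      then obtain p q where pq: "p \<in> W" "q \<in> W" "g * i = p + q" by (rule sums_ofE)
      then obtain a b where ab: "p = g * a" "q = g * b" using gd by (meson dvdE)
      then have "i = a + b" using pq(3) gn0 by (metis distrib_left mult_cancel_left)
      moreover have "a \<in> S1 - {0}" "b \<in> S1 - {0}" using pq ab unfolding S1_def W_def by auto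
      ultimately show "i \<in> sums_of (S1 - {0})" by (intro sums_ofI')
    qed
    then have b: "i \<le> 2 * int (card S) - 2" "0 \<le> i" if "i \<in> S1" for i
      using chain_short[of S1 i] good small that unfolding c1 s1 chain_def by auto
    have "short S"
    proof (rule short_of_bounds[where t = g])
      fix x assume "x \<in> S"
      then obtain i where "i \<in> S1" "x = g * i" unfolding SS1 by auto
      then show "\<exists>i. 0 \<le> i \<and> i \<le> 2 * int (card S) - 2 \<and> x = i * g" using b[of i] by (auto simp: mult.commute)
    qed
    then show ?thesis by blast
  next
    case False
    have W2: "2 \<le> card W" "card W < card S" using cS c3 by simp_all
    have smW: "card (sums_of W) + 3 \<le> 3 * card W" using count small cS False by simp
    have strW: "structured W" by (rule good_belowD(1)[OF good finW W2 smW])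
    show ?thesis
    proof (cases "card (sums_of W) + 4 \<le> 3 * card W")
      case True
      then have "short W" by (rule good_belowD(2)[OF good finW W2])
      then show ?thesis unfolding W_def by blast
    next
      \<comment> \<open>All bounds are tight: exactly two members are new sums and |2W| = 3|W| - 3.
        Hence \<open>S\<close> itself does not satisfy the bound 3k - 4, and only its structure is
        to be found.\<close>
      case F: False
      then have e2: "card (W - sums_of W) \<le> 2" and nF: "\<not> card (sums_of S) + 4 \<le> 3 * card S"
        using count small cS False by simp_all
      from strW have "short W \<or> structured S"
        unfolding structured_def[of W] S
        using biprog_insert_zero[OF _ pos e2] triangle_insert_zero[OF _ pos e2] by blast
      then show ?thesis using nF unfolding W_def by blast
    qed
  qed
qed

text \<open>\<open>remove_zero\<close> is applied to the set and to its mirror image. There remains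
  a set that is short after the loss of either end: one end may lie off the lattice of the rest, and
  if neither does, the set is short itself or has a large gap at both ends.\<close>

lemma small_sums_structured_step:
  fixes S :: "int set"
  assumes fin: "finite S" and S0: "0 \<in> S" "\<And>x. x \<in> S \<Longrightarrow> 0 \<le> x" and c3: "3 \<le> card S"
    and good: "good_below (card S)" and small: "card (sums_of S) + 3 \<le> 3 * card S"
  shows "structured S \<and> (card (sums_of S) + 4 \<le> 3 * card S \<longrightarrow> short S)"
proof -
  define k where "k = int (card S)"
  define n where "n = Max S"
  have n: "n \<in> S" "\<And>y. y \<in> S \<Longrightarrow> y \<le> n" unfolding n_def using fin S0(1) Max_in by auto
  define R where "R = (\<lambda>x. n + (- 1) * x) ` S"
  have invol: "(\<lambda>x. n + (- 1) * x) ` ((\<lambda>x. n + (- 1) * x) ` V) = V" for V :: "int set"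
    unfolding image_image by simp
  have SR: "S = (\<lambda>x. n + (- 1) * x) ` R" unfolding R_def invol ..
  have cR: "card R = card S" unfolding R_def by (rule card_affine) simp
  have sR: "card (sums_of R) = card (sums_of S)" unfolding R_def by (rule card_sums_of_affine) simp
  have "short R \<or> (structured R \<and> \<not> card (sums_of R) + 4 \<le> 3 * card R) \<or> short (R - {0})"
  proof (rule remove_zero)
    show "finite R" unfolding R_def using fin by simp
    show "0 \<in> R" unfolding R_def using n(1) by (intro image_eqI[of _ _ n]) simp_all
    show "0 \<le> x" if "x \<in> R" for x using that n(2) unfolding R_def by auto
  qed (use c3 good small cR sR in simp_all)
  moreover have "S - {n} = (\<lambda>x. n + (- 1) * x) ` (R - {0})"
    using image_set_diff[OF inj_affine[of "- 1" n UNIV], of R "{0}"] SR by simp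
  ultimately have topc: "short S \<or> (structured S \<and> \<not> card (sums_of S) + 4 \<le> 3 * card S) \<or> short (S - {n})"
    using short_affine[of R "- 1" n] structured_affine[of R "- 1" n] short_affine[of "R - {0}" "- 1" n]
    unfolding SR[symmetric] cR sR by auto
  from remove_zero[OF assms] topc consider "short S" | "structured S" "\<not> card (sums_of S) + 4 \<le> 3 * card S"
    | "short (S - {0})" "short (S - {n})" by blast
  then show ?thesis
  proof cases
    case 3
    have c: "card (S - {x}) = card S - 1" if "x \<in> S" for x using fin that by simp
    have n0: "0 < n"
    proof -
      have "\<not> S \<subseteq> {0}" using c3 card_mono[of "{0}" S] by auto
      then obtain x where "x \<in> S" "x \<noteq> 0" by blast
      then show ?thesis using S0(2)[of x] n(2)[of x] by simp
    qed
    have "\<not> S \<subseteq> {0, n}" using c3 n0 card_mono[of "{0, n}" S] by auto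
    then obtain y where y: "y \<in> S" "y \<noteq> 0" "y \<noteq> n" by blast
    obtain m where m: "m \<in> S" "m < n" "y \<le> m" "\<forall>x\<in>S. x = n \<or> x \<le> m"
      by (rule second_largest[OF fin n y(1,3)]) blast+
    define a where "a = Min (S - {0})"
    have a: "a \<in> S" "a \<noteq> 0" "\<And>x. x \<in> S \<Longrightarrow> x = 0 \<or> a \<le> x"
    proof -
      have "finite (S - {0})" "S - {0} \<noteq> {}" using fin y by auto
      then have "a \<in> S - {0}" "\<forall>x\<in>S - {0}. a \<le> x" unfolding a_def using Min_in[of "S - {0}"] Min_le[of "S - {0}"] by blast+
      then show "a \<in> S" "a \<noteq> 0" "\<And>x. x \<in> S \<Longrightarrow> x = 0 \<or> a \<le> x" by auto
    qed
    have am: "0 < a" "a \<le> m" using a S0(2)[OF a(1)] a(3)[OF y(1)] y(2) m(3) by simp_all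
    obtain d1 where d1: "0 < d1" "\<And>x y. x \<in> S - {0} \<Longrightarrow> y \<in> S - {0} \<Longrightarrow> d1 dvd x - y"
      "\<And>x y. x \<in> S - {0} \<Longrightarrow> y \<in> S - {0} \<Longrightarrow> x - y \<le> d1 * (2 * int (card (S - {0})) - 2)"
      using shortE[OF 3(1), of y n] y n n0 by blast
    obtain d2 where d2: "0 < d2" "\<And>x y. x \<in> S - {n} \<Longrightarrow> y \<in> S - {n} \<Longrightarrow> d2 dvd x - y"
      "\<And>x y. x \<in> S - {n} \<Longrightarrow> y \<in> S - {n} \<Longrightarrow> x - y \<le> d2 * (2 * int (card (S - {n})) - 2)"
      using shortE[OF 3(2), of y 0] y S0 n0 by blast
    have z0: "2 * 0 \<notin> sums_of (S - {0})"
    proof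
      assume "2 * 0 \<in> sums_of (S - {0})"
      then obtain p q where "p \<in> S - {0}" "q \<in> S - {0}" "2 * 0 = p + q" by (rule sums_ofE)
      then show False using S0(2)[of p] S0(2)[of q] by auto
    qed
    have zn: "2 * n \<notin> sums_of (S - {n})"
    proof
      assume "2 * n \<in> sums_of (S - {n})"
      then obtain p q where "p \<in> S - {n}" "q \<in> S - {n}" "2 * n = p + q" by (rule sums_ofE)
      then show False using n(2)[of p] n(2)[of q] by auto
    qed
    have c2: "2 \<le> card (S - {0})" "2 \<le> card (S - {n})" using c S0 n c3 by simp_all
    have y1: "y \<in> S - {0}" "y \<in> S - {n}" using y by auto
    have off: ?thesis if "3 * card S \<le> card (sums_of S) + 3" "card (sums_of S) + 3 \<le> 3 * card S \<Longrightarrow> biprog S"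
      using that small unfolding structured_def by auto
    show ?thesis
    proof (cases "d1 dvd 0 - y \<and> d2 dvd n - y")
      case False
      then consider "\<not> d1 dvd 0 - y" | "\<not> d2 dvd n - y" by blast
      then show ?thesis
      proof cases
        case 1
        show ?thesis
          by (rule off; rule off_lattice[OF fin S0(1) c2(1) z0 y1(1) d1(2)[OF _ y1(1)] 1]; assumption)
      next
        case 2
        show ?thesis
          by (rule off; rule off_lattice[OF fin n(1) c2(2) zn y1(2) d2(2)[OF _ y1(2)] 2]; assumption)
      qed
    next
      case True
      \<comment> \<open>Both steps divide every member, hence so does their least common multiple.
        Being at least as large as either step, it preserves both length bounds after
        division.\<close>
      define D where "D = lcm d1 d2"
      have D0: "0 < D" unfolding D_def using d1(1) d2(1) by (simp add: lcm_pos_int)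
      have Dle: "d1 \<le> D" "d2 \<le> D" unfolding D_def using d1(1) d2(1) D0[unfolded D_def] by (auto intro: zdvd_imp_le)
      have Dd: "D dvd x" if "x \<in> S" for x
      proof -
        have "d1 dvd y" using True by simp
        have "d1 dvd x"
        proof (cases "x = 0")
          case False
          then have "d1 dvd (x - y) + y" using d1(2)[of x y] that y1(1) \<open>d1 dvd y\<close> by (intro dvd_add) auto
          then show ?thesis by simp
        qed simp
        moreover have "d2 dvd x"
        proof -
          have zS: "0 \<in> S - {n}" using S0(1) n0 by simp
          have "d2 dvd y - 0" by (rule d2(2)[OF y1(2) zS])
          then have dy: "d2 dvd y" by simp
          show ?thesis
          proof (cases "x = n")
            case True
            have "d2 dvd (n - y) + y" using \<open>d1 dvd 0 - y \<and> d2 dvd n - y\<close> dy by (intro dvd_add) auto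
            then show ?thesis using True by simp
          next
            case False
            then have "d2 dvd x - 0" using that zS by (intro d2(2)) auto
            then show ?thesis by simp
          qed
        qed
        ultimately show ?thesis unfolding D_def by (rule lcm_least)
      qed
      define S1 where "S1 = {i. D * i \<in> S}"
      have SS1: "S = (\<lambda>i. 0 + D * i) ` S1" unfolding S1_def using Dd by (auto elim!: dvdE)
      have Dn0: "D \<noteq> 0" using D0 by simp
      have k1: "int (card S1) = k" unfolding k_def using card_affine[OF Dn0, of 0 S1] SS1 by simp
      have s1: "card (sums_of S1) = card (sums_of S)" using card_sums_of_affine[OF Dn0, of 0 S1] SS1 by simp
      obtain a1 m1 n1 where q: "a = D * a1" "m = D * m1" "n = D * n1"
        using Dd[OF a(1)] Dd[OF m(1)] Dd[OF n(1)] by (auto elim!: dvdE)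
      have fin1: "finite S1" using k1 c3 card_ge_0_finite[of S1] unfolding k_def by simp
      have mem1: "0 \<in> S1" "a1 \<in> S1" "m1 \<in> S1" "n1 \<in> S1" unfolding S1_def using S0 a m n q by simp_all
      have leD: "i \<le> j" if "D * i \<le> D * j" for i j using that D0 by simp
      have ltD: "i < j" if "D * i < D * j" for i j using that D0 by simp
      have k4: "0 \<le> 2 * k - 4" unfolding k_def using c3 by simp
      have "n - a \<le> d1 * (2 * k - 4)"
        using d1(3)[of n a] n n0 a c[OF S0(1)] c3 unfolding k_def by (simp add: of_nat_diff)
      also have "\<dots> \<le> D * (2 * k - 4)" using Dle k4 by (intro mult_right_mono)
      finally have "D * (n1 - a1) \<le> D * (2 * k - 4)" unfolding q by (simp add: algebra_simps)
      then have na: "n1 - a1 \<le> 2 * k - 4" by (rule leD)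
      have "m - 0 \<le> d2 * (2 * k - 4)"
        using d2(3)[of m 0] m n0 S0 c[OF n(1)] c3 unfolding k_def by (simp add: of_nat_diff)
      also have "\<dots> \<le> D * (2 * k - 4)" using Dle k4 by (intro mult_right_mono)
      finally have "D * m1 \<le> D * (2 * k - 4)" unfolding q by simp
      then have mk: "m1 \<le> 2 * k - 4" by (rule leD)
      have rng: "0 \<le> i \<and> i \<le> n1 \<and> (i = 0 \<or> a1 \<le> i) \<and> (i = n1 \<or> i \<le> m1)" if "i \<in> S1" for i
      proof -
        have i: "D * i \<in> S" using that unfolding S1_def by simp
        have "D * 0 \<le> D * i" "D * i \<le> D * n1" using S0(2)[OF i] n(2)[OF i] q by simp_all
        moreover have "i = 0 \<or> D * a1 \<le> D * i" using a(3)[OF i] Dn0 q by auto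
        moreover have "i = n1 \<or> D * i \<le> D * m1" using m(4) i Dn0 q by auto
        ultimately show ?thesis using leD by blast
      qed
      show ?thesis
      proof (cases "n1 \<le> 2 * k - 2")
        case True
        have "short S"
        proof (rule short_of_bounds[where t = D])
          fix x assume "x \<in> S"
          then obtain i where "i \<in> S1" "x = D * i" unfolding SS1 by auto
          then show "\<exists>i. 0 \<le> i \<and> i \<le> 2 * int (card S) - 2 \<and> x = i * D"
            using rng[of i] True unfolding k_def by (intro exI[of _ i]) (auto simp: mult.commute)
        qed
        then show ?thesis unfolding structured_def by blast
      next
        case False
        then have n1: "2 * int (card S1) - 1 \<le> n1" unfolding k1 by simp
        have ord: "0 < a1" "a1 \<le> m1" "m1 < n1"
          using am m(2) ltD[of 0 a1] leD[of a1 m1] ltD[of m1 n1] unfolding q by simp_all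
        have lo: "i = 0 \<or> a1 \<le> i" and hi: "i = n1 \<or> i \<le> m1" if "i \<in> S1" for i using rng[OF that] by blast+
        \<comment> \<open>The rescaled set is too long to be short, but both truncations have span
          at most 2k - 4.\<close>
        note tg = two_gaps_bound[OF fin1 mem1 ord lo hi n1 mk[folded k1] na[folded k1]]
        have ge: "3 * int (card S1) - 3 \<le> int (card (sums_of S1))" using tg(1) by blast
        then have eq: "int (card (sums_of S1)) = 3 * int (card S1) - 3" using small s1 k1 unfolding k_def by simp
        then have "biprog S1" using tg(2) by blast
        then have "biprog S" using biprog_affine[of S1 D 0] Dn0 SS1 by simp
        moreover have "\<not> card (sums_of S) + 4 \<le> 3 * card S" using ge s1 k1 unfolding k_def by simp
        ultimately show ?thesis unfolding structured_def by blast
      qed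
    qed
  qed (auto simp: structured_def)
qed

theorem small_sums_structured:
  fixes S :: "int set"
  shows "finite S \<Longrightarrow> 2 \<le> card S \<Longrightarrow>
    (card (sums_of S) + 3 \<le> 3 * card S \<longrightarrow> structured S) \<and> (card (sums_of S) + 4 \<le> 3 * card S \<longrightarrow> short S)"
proof (induction "card S" arbitrary: S rule: less_induct)
  case less
  show ?case
  proof (cases "card S = 2")
    case True
    then obtain x y where S: "S = {x, y}" by (auto simp: card_2_iff)
    have "S \<noteq> {}" using True by auto
    \<comment> \<open>Two points have at least 3 = 3k - 3 sums, so the claim about 3k - 4 is
      void.\<close>
    then have "3 \<le> card (sums_of S)" using sums_of_minimal[OF less.prems(1)] True by simp
    moreover have "S = prog 1 x (Suc 0) \<union> prog 1 y (Suc 0)" unfolding S prog_1 by auto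
    then have "biprog S" by (rule biprogI_progs) (use True in simp_all)
    ultimately show ?thesis using True unfolding structured_def by simp
  next
    case False
    then have c3: "3 \<le> card S" using less.prems by simp
    define R where "R = (\<lambda>x. (- Min S) + 1 * x) ` S"
    have SR: "S = (\<lambda>x. Min S + 1 * x) ` R" unfolding R_def image_image by simp
    have cR: "card R = card S" unfolding R_def by (rule card_affine) simp
    have sR: "card (sums_of R) = card (sums_of S)" unfolding R_def by (rule card_sums_of_affine) simp
    have "S \<noteq> {}" using c3 by auto
    then have mn: "Min S \<in> S" "\<And>x. x \<in> S \<Longrightarrow> Min S \<le> x" using less.prems(1) by auto
    have good: "good_below (card R)" unfolding good_below_def cR using less.hyps by blast
    have R: "finite R" "0 \<in> R" "\<And>x. x \<in> R \<Longrightarrow> 0 \<le> x"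
      unfolding R_def using less.prems(1) mn by (auto intro: image_eqI[of _ _ "Min S"])
    have "structured R \<and> (card (sums_of R) + 4 \<le> 3 * card R \<longrightarrow> short R)"
      if "card (sums_of S) + 3 \<le> 3 * card S"
      using small_sums_structured_step[OF R _ good] that c3 cR sR by simp
    then show ?thesis
      using structured_affine[of R 1 "Min S"] short_affine[of R 1 "Min S"] cR sR unfolding SR[symmetric] by auto
  qed
qed

section \<open>Ordered groups\<close>

locale ordered_group = group G for G (structure) +
  fixes lt :: "'a \<Rightarrow> 'a \<Rightarrow> bool"  (infix \<open>\<sqsubset>\<close> 50)
  assumes lt_irrefl: "x \<in> carrier G \<Longrightarrow> \<not> x \<sqsubset> x"
    and lt_trans: "x \<sqsubset> y \<Longrightarrow> y \<sqsubset> z \<Longrightarrow> x \<in> carrier G \<Longrightarrow> y \<in> carrier G \<Longrightarrow> z \<in> carrier G \<Longrightarrow> x \<sqsubset> z"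
    and lt_total: "x \<in> carrier G \<Longrightarrow> y \<in> carrier G \<Longrightarrow> x \<noteq> y \<Longrightarrow> x \<sqsubset> y \<or> y \<sqsubset> x"
    and lt_mult_left: "x \<sqsubset> y \<Longrightarrow> x \<in> carrier G \<Longrightarrow> y \<in> carrier G \<Longrightarrow> z \<in> carrier G \<Longrightarrow> z \<otimes> x \<sqsubset> z \<otimes> y"
    and lt_mult_right: "x \<sqsubset> y \<Longrightarrow> x \<in> carrier G \<Longrightarrow> y \<in> carrier G \<Longrightarrow> z \<in> carrier G \<Longrightarrow> x \<otimes> z \<sqsubset> y \<otimes> z"
begin

lemma mult_lt_mult:
  assumes "a \<sqsubset> b \<or> a = b" "c \<sqsubset> d \<or> c = d" "a \<sqsubset> b \<or> c \<sqsubset> d"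
    and c: "a \<in> carrier G" "b \<in> carrier G" "c \<in> carrier G" "d \<in> carrier G"
  shows "a \<otimes> c \<sqsubset> b \<otimes> d"
proof (cases "a = b")
  case True
  then show ?thesis using assms lt_irrefl lt_mult_left by blast
next
  case False
  then have ab: "a \<otimes> c \<sqsubset> b \<otimes> c" using assms lt_mult_right by blast
  show ?thesis
  proof (cases "c = d")
    case True then show ?thesis using ab by simp
  next
    case False
    then have "b \<otimes> c \<sqsubset> b \<otimes> d" using assms lt_mult_left by blast
    then show ?thesis using lt_trans[OF ab] c by simp
  qed
qed

lemma torsion_free:
  assumes x: "x \<in> carrier G" and n: "0 < (n::nat)" "x [^] n = \<one>"
  shows "x = \<one>"
proof (rule ccontr)
  assume "x \<noteq> \<one>"
  then consider "\<one> \<sqsubset> x" | "x \<sqsubset> \<one>" using lt_total[OF x one_closed] by blast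
  then show False
  proof cases
    case 1
    have "\<one> \<sqsubset> x [^] Suc j" for j
    proof (induction j)
      case 0 then show ?case using 1 x by simp
    next
      case (Suc j)
      then have "\<one> \<otimes> \<one> \<sqsubset> x [^] Suc j \<otimes> x" using 1 x by (intro mult_lt_mult) simp_all
      then show ?case by simp
    qed
    from this[of "n - 1"] show False using n lt_irrefl by simp
  next
    case 2
    have "x [^] Suc j \<sqsubset> \<one>" for j
    proof (induction j)
      case 0 then show ?case using 2 x by simp
    next
      case (Suc j)
      then have "x [^] Suc j \<otimes> x \<sqsubset> \<one> \<otimes> \<one>" using 2 x by (intro mult_lt_mult) simp_all
      then show ?case by simp
    qed
    from this[of "n - 1"] show False using n lt_irrefl by simp
  qed
qed

lemma finite_has_top:
  assumes "finite A" "A \<noteq> {}" "A \<subseteq> carrier G"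
  obtains m where "m \<in> A" "\<forall>x\<in>A. x = m \<or> x \<sqsubset> m"
proof -
  have "\<exists>m\<in>A. \<forall>x\<in>A. x = m \<or> x \<sqsubset> m"
    using assms
  proof (induction A rule: finite_ne_induct)
    case (singleton x) then show ?case by simp
  next
    case (insert a A)
    then obtain m where m: "m \<in> A" "\<forall>x\<in>A. x = m \<or> x \<sqsubset> m" by blast
    have c: "a \<in> carrier G" "m \<in> carrier G" "a \<noteq> m" using insert.prems insert.hyps m(1) by auto
    show ?case
    proof (cases "a \<sqsubset> m")
      case True then show ?thesis using m by blast
    next
      case False
      then have ma: "m \<sqsubset> a" using lt_total c by blast
      have "x \<sqsubset> a" if "x \<in> A" for x
      proof (cases "x = m")
        case False
        then have "x \<sqsubset> m" using m(2) that by blast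
        then show ?thesis by (rule lt_trans[OF _ ma]) (use that insert.prems c in auto)
      qed (use ma in simp)
      then show ?thesis by blast
    qed
  qed
  then show ?thesis using that by blast
qed

text \<open>Elements are added in increasing order, so the new one always lies above the earlier
  ones.\<close>

lemma finite_top_induct [consumes 2, case_names empty insert]:
  assumes "finite A" "A \<subseteq> carrier G" and "P {}"
    and step: "\<And>m T. finite T \<Longrightarrow> T \<subseteq> carrier G \<Longrightarrow> m \<in> carrier G \<Longrightarrow> m \<notin> T \<Longrightarrow> \<forall>x\<in>T. x \<sqsubset> m \<Longrightarrow> P T \<Longrightarrow>
      P (insert m T)"
  shows "P A"
  using assms(1,2)
proof (induction "card A" arbitrary: A)
  case 0 then show ?case using assms(3) by simp
next
  case (Suc n)
  then have "A \<noteq> {}" by auto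
  then obtain m where m: "m \<in> A" "\<forall>x\<in>A. x = m \<or> x \<sqsubset> m" using finite_has_top Suc.prems by blast
  have "P (A - {m})" by (rule Suc.hyps(1)) (use Suc.hyps(2) Suc.prems m(1) in auto)
  then have "P (insert m (A - {m}))" using Suc.prems m by (intro step) auto
  then show ?case using m(1) by (simp add: insert_absorb)
qed

section \<open>Few products force commutation\<close>

lemma finite_set_mult: "finite A \<Longrightarrow> finite B \<Longrightarrow> finite (A <#> B)"
  by (simp add: set_mult_def)

lemma set_multI: "x \<in> A \<Longrightarrow> y \<in> B \<Longrightarrow> x \<otimes> y \<in> A <#> B"
  by (auto simp: set_mult_def)

lemma set_multE:
  assumes "z \<in> A <#> B" obtains x y where "x \<in> A" "y \<in> B" "z = x \<otimes> y"
  using assms by (auto simp: set_mult_def)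

lemma square_below:
  assumes "T \<subseteq> carrier G" "a \<in> carrier G" "b \<in> carrier G"
    and "\<forall>x\<in>T. x \<sqsubset> a \<or> x = a" "\<forall>x\<in>T. x \<sqsubset> b \<or> x = b" "(\<forall>x\<in>T. x \<sqsubset> a) \<or> (\<forall>x\<in>T. x \<sqsubset> b)"
  shows "a \<otimes> b \<notin> T <#> T"
proof
  assume "a \<otimes> b \<in> T <#> T"
  then obtain x y where xy: "x \<in> T" "y \<in> T" "a \<otimes> b = x \<otimes> y" by (rule set_multE)
  then have "x \<otimes> y \<sqsubset> a \<otimes> b" using assms by (intro mult_lt_mult) blast+
  then show False using lt_irrefl[OF m_closed[OF assms(2,3)]] unfolding xy(3) by blast
qed

text \<open>A new largest \<open>m\<close> contributes \<open>m m\<close> and \<open>m p\<close>,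
  with \<open>p\<close> the previous largest element; both exceed all earlier products.\<close>

lemma card_square_ge:
  assumes "finite A" "A \<subseteq> carrier G" shows "A \<noteq> {} \<longrightarrow> 2 * card A \<le> card (A <#> A) + 1"
  using assms
proof (induction A rule: finite_top_induct)
  case empty then show ?case by simp
next
  case (insert m T)
  let ?S = "insert m T"
  have fin: "finite (?S <#> ?S)" using insert.hyps by (intro finite_set_mult) auto
  show ?case
  proof (cases "T = {}")
    case True
    have "{m \<otimes> m} \<subseteq> ?S <#> ?S" using set_multI[of m ?S m ?S] by simp
    then have "card {m \<otimes> m} \<le> card (?S <#> ?S)" by (rule card_mono[OF fin])
    then show ?thesis using True by simp
  next
    case False
    then obtain p where p: "p \<in> T" "\<forall>x\<in>T. x = p \<or> x \<sqsubset> p" using finite_has_top insert.hyps by blast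
    have pm: "p \<in> carrier G" "m \<in> carrier G" "p \<noteq> m" using p insert.hyps by auto
    have "m \<otimes> m \<notin> T <#> T" using insert.hyps by (intro square_below) auto
    moreover have "m \<otimes> p \<notin> T <#> T" using insert.hyps p pm by (intro square_below) auto
    moreover have "m \<otimes> m \<noteq> m \<otimes> p" using pm by simp
    moreover have finT: "finite (T <#> T)" using insert.hyps by (intro finite_set_mult) auto
    ultimately have "card (insert (m \<otimes> m) (insert (m \<otimes> p) (T <#> T))) = card (T <#> T) + 2" by simp
    moreover have "insert (m \<otimes> m) (insert (m \<otimes> p) (T <#> T)) \<subseteq> ?S <#> ?S"
      using p(1) by (auto simp: set_mult_def)
    then have "card (insert (m \<otimes> m) (insert (m \<otimes> p) (T <#> T))) \<le> card (?S <#> ?S)" by (rule card_mono[OF fin])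
    ultimately show ?thesis using insert.IH False insert.hyps by simp
  qed
qed

text \<open>Equal translates would make conjugation by \<open>m\<close> a permutation of
  \<open>T\<close>. The largest \<open>z\<close> in \<open>T\<close> that does not commute with
  \<open>m\<close> has only fixed elements above it, so conjugation and its inverse both move
  \<open>z\<close> down, giving \<open>m z < z m\<close> and \<open>z m < m z\<close>.\<close>

lemma translates_differ:
  assumes T: "finite T" "T \<subseteq> carrier G" and m: "m \<in> carrier G" and y: "y \<in> T" "m \<otimes> y \<noteq> y \<otimes> m"
  shows "(\<lambda>x. m \<otimes> x) ` T \<noteq> (\<lambda>x. x \<otimes> m) ` T"
proof
  assume eq: "(\<lambda>x. m \<otimes> x) ` T = (\<lambda>x. x \<otimes> m) ` T"
  define A where "A = {x \<in> T. m \<otimes> x \<noteq> x \<otimes> m}"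
  have "finite A" "A \<noteq> {}" "A \<subseteq> carrier G" unfolding A_def using T y by auto
  then obtain z where z: "z \<in> A" "\<forall>x\<in>A. x = z \<or> x \<sqsubset> z" by (rule finite_has_top)
  have zT: "z \<in> T" "m \<otimes> z \<noteq> z \<otimes> m" "z \<in> carrier G" using z(1) T unfolding A_def by auto
  have above: "m \<otimes> x = x \<otimes> m" if "x \<in> T" "z \<sqsubset> x" for x
  proof (rule ccontr)
    assume "m \<otimes> x \<noteq> x \<otimes> m"
    then have "x \<in> A" unfolding A_def using that by simp
    then have "x = z \<or> x \<sqsubset> z" using z(2) by blast
    then show False using that(2) lt_trans[OF that(2), of z] lt_irrefl[OF zT(3)] zT(3) T(2) that(1) by blast
  qed
  have "m \<otimes> z \<in> (\<lambda>x. x \<otimes> m) ` T" using eq zT(1) by blast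
  then obtain u where u: "u \<in> T" "m \<otimes> z = u \<otimes> m" by blast
  have "z \<otimes> m \<in> (\<lambda>x. m \<otimes> x) ` T" using eq zT(1) by blast
  then obtain v where v: "v \<in> T" "z \<otimes> m = m \<otimes> v" by blast
  have c: "u \<in> carrier G" "v \<in> carrier G" using u v T by auto
  have nz: "u \<noteq> z" "v \<noteq> z" using u v zT by auto
  have nu: "\<not> z \<sqsubset> u"
  proof
    assume "z \<sqsubset> u"
    then have "m \<otimes> z = m \<otimes> u" using above[OF u(1)] u(2) by simp
    then show False using nz m c zT by simp
  qed
  have nv: "\<not> z \<sqsubset> v"
  proof
    assume "z \<sqsubset> v"
    then have "z \<otimes> m = v \<otimes> m" using above[OF v(1)] v(2) by simp
    then show False using nz m c zT by simp
  qed
  have "u \<sqsubset> z" "v \<sqsubset> z" using nu nv nz lt_total c zT(3) by blast+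
  then have "u \<otimes> m \<sqsubset> z \<otimes> m" "m \<otimes> v \<sqsubset> m \<otimes> z" using lt_mult_left lt_mult_right c zT(3) m by blast+
  then have "m \<otimes> z \<sqsubset> z \<otimes> m" "z \<otimes> m \<sqsubset> m \<otimes> z" using u v by simp_all
  then show False using lt_trans[of "m \<otimes> z" "z \<otimes> m" "m \<otimes> z"] lt_irrefl[of "m \<otimes> z"] m zT(3) by simp
qed

text \<open>If \<open>m\<close> does not commute with \<open>y\<close>, both translates of
  \<open>T\<close> avoid the products of \<open>T\<close>. They differ, so together they have at
  least |T| + 1 elements, and with \<open>m m\<close> there are at least (2|T| - 1) + (|T| + 1) + 1
  = 3|S| - 2 products.\<close>

lemma top_commutes:
  assumes T: "finite T" "T \<subseteq> carrier G" and m: "m \<in> carrier G" "\<forall>x\<in>T. x \<sqsubset> m" "m \<notin> T"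
    and comm: "\<forall>x\<in>T. \<forall>y\<in>T. x \<otimes> y = y \<otimes> x"
    and small: "card (insert m T <#> insert m T) + 3 \<le> 3 * card (insert m T)" and y: "y \<in> T"
  shows "m \<otimes> y = y \<otimes> m"
proof (rule ccontr)
  assume nc: "m \<otimes> y \<noteq> y \<otimes> m"
  let ?L = "(\<lambda>x. m \<otimes> x) ` T" and ?R = "(\<lambda>x. x \<otimes> m) ` T" and ?Q = "T <#> T" and ?S = "insert m T"
  have cT: "x \<in> carrier G" if "x \<in> T" for x using T that by blast
  \<comment> \<open>In a relation \<open>m z = a b\<close> the elements \<open>a\<close>,
    \<open>b\<close> and \<open>z\<close> all commute with \<open>y\<close>, so \<open>m\<close>
    would commute with \<open>y\<close> too.\<close>
  have disjL: "m \<otimes> z \<notin> ?Q" if z: "z \<in> T" for z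
  proof
    assume "m \<otimes> z \<in> ?Q"
    then obtain a b where ab: "a \<in> T" "b \<in> T" "m \<otimes> z = a \<otimes> b" by (rule set_multE)
    have c: "a \<in> carrier G" "b \<in> carrier G" "z \<in> carrier G" "y \<in> carrier G" using ab z y cT by auto
    have "(m \<otimes> y) \<otimes> z = (m \<otimes> z) \<otimes> y" using comm z y c m by (simp add: m_assoc)
    also have "\<dots> = a \<otimes> (b \<otimes> y)" using ab(3) c by (simp add: m_assoc)
    also have "\<dots> = (a \<otimes> y) \<otimes> b" using comm ab y c by (simp add: m_assoc)
    also have "\<dots> = (y \<otimes> a) \<otimes> b" using comm ab(1) y by simp
    also have "\<dots> = y \<otimes> (a \<otimes> b)" using c by (simp add: m_assoc)
    also have "\<dots> = (y \<otimes> m) \<otimes> z" using ab(3)[symmetric] c m by (simp add: m_assoc)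
    finally show False using nc c m by simp
  qed
  have disjR: "z \<otimes> m \<notin> ?Q" if z: "z \<in> T" for z
  proof
    assume "z \<otimes> m \<in> ?Q"
    then obtain a b where ab: "a \<in> T" "b \<in> T" "z \<otimes> m = a \<otimes> b" by (rule set_multE)
    have c: "a \<in> carrier G" "b \<in> carrier G" "z \<in> carrier G" "y \<in> carrier G" using ab z y cT by auto
    have "z \<otimes> (m \<otimes> y) = (z \<otimes> m) \<otimes> y" using c m by (simp add: m_assoc)
    also have "\<dots> = a \<otimes> (b \<otimes> y)" using ab(3) c by (simp add: m_assoc)
    also have "\<dots> = (a \<otimes> y) \<otimes> b" using comm ab y c by (simp add: m_assoc)
    also have "\<dots> = (y \<otimes> a) \<otimes> b" using comm ab(1) y by simp
    also have "\<dots> = y \<otimes> (a \<otimes> b)" using c by (simp add: m_assoc)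
    also have "\<dots> = (y \<otimes> z) \<otimes> m" using ab(3)[symmetric] c m by (simp add: m_assoc)
    also have "\<dots> = (z \<otimes> y) \<otimes> m" using comm y z by simp
    also have "\<dots> = z \<otimes> (y \<otimes> m)" using c m by (simp add: m_assoc)
    finally show False using nc c m by simp
  qed
  have mm: "m \<otimes> m \<notin> ?Q" using T m by (intro square_below) auto
  have mLR: "m \<otimes> m \<notin> ?L \<union> ?R" using m cT by auto
  have injL: "inj_on (\<lambda>x. m \<otimes> x) T" and injR: "inj_on (\<lambda>x. x \<otimes> m) T" using m cT by (auto simp: inj_on_def)
  have cL: "card ?L = card T" "card ?R = card T" using card_image[OF injL] card_image[OF injR] by simp_all
  have LR: "card T + 1 \<le> card (?L \<union> ?R)"
  proof (rule ccontr)
    assume "\<not> ?thesis"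
    then have le: "card (?L \<union> ?R) \<le> card T" by simp
    have "?L = ?L \<union> ?R" by (rule card_seteq) (use T le cL in auto)
    moreover have "?R = ?L \<union> ?R" by (rule card_seteq) (use T le cL in auto)
    ultimately show False using translates_differ[OF T m(1) y nc] by simp
  qed
  have finQ: "finite ?Q" using T by (intro finite_set_mult)
  have finU: "finite (?L \<union> ?R)" using T by simp
  have "?Q \<inter> (?L \<union> ?R) = {}" using disjL disjR by blast
  then have "card (?Q \<union> (?L \<union> ?R)) = card ?Q + card (?L \<union> ?R)" by (rule card_Un_disjoint[OF finQ finU])
  moreover have "m \<otimes> m \<notin> ?Q \<union> (?L \<union> ?R)" using mm mLR by blast
  moreover have "finite (?Q \<union> (?L \<union> ?R))" using finQ finU by blast
  ultimately have "card (insert (m \<otimes> m) (?Q \<union> (?L \<union> ?R))) = Suc (card ?Q + card (?L \<union> ?R))" by simp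
  moreover have "card (insert (m \<otimes> m) (?Q \<union> (?L \<union> ?R))) \<le> card (?S <#> ?S)"
  proof (rule card_mono)
    show "finite (?S <#> ?S)" using T by (intro finite_set_mult) auto
    show "insert (m \<otimes> m) (?Q \<union> (?L \<union> ?R)) \<subseteq> ?S <#> ?S" by (auto simp: set_mult_def)
  qed
  moreover have "2 * card T \<le> card ?Q + 1" using card_square_ge[OF T] y by blast
  moreover have "card ?S = Suc (card T)" using T(1) m(3) by simp
  ultimately show False using LR small by linarith
qed

text \<open>Only \<open>m m\<close> and \<open>m p\<close> can be new products, with
  \<open>p\<close> the second largest element. Take \<open>y\<close> largest among the elements that
  fail to commute with some larger \<open>z\<close>; the elements above \<open>y\<close> commute
  with each other. Both \<open>m y\<close> and \<open>y m\<close> are old products, and comparing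
  their factors with \<open>y\<close> and \<open>m\<close> gives
  \<open>m y < y m < m y\<close>.\<close>

lemma tight_commutes:
  assumes T: "finite T" "T \<subseteq> carrier G" "T \<noteq> {}" and m: "m \<in> carrier G" "\<forall>x\<in>T. x \<sqsubset> m" "m \<notin> T"
    and tight: "card (insert m T <#> insert m T) \<le> card (T <#> T) + 2"
  shows "\<forall>x\<in>insert m T. \<forall>y\<in>insert m T. x \<otimes> y = y \<otimes> x"
proof (rule ccontr)
  assume nc: "\<not> ?thesis"
  let ?Q = "T <#> T" and ?S = "insert m T"
  have cS: "x \<in> carrier G" if "x \<in> ?S" for x using T m that by blast
  obtain p where p: "p \<in> T" "\<forall>x\<in>T. x = p \<or> x \<sqsubset> p" using finite_has_top T by blast
  have pc: "p \<in> carrier G" "p \<noteq> m" "p \<sqsubset> m" using p m cS by auto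
  have nQ: "m \<otimes> m \<notin> ?Q" "m \<otimes> p \<notin> ?Q" "p \<otimes> m \<notin> ?Q"
    by (rule square_below; use T m p pc in blast)+
  have finQ: "finite ?Q" and finS: "finite (?S <#> ?S)" using T by (intro finite_set_mult; simp)+
  have new: "z = m \<otimes> m \<or> z = m \<otimes> p" if "z \<in> ?S <#> ?S" "z \<notin> ?Q" for z
  proof (rule ccontr)
    assume n: "\<not> ?thesis"
    then have "card (insert z (insert (m \<otimes> m) (insert (m \<otimes> p) ?Q))) = card ?Q + 3"
      using nQ that finQ pc m by simp
    moreover have "insert z (insert (m \<otimes> m) (insert (m \<otimes> p) ?Q)) \<subseteq> ?S <#> ?S"
      using that(1) p(1) by (auto simp: set_mult_def)
    then have "card (insert z (insert (m \<otimes> m) (insert (m \<otimes> p) ?Q))) \<le> card (?S <#> ?S)" by (rule card_mono[OF finS])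
    ultimately show False using tight by simp
  qed
  have "p \<otimes> m \<in> ?S <#> ?S" using p(1) by (intro set_multI) auto
  then have pm: "p \<otimes> m = m \<otimes> p" using new[OF _ nQ(3)] pc m by auto
  define A where "A = {x \<in> ?S. \<exists>z\<in>?S. x \<sqsubset> z \<and> x \<otimes> z \<noteq> z \<otimes> x}"
  have asym: "\<not> (x \<sqsubset> y \<and> y \<sqsubset> x)" if "x \<in> ?S" "y \<in> ?S" for x y
    using lt_trans[of x y x] lt_irrefl[of x] cS that by blast
  have "A \<noteq> {}"
  proof -
    obtain x y where xy: "x \<in> ?S" "y \<in> ?S" "x \<otimes> y \<noteq> y \<otimes> x" using nc by blast
    then have "x \<noteq> y" by auto
    then have "x \<sqsubset> y \<or> y \<sqsubset> x" using lt_total cS xy by blast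
    then have "x \<in> A \<or> y \<in> A" unfolding A_def using xy by force
    then show ?thesis by blast
  qed
  moreover have "finite A" "A \<subseteq> carrier G" unfolding A_def using T cS by auto
  ultimately obtain y where y: "y \<in> A" "\<forall>x\<in>A. x = y \<or> x \<sqsubset> y" using finite_has_top by blast
  obtain z where z: "z \<in> ?S" "y \<sqsubset> z" "y \<otimes> z \<noteq> z \<otimes> y" using y(1) unfolding A_def by blast
  have yS: "y \<in> ?S" "y \<in> carrier G" using y(1) cS unfolding A_def by auto
  have top: "x = m \<or> x \<sqsubset> m" if "x \<in> ?S" for x using m that by blast
  have ym: "y \<noteq> m" using asym[OF z(1), of m] top[OF z(1)] z(2) lt_irrefl[OF m(1)] by blast
  have yT: "y \<in> T" using yS ym by blast
  have yp: "y \<noteq> p"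
  proof
    assume e: "y = p"
    have "z = m"
    proof (rule ccontr)
      assume "z \<noteq> m"
      then have "z = p \<or> z \<sqsubset> p" using z(1) p(2) by blast
      then show False using asym[OF z(1), of p] z(2) e p(1) lt_irrefl[OF pc(1)] by blast
    qed
    then show False using z(3) e pm by simp
  qed
  have ylt: "y \<sqsubset> p" "y \<sqsubset> m" using yT p(2) yp m(2) by blast+
  have nA: "x \<notin> A" if x: "x \<in> ?S" "y \<sqsubset> x" for x
  proof
    assume "x \<in> A"
    then have "x = y \<or> x \<sqsubset> y" using y(2) by blast
    then show False using x(2) asym[OF x(1) yS(1)] lt_irrefl[OF yS(2)] by auto
  qed
  have above: "a \<otimes> b = b \<otimes> a" if "a \<in> ?S" "b \<in> ?S" "y \<sqsubset> a" "y \<sqsubset> b" for a b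
  proof (rule ccontr)
    assume n: "a \<otimes> b \<noteq> b \<otimes> a"
    then have "a \<noteq> b" by auto
    then have "a \<sqsubset> b \<or> b \<sqsubset> a" using lt_total cS that by blast
    then have "a \<in> A \<or> b \<in> A" unfolding A_def using n that by force
    then show False using nA that by blast
  qed
  have inQ: "m \<otimes> y \<in> ?Q" "y \<otimes> m \<in> ?Q"
  proof -
    have "y \<otimes> m \<noteq> p \<otimes> m" using yp yS pc m by simp
    then have ne: "m \<otimes> y \<noteq> m \<otimes> m" "m \<otimes> y \<noteq> m \<otimes> p" "y \<otimes> m \<noteq> m \<otimes> m" "y \<otimes> m \<noteq> m \<otimes> p"
      using ym yp yS pc m by (simp_all add: pm)
    have "m \<otimes> y \<in> ?S <#> ?S" "y \<otimes> m \<in> ?S <#> ?S" using yS by (auto intro: set_multI)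
    then show "m \<otimes> y \<in> ?Q" "y \<otimes> m \<in> ?Q" using new ne by blast+
  qed
  have cz: "z \<in> carrier G" using z cS by blast
  obtain i l where il: "i \<in> T" "l \<in> T" "m \<otimes> y = i \<otimes> l" by (rule set_multE[OF inQ(1)])
  obtain r q where rq: "r \<in> T" "q \<in> T" "y \<otimes> m = r \<otimes> q" by (rule set_multE[OF inQ(2)])
  have c: "i \<in> carrier G" "l \<in> carrier G" "r \<in> carrier G" "q \<in> carrier G" using il rq cS by auto
  have leI: "a = b \<or> a \<sqsubset> b" if "\<not> b \<sqsubset> a" "a \<in> carrier G" "b \<in> carrier G" for a b
    using lt_total that by blast
  \<comment> \<open>As \<open>i\<close> lies below \<open>m\<close>, the other factor must lie above
    \<open>y\<close> for the product to reach \<open>m y\<close>.\<close>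
  have yl: "y \<sqsubset> l"
  proof (rule ccontr)
    assume "\<not> y \<sqsubset> l"
    then have "l \<sqsubset> y \<or> l = y" using leI[of l y] c yS by blast
    moreover have "i \<sqsubset> m" using il(1) m(2) by blast
    ultimately have "i \<otimes> l \<sqsubset> m \<otimes> y" using m(1) c yS by (intro mult_lt_mult) simp_all
    then show False using il(3) lt_irrefl[of "i \<otimes> l"] c by simp
  qed
  have yr: "y \<sqsubset> r"
  proof (rule ccontr)
    assume "\<not> y \<sqsubset> r"
    then have "r \<sqsubset> y \<or> r = y" using leI[of r y] c yS by blast
    moreover have "q \<sqsubset> m" using rq(2) m(2) by blast
    ultimately have "r \<otimes> q \<sqsubset> y \<otimes> m" using m(1) c yS by (intro mult_lt_mult) simp_all
    then show False using rq(3) lt_irrefl[of "r \<otimes> q"] c by simp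
  qed
  have zm: "z \<otimes> m = m \<otimes> z" using above[OF z(1) _ z(2) ylt(2)] by blast
  \<comment> \<open>If both factors lay above \<open>y\<close>, they would commute with
    \<open>z\<close>, as \<open>m\<close> does. Cancelling \<open>m\<close> in
    \<open>m y z = m z y\<close> would then contradict the choice of \<open>z\<close>.\<close>
  have ni: "\<not> y \<sqsubset> i"
  proof
    assume yi: "y \<sqsubset> i"
    have zi: "z \<otimes> i = i \<otimes> z" "z \<otimes> l = l \<otimes> z" using above[OF z(1) _ z(2)] il yi yl by blast+
    have "m \<otimes> (y \<otimes> z) = i \<otimes> (l \<otimes> z)" using il(3) c cz m yS by (simp add: m_assoc[symmetric])
    also have "\<dots> = (i \<otimes> z) \<otimes> l" using zi c cz by (simp add: m_assoc)
    also have "\<dots> = z \<otimes> (m \<otimes> y)" using zi il(3) c cz by (simp add: m_assoc[symmetric])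
    also have "\<dots> = m \<otimes> (z \<otimes> y)" using zm cz m yS by (simp add: m_assoc[symmetric])
    finally show False using z(3) cz m yS by simp
  qed
  have nq: "\<not> y \<sqsubset> q"
  proof
    assume yq: "y \<sqsubset> q"
    have zr: "z \<otimes> r = r \<otimes> z" "z \<otimes> q = q \<otimes> z" using above[OF z(1) _ z(2)] rq yq yr by blast+
    have "(z \<otimes> y) \<otimes> m = (z \<otimes> r) \<otimes> q" using rq(3) c cz m yS by (simp add: m_assoc)
    also have "\<dots> = r \<otimes> (z \<otimes> q)" using zr c cz by (simp add: m_assoc)
    also have "\<dots> = (y \<otimes> m) \<otimes> z" using zr rq(3) c cz by (simp add: m_assoc)
    also have "\<dots> = (y \<otimes> z) \<otimes> m" using zm cz m yS by (simp add: m_assoc)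
    finally show False using z(3) cz m yS by simp
  qed
  have "i \<sqsubset> y \<or> i = y" "q \<sqsubset> y \<or> q = y" using leI[of i y] leI[of q y] ni nq c yS by blast+
  moreover have "l \<sqsubset> m" "r \<sqsubset> m" using il(2) rq(1) m(2) by blast+
  ultimately have "i \<otimes> l \<sqsubset> y \<otimes> m" "r \<otimes> q \<sqsubset> m \<otimes> y" using m(1) c yS by (simp_all add: mult_lt_mult)
  then have "m \<otimes> y \<sqsubset> y \<otimes> m" "y \<otimes> m \<sqsubset> m \<otimes> y" using il rq by simp_all
  then show False using lt_trans[of "m \<otimes> y" "y \<otimes> m" "m \<otimes> y"] lt_irrefl[of "m \<otimes> y"] m yS by simp
qed

text \<open>Either the set without its maximum still satisfies the bound, so it commutes by
  induction and \<open>top_commutes\<close> adds the maximum; or it violates the bound, and then the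
  maximum has added at most two products.\<close>

theorem small_square_commutes:
  assumes "finite S" "S \<subseteq> carrier G"
  shows "card (S <#> S) + 3 \<le> 3 * card S \<longrightarrow> (\<forall>x\<in>S. \<forall>y\<in>S. x \<otimes> y = y \<otimes> x)"
  using assms
proof (induction S rule: finite_top_induct)
  case empty then show ?case by simp
next
  case (insert m T)
  show ?case
  proof (intro impI)
    assume small: "card (insert m T <#> insert m T) + 3 \<le> 3 * card (insert m T)"
    show "\<forall>x\<in>insert m T. \<forall>y\<in>insert m T. x \<otimes> y = y \<otimes> x"
    proof (cases "T = {}")
      case True then show ?thesis by simp
    next
      case F: False
      show ?thesis
      proof (cases "card (T <#> T) + 3 \<le> 3 * card T")
        case True
        then have comm: "\<forall>x\<in>T. \<forall>y\<in>T. x \<otimes> y = y \<otimes> x" using insert.IH by blast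
        have "m \<otimes> y = y \<otimes> m" if "y \<in> T" for y
          by (rule top_commutes) (use insert.hyps comm small that in blast)+
        then show ?thesis using comm by simp
      next
        case False
        then have "card (insert m T <#> insert m T) \<le> card (T <#> T) + 2" using small insert.hyps by simp
        then show ?thesis using insert.hyps F by (intro tight_commutes)
      qed
    qed
  qed
qed

end

section \<open>Homomorphisms to the integers\<close>

lemma (in group) commutes_generate:
  assumes "S \<subseteq> carrier G" "y \<in> carrier G" "\<And>s. s \<in> S \<Longrightarrow> s \<otimes> y = y \<otimes> s" "h \<in> generate G S"
  shows "h \<otimes> y = y \<otimes> h"
  using assms(4)
proof induction
  case one then show ?case using assms(2) by simp
next
  case (incl h) then show ?case by (rule assms(3))
next
  case (inv h)
  then have h: "h \<in> carrier G" "h \<otimes> y = y \<otimes> h" using assms by blast+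
  have "inv h \<otimes> y = inv h \<otimes> (y \<otimes> h) \<otimes> inv h" using h(1) assms(2) by (simp add: m_assoc)
  also have "\<dots> = y \<otimes> inv h" unfolding h(2)[symmetric] using h(1) assms(2) by (simp add: m_assoc[symmetric])
  finally show ?case .
next
  case (eng h1 h2)
  then have c: "h1 \<in> carrier G" "h2 \<in> carrier G" using generate_incl[OF assms(1)] by blast+
  have "h1 \<otimes> h2 \<otimes> y = h1 \<otimes> (y \<otimes> h2)" using eng.IH c assms(2) by (simp add: m_assoc)
  also have "\<dots> = (y \<otimes> h1) \<otimes> h2" using eng.IH(1)[symmetric] c assms(2) by (simp add: m_assoc[symmetric])
  also have "\<dots> = y \<otimes> (h1 \<otimes> h2)" using c assms(2) by (simp add: m_assoc)
  finally show ?case .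
qed

lemma (in group) comm_group_generate:
  assumes S: "S \<subseteq> carrier G" and comm: "\<And>x y. x \<in> S \<Longrightarrow> y \<in> S \<Longrightarrow> x \<otimes> y = y \<otimes> x"
  shows "comm_group (G\<lparr>carrier := generate G S\<rparr>)"
proof -
  interpret K: group "G\<lparr>carrier := generate G S\<rparr>" by (rule subgroup_imp_group[OF generate_is_subgroup[OF S]])
  \<comment> \<open>Commutation is extended from generators to the subgroup one argument at a
    time.\<close>
  have "x \<otimes> y = y \<otimes> x" if "x \<in> generate G S" "y \<in> generate G S" for x y
  proof (rule commutes_generate[OF S _ _ that(1)])
    show yc: "y \<in> carrier G" using that(2) generate_incl[OF S] by blast
    show "s \<otimes> y = y \<otimes> s" if "s \<in> S" for s
      by (rule commutes_generate[OF S _ _ \<open>y \<in> generate G S\<close>, symmetric]) (use that S comm in auto)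
  qed
  then show ?thesis by (intro K.group_comm_groupI) simp
qed

lemma (in group) subgroup_pow_closed:
  "subgroup B G \<Longrightarrow> x \<in> B \<Longrightarrow> x [^] (n::nat) \<in> B"
  by (induction n) (simp_all add: subgroup.one_closed subgroup.m_closed)

lemma (in group) subgroup_int_power_closed:
  "subgroup B G \<Longrightarrow> x \<in> B \<Longrightarrow> x [^] (i::int) \<in> B"
  by (cases i rule: int_cases2)
    (simp_all add: int_pow_int int_pow_neg subgroup_pow_closed subgroup.m_inv_closed subgroup.mem_carrier)

text \<open>Additivity is demanded on \<open>B\<close> only, so \<open>\<phi>\<close> is a total
  function with arbitrary values elsewhere and can be replaced as \<open>B\<close> grows.\<close>

definition separated :: "('a, 'b) monoid_scheme \<Rightarrow> 'a set \<Rightarrow> 'a set \<Rightarrow> bool"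
  where "separated G B F \<longleftrightarrow> (\<exists>\<phi>::'a \<Rightarrow> int. (\<forall>x\<in>B. \<forall>y\<in>B. \<phi> (x \<otimes>\<^bsub>G\<^esub> y) = \<phi> x + \<phi> y) \<and> (\<forall>f\<in>F. \<phi> f \<noteq> 0))"

text \<open>For a new element with a power in \<open>B\<close>: the m-th power map is a homomorphism
  from \<open>B'\<close> into \<open>B\<close>, and composing with it avoids dividing values of
  \<open>\<phi>\<close>.\<close>

lemma (in comm_group) separated_power:
  assumes B: "subgroup B G" and B': "B' \<subseteq> carrier G" "\<And>x. x \<in> B' \<Longrightarrow> x [^] (m::nat) \<in> B"
    and sep: "separated G B ((\<lambda>x. x [^] m) ` F)"
  shows "separated G B' F"
proof -
  obtain \<phi> :: "'a \<Rightarrow> int" where \<phi>: "\<forall>x\<in>B. \<forall>y\<in>B. \<phi> (x \<otimes> y) = \<phi> x + \<phi> y" "\<forall>f\<in>F. \<phi> (f [^] m) \<noteq> 0"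
    using sep unfolding separated_def by auto
  have "\<phi> ((x \<otimes> y) [^] m) = \<phi> (x [^] m) + \<phi> (y [^] m)" if "x \<in> B'" "y \<in> B'" for x y
  proof -
    have "x \<in> carrier G" "y \<in> carrier G" using that B'(1) by auto
    then show ?thesis using \<phi>(1) B'(2)[OF that(1)] B'(2)[OF that(2)] by (simp add: nat_pow_distrib)
  qed
  then show ?thesis unfolding separated_def using \<phi>(2) by (intro exI[of _ "\<lambda>x. \<phi> (x [^] m)"]) simp
qed

text \<open>For a new element independent of \<open>B\<close>: its value may be chosen freely, and a
  value larger than all those on the \<open>B\<close>-parts of \<open>F\<close> rules out
  cancellation.\<close>

lemma (in comm_group) separated_free:
  assumes B: "subgroup B G" and s: "s \<in> carrier G" and free: "\<And>m::nat. 0 < m \<Longrightarrow> s [^] m \<notin> B"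
    and B': "\<And>x. x \<in> B' \<Longrightarrow> \<exists>g\<in>B. \<exists>i::int. x = g \<otimes> s [^] i"
    and F: "finite F" "F \<subseteq> B'" and sep: "separated G B (F \<inter> B)"
  shows "separated G B' F"
proof -
  have cB: "g \<in> carrier G" if "g \<in> B" for g using subgroup.mem_carrier[OF B that] .
  have pos: "i \<le> j" if gh: "g \<in> B" "h \<in> B" "g \<otimes> s [^] i = h \<otimes> s [^] j" for g h and i j :: int
  proof (rule ccontr)
    assume "\<not> i \<le> j"
    then obtain m :: nat where m: "0 < m" "i = j + int m" by (intro that[of "nat (i - j)"]) auto
    have "(g \<otimes> s [^] m) \<otimes> s [^] j = g \<otimes> s [^] i"
      using s cB gh unfolding m by (simp add: int_pow_mult int_pow_int m_ac)
    then have "g \<otimes> s [^] m = h" using gh s cB by simp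
    then have "s [^] m = inv g \<otimes> h" using gh s cB by (auto simp: m_assoc[symmetric])
    then have "s [^] m \<in> B" using gh B by (simp add: subgroup.m_closed subgroup.m_inv_closed)
    then show False using free m by blast
  qed
  have uniq: "i = j \<and> g = h" if gh: "g \<in> B" "h \<in> B" "g \<otimes> s [^] i = h \<otimes> s [^] j" for g h and i j :: int
  proof -
    have "i = j" using pos[OF gh] pos[OF gh(2,1) gh(3)[symmetric]] by simp
    then show ?thesis using gh s cB by simp
  qed
  \<comment> \<open>A choice of the \<open>B\<close>-part and the exponent of \<open>s\<close>; the
    default \<open>(x, 0)\<close> makes \<open>Q\<close> total.\<close>
  define Q where "Q x = (if \<exists>g\<in>B. \<exists>i::int. x = g \<otimes> s [^] i then (SOME p. fst p \<in> B \<and> x = fst p \<otimes> s [^] (snd p :: int)) else (x, 0))" for x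
  have Qeq: "Q (g \<otimes> s [^] i) = (g, i)" if g: "g \<in> B" for g i
  proof -
    have "(SOME p. fst p \<in> B \<and> g \<otimes> s [^] i = fst p \<otimes> s [^] (snd p :: int)) = (g, i)"
    proof (rule some_equality)
      show "fst (g, i) \<in> B \<and> g \<otimes> s [^] i = fst (g, i) \<otimes> s [^] snd (g, i)" using g by simp
      show "p = (g, i)" if "fst p \<in> B \<and> g \<otimes> s [^] i = fst p \<otimes> s [^] (snd p :: int)" for p
        using uniq[of g "fst p" i "snd p"] g that by (simp add: prod_eq_iff)
    qed
    then show ?thesis unfolding Q_def using g by auto
  qed
  obtain \<phi> :: "'a \<Rightarrow> int" where \<phi>: "\<forall>x\<in>B. \<forall>y\<in>B. \<phi> (x \<otimes> y) = \<phi> x + \<phi> y" "\<forall>f\<in>F \<inter> B. \<phi> f \<noteq> 0"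
    using sep unfolding separated_def by auto
  \<comment> \<open>The summand 1 makes \<open>c\<close> strictly larger than the absolute values on
    all \<open>B\<close>-parts, also for empty \<open>F\<close>.\<close>
  define c where "c = 1 + (\<Sum>f\<in>F. \<bar>\<phi> (fst (Q f))\<bar>)"
  define \<psi> where "\<psi> x = \<phi> (fst (Q x)) + c * snd (Q x)" for x
  have "\<psi> (x \<otimes> y) = \<psi> x + \<psi> y" if xy: "x \<in> B'" "y \<in> B'" for x y
  proof -
    obtain g h and i j :: int where gh: "g \<in> B" "h \<in> B" "x = g \<otimes> s [^] i" "y = h \<otimes> s [^] j"
      using B'[OF xy(1)] B'[OF xy(2)] by blast
    have "x \<otimes> y = (g \<otimes> h) \<otimes> s [^] (i + j)" using gh s cB by (simp add: int_pow_mult m_ac)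
    moreover have "g \<otimes> h \<in> B" using gh B by (simp add: subgroup.m_closed)
    ultimately have "\<psi> (x \<otimes> y) = \<phi> (g \<otimes> h) + c * (i + j)" unfolding \<psi>_def by (simp add: Qeq)
    moreover have "\<psi> x = \<phi> g + c * i" "\<psi> y = \<phi> h + c * j" unfolding \<psi>_def using gh by (simp_all add: Qeq)
    ultimately show ?thesis using \<phi>(1) gh by (simp add: algebra_simps)
  qed
  moreover have "\<psi> f \<noteq> 0" if f: "f \<in> F" for f
  proof -
    obtain g and i :: int where gi: "g \<in> B" "f = g \<otimes> s [^] i" using B'[of f] F(2) f by blast
    have \<psi>f: "\<psi> f = \<phi> g + c * i" unfolding \<psi>_def using gi by (simp add: Qeq)
    show ?thesis
    proof (cases "i = 0")
      case True
      then have "f = g" using gi cB by simp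
      then show ?thesis using \<psi>f True \<phi>(2) f gi by simp
    next
      case False
      have "\<bar>\<phi> (fst (Q f))\<bar> \<le> (\<Sum>f\<in>F. \<bar>\<phi> (fst (Q f))\<bar>)" by (rule member_le_sum[OF f _ F(1)]) simp
      moreover have "fst (Q f) = g" using gi by (simp add: Qeq)
      ultimately have lt: "\<bar>\<phi> g\<bar> < c" unfolding c_def by simp
      have "1 \<le> \<bar>i\<bar>" using False by simp
      then have "c * 1 \<le> c * \<bar>i\<bar>" using lt by (intro mult_left_mono) simp_all
      also have "c * \<bar>i\<bar> = \<bar>c * i\<bar>" using lt by (simp add: abs_mult)
      finally show ?thesis using \<psi>f lt by linarith
    qed
  qed
  ultimately show ?thesis unfolding separated_def by blast
qed

text \<open>Generators are adjoined one at a time, each by one of the two extensions above.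
  Torsion-freeness ensures that m-th powers of non-identity elements are again different from
  \<open>\<one>\<close>.\<close>

lemma (in comm_group) separating_subgroup:
  assumes tf: "\<And>x (n::nat). x \<in> carrier G \<Longrightarrow> 0 < n \<Longrightarrow> x [^] n = \<one> \<Longrightarrow> x = \<one>"
    and fin: "finite A" and A: "A \<subseteq> carrier G"
  shows "\<exists>B. subgroup B G \<and> A \<subseteq> B \<and> (\<forall>F. finite F \<and> F \<subseteq> B \<and> \<one> \<notin> F \<longrightarrow> separated G B F)"
  using fin A
proof (induction A)
  case empty
  have "separated G {\<one>} F" if "F \<subseteq> {\<one>}" "\<one> \<notin> F" for F
  proof -
    have "F = {}" using that by blast
    then show ?thesis unfolding separated_def by (intro exI[of _ "\<lambda>_. 0"]) simp
  qed
  then show ?case using triv_subgroup by blast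
next
  case (insert s A)
  then obtain B where B: "subgroup B G" "A \<subseteq> B" and sep: "\<forall>F. finite F \<and> F \<subseteq> B \<and> \<one> \<notin> F \<longrightarrow> separated G B F"
    by blast
  have s: "s \<in> carrier G" using insert.prems by simp
  have cB: "g \<in> carrier G" if "g \<in> B" for g using subgroup.mem_carrier[OF B(1) that] .
  define B' where "B' = {g \<otimes> s [^] i | g i. g \<in> B \<and> (i::int) \<in> UNIV}"
  have I: "x \<in> B'" if "g \<in> B" "x = g \<otimes> s [^] (i::int)" for x g i unfolding B'_def using that by blast
  have E: "\<exists>g\<in>B. \<exists>i::int. x = g \<otimes> s [^] i" if "x \<in> B'" for x using that unfolding B'_def by blast
  have B'c: "B' \<subseteq> carrier G" using E cB s by fastforce
  have one: "\<one> \<in> B'" by (rule I[OF subgroup.one_closed[OF B(1)], of _ 0]) simp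
  have sub: "subgroup B' G"
  proof (rule subgroupI[OF B'c])
    show "B' \<noteq> {}" using one by blast
    fix a assume "a \<in> B'"
    then obtain g and i :: int where g: "g \<in> B" "a = g \<otimes> s [^] i" using E by blast
    show "inv a \<in> B'"
      by (rule I[OF subgroup.m_inv_closed[OF B(1) g(1)], of _ "- i"]) (use g cB s in \<open>simp add: inv_mult int_pow_neg\<close>)
    fix b assume "b \<in> B'"
    then obtain h and j :: int where h: "h \<in> B" "b = h \<otimes> s [^] j" using E by blast
    show "a \<otimes> b \<in> B'"
      by (rule I[OF subgroup.m_closed[OF B(1) g(1) h(1)], of _ "i + j"])
        (use g h cB s in \<open>simp add: int_pow_mult m_ac\<close>)
  qed
  have AB': "insert s A \<subseteq> B'"
  proof
    fix x assume x: "x \<in> insert s A"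
    show "x \<in> B'"
    proof (cases "x = s")
      case True
      then show ?thesis using I[OF subgroup.one_closed[OF B(1)], of x 1] s by simp
    next
      case False
      then have "x \<in> B" using x B(2) by blast
      then show ?thesis using I[of x x 0] cB by simp
    qed
  qed
  have "separated G B' F" if F: "finite F" "F \<subseteq> B'" "\<one> \<notin> F" for F
  proof (cases "\<exists>m::nat. 0 < m \<and> s [^] m \<in> B")
    case True
    then obtain m :: nat where m: "0 < m" "s [^] m \<in> B" by blast
    have pw: "x [^] m \<in> B" if x: "x \<in> B'" for x
    proof -
      obtain g and i :: int where g: "g \<in> B" "x = g \<otimes> s [^] i" using E[OF x] by blast
      have "(s [^] i) [^] m = (s [^] i) [^] int m" by (simp add: int_pow_int)
      also have "\<dots> = s [^] (int m * i)" using s by (simp add: int_pow_pow mult.commute)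
      also have "\<dots> = (s [^] int m) [^] i" using s by (simp add: int_pow_pow)
      also have "s [^] int m = s [^] m" by (simp add: int_pow_int)
      finally have "x [^] m = g [^] m \<otimes> (s [^] m) [^] i" using g cB s by (simp add: nat_pow_distrib)
      then show ?thesis using g(1) m(2) B(1)
        by (simp add: subgroup.m_closed subgroup_pow_closed subgroup_int_power_closed)
    qed
    have "\<one> \<notin> (\<lambda>x. x [^] m) ` F"
    proof
      assume "\<one> \<in> (\<lambda>x. x [^] m) ` F"
      then obtain f where f: "f \<in> F" "f [^] m = \<one>" by force
      then have "f = \<one>" using tf[OF _ m(1) f(2)] F(2) B'c by blast
      then show False using f(1) F(3) by simp
    qed
    moreover have "finite ((\<lambda>x. x [^] m) ` F)" using F(1) by simp
    moreover have "(\<lambda>x. x [^] m) ` F \<subseteq> B" using F(2) pw by blast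
    ultimately have sp: "separated G B ((\<lambda>x. x [^] m) ` F)" by (intro sep[rule_format] conjI)
    show ?thesis by (rule separated_power[OF B(1) B'c _ sp]) (rule pw)
  next
    case False
    have "separated G B (F \<inter> B)" by (rule sep[rule_format]) (use F in auto)
    then show ?thesis
    proof (rule separated_free[OF B(1) s _ _ F(1,2), rotated 2])
      show "s [^] m \<notin> B" if "0 < m" for m :: nat using False that by blast
    qed (rule E)
  qed
  then show ?case using sub AB' by blast
qed

section \<open>Transfer to torsion-free abelian groups\<close>

text \<open>The ratio has to be a difference \<open>c - b\<close> of members in order to be realised
  in the group. Two members in adjacent places provide it. If there are none, \<open>card A\<close>
  indices without neighbours among \<open>2 * card A - 1\<close> places must be the even ones, and
  the set is a progression with ratio \<open>2 * t\<close>.\<close>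

lemma short_cases:
  assumes fin: "finite A" and k: "2 \<le> card A" and sh: "short A"
  shows "biprog A \<or> (\<exists>a\<in>A. \<exists>b\<in>A. \<exists>c\<in>A. \<forall>x\<in>A. \<exists>i::nat. i \<le> 2 * card A - 2 \<and> x - a = int i * (c - b))"
proof -
  obtain u t where ut: "\<forall>x\<in>A. \<exists>i. 0 \<le> i \<and> i \<le> 2 * int (card A) - 2 \<and> x = u + i * t"
    using sh unfolding short_def by blast
  define I where "I = {i. 0 \<le> i \<and> i \<le> 2 * int (card A) - 2 \<and> u + i * t \<in> A}"
  have AI: "A = (\<lambda>i. u + i * t) ` I"
  proof
    show "A \<subseteq> (\<lambda>i. u + i * t) ` I"
    proof
      fix x assume x: "x \<in> A"
      then obtain i where i: "0 \<le> i" "i \<le> 2 * int (card A) - 2" "x = u + i * t" using ut by blast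
      then have "i \<in> I" unfolding I_def using x by simp
      then show "x \<in> (\<lambda>i. u + i * t) ` I" using i(3) by blast
    qed
    show "(\<lambda>i. u + i * t) ` I \<subseteq> A" unfolding I_def by blast
  qed
  have t0: "t \<noteq> 0"
  proof
    assume "t = 0"
    then have "A \<subseteq> {u}" using ut by auto
    then have "card A \<le> card {u}" by (rule card_mono[rotated]) simp
    then show False using k by simp
  qed
  have "inj_on (\<lambda>i. u + i * t) I" using t0 by (simp add: inj_on_def)
  then have cI: "card I = card A" using card_image AI by metis
  have "I \<subseteq> {0..2 * int (card A) - 2}" unfolding I_def by auto
  then have finI: "finite I" by (rule finite_subset) simp
  have neI: "I \<noteq> {}" using cI k by auto
  have rng: "0 \<le> i \<and> i \<le> 2 * int (card A) - 2 \<and> u + i * t \<in> A" if "i \<in> I" for i using that unfolding I_def by simp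
  show ?thesis
  proof (cases "\<exists>i. i \<in> I \<and> i + 1 \<in> I")
    case True
    then obtain i where i: "i \<in> I" "i + 1 \<in> I" by blast
    \<comment> \<open>Starting from the smallest occupied index makes all exponents natural
      numbers.\<close>
    have mn: "Min I \<in> I" "\<And>j. j \<in> I \<Longrightarrow> Min I \<le> j" using Min_in[OF finI neI] Min_le[OF finI] by blast+
    have "\<exists>j::nat. j \<le> 2 * card A - 2 \<and> x - (u + Min I * t) = int j * ((u + (i + 1) * t) - (u + i * t))"
      if xA: "x \<in> A" for x
    proof -
      from xA[unfolded AI] obtain j where j: "j \<in> I" "x = u + j * t" by blast
      have "nat (j - Min I) \<le> 2 * card A - 2" using rng[OF j(1)] rng[OF mn(1)] k by linarith
      moreover have "int (nat (j - Min I)) = j - Min I" using mn(2)[OF j(1)] by simp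
      then have "x - (u + Min I * t) = int (nat (j - Min I)) * ((u + (i + 1) * t) - (u + i * t))"
        unfolding j(2) by (simp only:) (simp add: algebra_simps)
      ultimately show ?thesis by blast
    qed
    moreover have "u + Min I * t \<in> A" "u + i * t \<in> A" "u + (i + 1) * t \<in> A" using rng mn(1) i by blast+
    ultimately show ?thesis by blast
  next
    case False
    let ?J = "(\<lambda>i. i + 1) ` I"
    have "card ?J = card A" using cI card_image[of "\<lambda>i. i + 1" I] by (simp add: inj_on_def)
    moreover have "I \<inter> ?J = {}" using False by blast
    ultimately have cJ: "card (I \<union> ?J) = 2 * card A" using card_Un_disjoint[of I ?J] finI cI by simp
    \<comment> \<open>Occupied places and their successors fill the whole interval, so a place with
      a vacant predecessor is occupied.\<close>
    have "I \<union> ?J \<subseteq> {0..2 * int (card A) - 1}" using rng by fastforce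
    moreover have "card {0..2 * int (card A) - 1} = 2 * card A" by simp
    ultimately have full: "I \<union> ?J = {0..2 * int (card A) - 1}"
      using cJ by (intro card_subset_eq) simp_all
    have step: "j \<in> I" if j: "0 \<le> j" "j \<le> 2 * int (card A) - 1" "j - 1 \<notin> I" for j
    proof -
      have "j \<in> I \<union> ?J" unfolding full using j by simp
      moreover have "j \<notin> ?J"
      proof
        assume "j \<in> ?J"
        then obtain i where "i \<in> I" "j = i + 1" by blast
        then show False using j(3) by simp
      qed
      ultimately show ?thesis by blast
    qed
    have ev: "j < card A \<longrightarrow> 2 * int j \<in> I" for j
    proof (induction j)
      case 0
      have "0 - 1 \<notin> I" using rng[of "0 - 1"] by auto
      then have "0 \<in> I" using k by (intro step) simp_all
      then show ?case by simp
    next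
      case (Suc j)
      show ?case
      proof
        assume j: "Suc j < card A"
        then have "2 * int j \<in> I" using Suc by simp
        then have "2 * int j + 1 \<notin> I" using False by blast
        moreover have "2 * int (Suc j) - 1 = 2 * int j + 1" by simp
        ultimately have "2 * int (Suc j) - 1 \<notin> I" by metis
        then show "2 * int (Suc j) \<in> I" using j by (intro step) simp_all
      qed
    qed
    let ?E = "(\<lambda>j. 2 * int j) ` {..<card A}"
    have "card ?E = card A" using card_image[of "\<lambda>j. 2 * int j" "{..<card A}"] by (simp add: inj_on_def)
    moreover have "?E \<subseteq> I" using ev by blast
    ultimately have IE: "I = ?E" using cI finI card_subset_eq[of I ?E] by simp
    have "A = (\<lambda>i. u + i * t) ` ?E" using AI unfolding IE .
    also have "\<dots> = prog (2 * t) u (card A)" unfolding prog_def image_image by (simp add: ac_simps)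
    finally have Ap: "A = prog (2 * t) u (card A)" .
    \<comment> \<open>Splitting off the last term supplies the second nonempty progression.\<close>
    obtain n where n: "card A = Suc n" "0 < n" by (rule that[of "card A - 1"]) (use k in simp_all)
    have "A = insert (u + int n * (2 * t)) (prog (2 * t) u n)" using Ap unfolding n(1) prog_Suc_last .
    then have "A = prog (2 * t) u n \<union> prog (2 * t) (u + int n * (2 * t)) (Suc 0)" unfolding prog_1 by blast
    then have "biprog A" by (rule biprogI_progs) (use n in simp_all)
    then show ?thesis by blast
  qed
qed

text \<open>Taking \<open>b\<close> from the two starting points means that \<open>u\<close>,
  \<open>v\<close> and \<open>c\<close> generate everything, which keeps the number of generators at
  3. If both progressions are single points only \<open>i = 0\<close> occurs, and
  \<open>b = c = u\<close> serves.\<close>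

lemma prog_pair_step:
  assumes "A = prog t u l \<union> prog t v m" "0 < l" "0 < m"
  shows "\<exists>b\<in>{u, v}. \<exists>c\<in>A. \<forall>i. i < l \<or> i < m \<longrightarrow> int i * (c - b) = int i * t"
proof -
  have step: "w + t \<in> prog t w n" if "1 < n" for w n
    unfolding prog_def using that by (intro image_eqI[of _ _ 1]) simp_all
  consider "1 < l" | "1 < m" | "l = 1" "m = 1" using assms(2,3) by linarith
  then show ?thesis
  proof cases
    case 1
    then have "u + t \<in> A" using step[of l u] assms(1) by simp
    moreover have "\<forall>i. i < l \<or> i < m \<longrightarrow> int i * ((u + t) - u) = int i * t" by simp
    ultimately show ?thesis by blast
  next
    case 2
    then have "v + t \<in> A" using step[of m v] assms(1) by simp
    moreover have "\<forall>i. i < l \<or> i < m \<longrightarrow> int i * ((v + t) - v) = int i * t" by simp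
    ultimately show ?thesis by blast
  next
    case 3
    have "u \<in> A" using prog_start[of l u t] assms by simp
    moreover have "\<forall>i. i < l \<or> i < m \<longrightarrow> int i * (u - u) = int i * t" using 3 by simp
    ultimately show ?thesis by blast
  qed
qed

text \<open>What has to be carried back from the integers is a family of relations s = a (b^-1 c)^i
  with \<open>i <= 2 * card S\<close>. They are finite in number, so one additive function that is
  nonzero on all failing ones reflects every relation.\<close>

lemma (in comm_group) small_square_structure:
  assumes tf: "\<And>x (n::nat). x \<in> carrier G \<Longrightarrow> 0 < n \<Longrightarrow> x [^] n = \<one> \<Longrightarrow> x = \<one>"
    and fin: "finite S" and S: "S \<subseteq> carrier G" and k2: "2 \<le> card S"
    and small: "card (S <#> S) + 3 \<le> 3 * card S"
  shows "(\<exists>T. T \<subseteq> S \<and> card T \<le> 3 \<and> S \<subseteq> generate G T) \<and> (card S \<noteq> 6 \<longrightarrow>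
    (\<exists>t P. geometric_progression G t (2 * card S - 1) P \<and> S \<subseteq> P) \<or>
    (\<exists>t l m P Q. geometric_progression G t l P \<and> geometric_progression G t m Q \<and> S = P \<union> Q \<and> l + m = card S))"
    (is "?gens \<and> (_ \<longrightarrow> ?one \<or> ?two)")
proof -
  have "\<exists>B. subgroup B G \<and> S \<subseteq> B \<and> (\<forall>F. finite F \<and> F \<subseteq> B \<and> \<one> \<notin> F \<longrightarrow> separated G B F)"
    by (rule separating_subgroup[OF _ fin S]) (rule tf)
  then obtain B where B: "subgroup B G" "S \<subseteq> B"
    and sep: "\<forall>F. finite F \<and> F \<subseteq> B \<and> \<one> \<notin> F \<longrightarrow> separated G B F" by blast
  \<comment> \<open>A word is the identity exactly when its relation holds; \<open>F\<close>
    collects the words that are not.\<close>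
  define word where "word s a b c i = s \<otimes> inv a \<otimes> inv ((inv b \<otimes> c) [^] i)" for s a b c and i :: nat
  define F where "F = (\<lambda>(s, a, b, c, i). word s a b c i) ` (S \<times> S \<times> S \<times> S \<times> {..2 * card S}) - {\<one>}"
  have wB: "word s a b c i \<in> B" if "s \<in> S" "a \<in> S" "b \<in> S" "c \<in> S" for s a b c i
    unfolding word_def using that B(2)
    by (auto intro!: subgroup.m_closed[OF B(1)] subgroup.m_inv_closed[OF B(1)] subgroup_pow_closed[OF B(1)])
  have "finite F" unfolding F_def using fin by simp
  moreover have "F \<subseteq> B" unfolding F_def using wB by auto
  moreover have "\<one> \<notin> F" unfolding F_def by simp
  ultimately have "separated G B F" using sep by blast
  then obtain \<phi> :: "'a \<Rightarrow> int" where add: "\<And>x y. x \<in> B \<Longrightarrow> y \<in> B \<Longrightarrow> \<phi> (x \<otimes> y) = \<phi> x + \<phi> y"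
    and nz: "\<forall>f\<in>F. \<phi> f \<noteq> 0" unfolding separated_def by blast
  have oneB: "\<one> \<in> B" and invB: "\<And>x. x \<in> B \<Longrightarrow> inv x \<in> B" and mB: "\<And>x y. x \<in> B \<Longrightarrow> y \<in> B \<Longrightarrow> x \<otimes> y \<in> B"
    using B(1) by (simp_all add: subgroup.one_closed subgroup.m_inv_closed subgroup.m_closed)
  have cB: "x \<in> carrier G" if "x \<in> B" for x using subgroup.mem_carrier[OF B(1) that] .
  have \<phi>1: "\<phi> \<one> = 0" using add[OF oneB oneB] by simp
  have \<phi>inv: "\<phi> (inv x) = - \<phi> x" if "x \<in> B" for x using add[OF that invB[OF that]] \<phi>1 cB[OF that] by simp
  have \<phi>pow: "\<phi> (x [^] i) = int i * \<phi> x" if x: "x \<in> B" for x and i :: nat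
    by (induction i) (simp_all add: \<phi>1 add subgroup_pow_closed[OF B(1) x] x algebra_simps)
  have key: "s = a \<otimes> (inv b \<otimes> c) [^] i"
    if sS: "s \<in> S" "a \<in> S" "b \<in> S" "c \<in> S" "i \<le> 2 * card S" "\<phi> s - \<phi> a = int i * (\<phi> c - \<phi> b)"
    for s a b c and i :: nat
  proof -
    have b: "s \<in> B" "a \<in> B" "b \<in> B" "c \<in> B" using sS B(2) by auto
    have q: "inv b \<otimes> c \<in> B" "inv a \<in> B" using b mB invB by simp_all
    note pB = subgroup_pow_closed[OF B(1) q(1), of i]
    have "\<phi> (word s a b c i) = \<phi> s - \<phi> a - int i * (\<phi> c - \<phi> b)"
      unfolding word_def using b q pB by (simp add: add mB invB \<phi>inv \<phi>pow)
    then have "\<phi> (word s a b c i) = 0" using sS by simp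
    then have "word s a b c i \<notin> F" using nz by blast
    moreover have "word s a b c i \<in> (\<lambda>(s, a, b, c, i). word s a b c i) ` (S \<times> S \<times> S \<times> S \<times> {..2 * card S})"
      using sS by (intro image_eqI[of _ _ "(s, a, b, c, i)"]) simp_all
    ultimately have "word s a b c i = \<one>" unfolding F_def by blast
    then have "s \<otimes> inv a = (inv b \<otimes> c) [^] i" unfolding word_def
      using cB b(1) q pB inv_solve_right'[of \<one> "s \<otimes> inv a" "(inv b \<otimes> c) [^] i"] by simp
    then have "s = (inv b \<otimes> c) [^] i \<otimes> a"
      using cB b pB inv_solve_right'[of "(inv b \<otimes> c) [^] i" s a] by simp
    then show ?thesis using cB b pB by (simp add: m_comm)
  qed
  \<comment> \<open>Exponent 0 in \<open>key\<close> turns equal values into equal elements, so the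
    image keeps its size while products can only merge.\<close>
  have inj: "inj_on \<phi> S"
  proof (rule inj_onI)
    fix x y assume "x \<in> S" "y \<in> S" "\<phi> x = \<phi> y"
    then have "x = y \<otimes> (inv x \<otimes> x) [^] (0::nat)" by (intro key) simp_all
    then show "x = y" using \<open>y \<in> S\<close> S by auto
  qed
  define A where "A = \<phi> ` S"
  have cA: "card A = card S" unfolding A_def by (rule card_image[OF inj])
  have finA: "finite A" unfolding A_def using fin by simp
  have finSS: "finite (S <#> S)" using fin by (simp add: set_mult_def)
  have "sums_of A \<subseteq> \<phi> ` (S <#> S)"
  proof
    fix z assume "z \<in> sums_of A"
    then obtain x y where xy: "x \<in> A" "y \<in> A" "z = x + y" by (rule sums_ofE)
    then obtain p q where pq: "p \<in> S" "q \<in> S" "z = \<phi> p + \<phi> q" unfolding A_def by blast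
    then have "z = \<phi> (p \<otimes> q)" using add B(2) by (simp add: subset_eq)
    moreover have "p \<otimes> q \<in> S <#> S" using pq unfolding set_mult_def by blast
    ultimately show "z \<in> \<phi> ` (S <#> S)" by blast
  qed
  then have "card (sums_of A) \<le> card (\<phi> ` (S <#> S))" by (rule card_mono[rotated]) (use finSS in simp)
  also have "\<dots> \<le> card (S <#> S)" by (rule card_image_le[OF finSS])
  finally have "card (sums_of A) + 3 \<le> 3 * card A" using small cA by simp
  then have str: "structured A" using small_sums_structured[OF finA] k2 cA by simp
  have preim: "\<exists>x. x \<in> S \<and> \<phi> x = z" if "z \<in> A" for z using that unfolding A_def by blast
  have inA: "\<phi> x \<in> A" if "x \<in> S" for x using that unfolding A_def by blast
  have genI: "x \<in> generate G T" if T: "T \<subseteq> S" and x: "x \<in> S" "a \<in> T" "b \<in> T" "c \<in> T" "i \<le> 2 * card S"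
      "\<phi> x - \<phi> a = int i * (\<phi> c - \<phi> b)" for x a b c T and i :: nat
  proof -
    have g: "subgroup (generate G T) G" using T S by (intro generate_is_subgroup) blast
    have "a \<in> generate G T" "b \<in> generate G T" "c \<in> generate G T" using x by (auto intro: generate.incl)
    then have "a \<otimes> (inv b \<otimes> c) [^] i \<in> generate G T"
      using g by (simp add: subgroup.m_closed subgroup.m_inv_closed subgroup_pow_closed)
    moreover have "x = a \<otimes> (inv b \<otimes> c) [^] i" by (rule key) (use x T in auto)
    ultimately show ?thesis by simp
  qed
  have gp: "geometric_progression G (inv b \<otimes> c) l ((\<lambda>i. a \<otimes> (inv b \<otimes> c) [^] i) ` {0..<l})"
    if "a \<in> S" "b \<in> S" "c \<in> S" "0 < l" for a b c l
    unfolding geometric_progression_def using that S by (auto intro!: bexI[of _ a] m_comm)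
  have card3: "card {x, y, z} \<le> 3" for x y z :: 'a by (simp add: card_insert_if)
  have bi: "?gens \<and> ?two" if bp: "biprog A"
  proof -
    obtain t u v l m where lm: "0 < l" "0 < m" "l + m = card A" and Ap: "A = prog t u l \<union> prog t v m"
      using bp unfolding biprog_def by blast
    have "u \<in> A" "v \<in> A" using prog_start lm unfolding Ap by auto
    then obtain su sv where su: "su \<in> S" "\<phi> su = u" and sv: "sv \<in> S" "\<phi> sv = v" using preim by blast
    obtain b0 c0 where bc0: "b0 \<in> {u, v}" "c0 \<in> A" "\<forall>i. i < l \<or> i < m \<longrightarrow> int i * (c0 - b0) = int i * t"
      using prog_pair_step[OF Ap lm(1,2)] by blast
    obtain c where c: "c \<in> S" "\<phi> c = c0" using preim bc0(2) by blast
    obtain b where b: "b \<in> {su, sv}" "\<phi> b = b0" using bc0(1) su sv by blast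
    have bS: "b \<in> S" using b su sv by blast
    have st: "int i * t = int i * (\<phi> c - \<phi> b)" if "i < l \<or> i < m" for i
      unfolding b(2) c(2) by (rule bc0(3)[rule_format, OF that, symmetric])
    let ?T = "{su, sv, c}"
    let ?P = "(\<lambda>i. su \<otimes> (inv b \<otimes> c) [^] i) ` {0..<l}" and ?Q = "(\<lambda>i. sv \<otimes> (inv b \<otimes> c) [^] i) ` {0..<m}"
    have lmk: "l \<le> 2 * card S" "m \<le> 2 * card S" using lm(3) cA by simp_all
    have split: "(\<exists>i<l. \<phi> x - \<phi> su = int i * (\<phi> c - \<phi> b)) \<or> (\<exists>i<m. \<phi> x - \<phi> sv = int i * (\<phi> c - \<phi> b))"
      if "x \<in> S" for x
    proof -
      have "\<phi> x \<in> prog t u l \<or> \<phi> x \<in> prog t v m" using inA[OF that] unfolding Ap by blast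
      then show ?thesis
      proof
        assume "\<phi> x \<in> prog t u l"
        then obtain i where "i < l" "\<phi> x = u + int i * t" unfolding prog_def by blast
        then have "i < l \<and> \<phi> x - \<phi> su = int i * (\<phi> c - \<phi> b)" using st su by simp
        then show ?thesis by blast
      next
        assume "\<phi> x \<in> prog t v m"
        then obtain i where "i < m" "\<phi> x = v + int i * t" unfolding prog_def by blast
        then have "i < m \<and> \<phi> x - \<phi> sv = int i * (\<phi> c - \<phi> b)" using st sv by simp
        then show ?thesis by blast
      qed
    qed
    have "S \<subseteq> generate G ?T"
    proof
      fix x assume x: "x \<in> S"
      have T: "?T \<subseteq> S" using su sv c by blast
      from split[OF x] show "x \<in> generate G ?T"
      proof
        assume "\<exists>i<l. \<phi> x - \<phi> su = int i * (\<phi> c - \<phi> b)"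
        then obtain i where "i < l" "\<phi> x - \<phi> su = int i * (\<phi> c - \<phi> b)" by blast
        then show ?thesis using b(1) lmk by (intro genI[OF T x, of su b c i]) auto
      next
        assume "\<exists>i<m. \<phi> x - \<phi> sv = int i * (\<phi> c - \<phi> b)"
        then obtain i where "i < m" "\<phi> x - \<phi> sv = int i * (\<phi> c - \<phi> b)" by blast
        then show ?thesis using b(1) lmk by (intro genI[OF T x, of sv b c i]) auto
      qed
    qed
    then have ?gens using su sv c card3[of su sv c] by (intro exI[of _ ?T]) simp
    moreover have "S = ?P \<union> ?Q"
    proof
      show "S \<subseteq> ?P \<union> ?Q"
      proof
        fix x assume x: "x \<in> S"
        from split[OF x] show "x \<in> ?P \<union> ?Q"
        proof
          assume "\<exists>i<l. \<phi> x - \<phi> su = int i * (\<phi> c - \<phi> b)"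
          then obtain i where i: "i < l" "\<phi> x - \<phi> su = int i * (\<phi> c - \<phi> b)" by blast
          then have "x = su \<otimes> (inv b \<otimes> c) [^] i" using lmk by (intro key[OF x su(1) bS c(1)]) simp_all
          then show ?thesis using i(1) by auto
        next
          assume "\<exists>i<m. \<phi> x - \<phi> sv = int i * (\<phi> c - \<phi> b)"
          then obtain i where i: "i < m" "\<phi> x - \<phi> sv = int i * (\<phi> c - \<phi> b)" by blast
          then have "x = sv \<otimes> (inv b \<otimes> c) [^] i" using lmk by (intro key[OF x sv(1) bS c(1)]) simp_all
          then show ?thesis using i(1) by auto
        qed
      qed
      \<comment> \<open>Each term of the group progressions has a counterpart in \<open>A\<close>,
        hence a preimage in \<open>S\<close>, and \<open>key\<close> identifies that preimage with
        the term.\<close>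
      show "?P \<union> ?Q \<subseteq> S"
      proof
        fix y assume "y \<in> ?P \<union> ?Q"
        then consider i where "i < l" "y = su \<otimes> (inv b \<otimes> c) [^] i" | i where "i < m" "y = sv \<otimes> (inv b \<otimes> c) [^] i"
          by auto
        then show "y \<in> S"
        proof cases
          case (1 i)
          then have "u + int i * t \<in> A" unfolding Ap prog_def by blast
          then obtain x where x: "x \<in> S" "\<phi> x = u + int i * t" using preim by blast
          have "x = su \<otimes> (inv b \<otimes> c) [^] i" using lmk 1(1) x(2) st[of i] su(2) by (intro key[OF x(1) su(1) bS c(1)]) simp_all
          then show ?thesis using x(1) 1(2) by simp
        next
          case (2 i)
          then have "v + int i * t \<in> A" unfolding Ap prog_def by blast
          then obtain x where x: "x \<in> S" "\<phi> x = v + int i * t" using preim by blast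
          have "x = sv \<otimes> (inv b \<otimes> c) [^] i" using lmk 2(1) x(2) st[of i] sv(2) by (intro key[OF x(1) sv(1) bS c(1)]) simp_all
          then show ?thesis using x(1) 2(2) by simp
        qed
      qed
    qed
    then have ?two using gp[OF su(1) bS c(1) lm(1)] gp[OF sv(1) bS c(1) lm(2)] lm(3) cA by metis
    ultimately show ?thesis by blast
  qed
  from str consider "short A" | "biprog A" | "triangle A" unfolding structured_def by blast
  then show ?thesis
  proof cases
    case 1
    from short_cases[OF finA _ 1] k2 cA consider "biprog A"
      | "\<exists>a\<in>A. \<exists>b\<in>A. \<exists>c\<in>A. \<forall>x\<in>A. \<exists>i::nat. i \<le> 2 * card A - 2 \<and> x - a = int i * (c - b)" by auto
    then show ?thesis
    proof cases
      case 1 then show ?thesis using bi by blast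
    next
      case 2
      then obtain a0 b0 c0 where m0: "a0 \<in> A" "b0 \<in> A" "c0 \<in> A"
        and all: "\<forall>x\<in>A. \<exists>i::nat. i \<le> 2 * card A - 2 \<and> x - a0 = int i * (c0 - b0)" by blast
      obtain a b c where s: "a \<in> S" "b \<in> S" "c \<in> S" and \<phi>s: "\<phi> a = a0" "\<phi> b = b0" "\<phi> c = c0"
        using preim m0 by metis
      have ex: "\<exists>i::nat. i \<le> 2 * card S - 2 \<and> \<phi> x - \<phi> a = int i * (\<phi> c - \<phi> b)" if "x \<in> S" for x
        using all inA[OF that] unfolding \<phi>s cA by blast
      have "S \<subseteq> generate G {a, b, c}"
      proof
        fix x assume x: "x \<in> S"
        obtain i :: nat where i: "i \<le> 2 * card S - 2" "\<phi> x - \<phi> a = int i * (\<phi> c - \<phi> b)" using ex[OF x] by blast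
        show "x \<in> generate G {a, b, c}" by (rule genI[OF _ x, of _ a b c i]) (use s i in auto)
      qed
      then have ?gens using s card3[of a b c] by (intro exI[of _ "{a, b, c}"]) simp
      moreover have "S \<subseteq> (\<lambda>i. a \<otimes> (inv b \<otimes> c) [^] i) ` {0..<2 * card S - 1}"
      proof
        fix x assume x: "x \<in> S"
        obtain i :: nat where i: "i \<le> 2 * card S - 2" "\<phi> x - \<phi> a = int i * (\<phi> c - \<phi> b)" using ex[OF x] by blast
        have "x = a \<otimes> (inv b \<otimes> c) [^] i" by (rule key) (use s i x in auto)
        moreover have "i \<in> {0..<2 * card S - 1}" using i(1) k2 by simp
        ultimately show "x \<in> (\<lambda>i. a \<otimes> (inv b \<otimes> c) [^] i) ` {0..<2 * card S - 1}" by blast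
      qed
      moreover have "geometric_progression G (inv b \<otimes> c) (2 * card S - 1)
          ((\<lambda>i. a \<otimes> (inv b \<otimes> c) [^] i) ` {0..<2 * card S - 1})"
        using k2 by (intro gp s) simp
      ultimately show ?thesis by blast
    qed
  next
    case 2 then show ?thesis using bi by blast
  next
    case 3
    then obtain u p q where A3: "A = {u, u + p, u + q, u + 2 * p, u + p + q, u + 2 * q}" and c6: "card A = 6"
      unfolding triangle_def by blast
    have "u \<in> A" "u + p \<in> A" "u + q \<in> A" unfolding A3 by simp_all
    then obtain a b c where s: "a \<in> S" "b \<in> S" "c \<in> S" and \<phi>s: "\<phi> a = u" "\<phi> b = u + p" "\<phi> c = u + q"
      using preim by metis
    \<comment> \<open>A corner and its two neighbours generate: the remaining points are b (a^-1 b),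
      b (a^-1 c) and c (a^-1 c).\<close>
    have "S \<subseteq> generate G {a, b, c}"
    proof
      fix x assume x: "x \<in> S"
      have T: "{a, b, c} \<subseteq> S" using s by blast
      note gI = genI[OF T x]
      have "\<phi> x = u \<or> \<phi> x = u + p \<or> \<phi> x = u + q \<or> \<phi> x = u + 2 * p \<or> \<phi> x = u + p + q \<or> \<phi> x = u + 2 * q"
        using inA[OF x] unfolding A3 by blast
      then show "x \<in> generate G {a, b, c}"
      proof (elim disjE)
        assume e: "\<phi> x = u"
        show ?thesis by (rule gI[of a a a 0]) (use e \<phi>s k2 in simp_all)
      next
        assume e: "\<phi> x = u + p"
        show ?thesis by (rule gI[of b a a 0]) (use e \<phi>s k2 in simp_all)
      next
        assume e: "\<phi> x = u + q"
        show ?thesis by (rule gI[of c a a 0]) (use e \<phi>s k2 in simp_all)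
      next
        assume e: "\<phi> x = u + 2 * p"
        show ?thesis by (rule gI[of b a b 1]) (use e \<phi>s k2 in simp_all)
      next
        assume e: "\<phi> x = u + p + q"
        show ?thesis by (rule gI[of b a c 1]) (use e \<phi>s k2 in simp_all)
      next
        assume e: "\<phi> x = u + 2 * q"
        show ?thesis by (rule gI[of c a c 1]) (use e \<phi>s k2 in simp_all)
      qed
    qed
    then have ?gens using s card3[of a b c] by (intro exI[of _ "{a, b, c}"]) simp
    then show ?thesis using c6 cA by simp
  qed
qed

theorem theorem2p1:
  fixes G :: "('a, 'b) monoid_scheme" and S :: "'a set"
  assumes "orderable_group G"
    and "S \<subseteq> carrier G"
    and "finite S"
    and "int (card (S <#>\<^bsub>G\<^esub> S)) \<le> 3 * int (card S) - 3"
  shows "comm_group (G\<lparr>carrier := generate G S\<rparr>) \<and>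
    (\<exists>T. T \<subseteq> carrier G \<and> finite T \<and> card T \<le> 3 \<and> generate G T = generate G S) \<and>
    (card S \<ge> 11 \<longrightarrow>
      (\<exists>t l P. geometric_progression G t l P \<and> l \<le> 2 * card S - 1 \<and> S \<subseteq> P) \<or>
      (\<exists>t l\<^sub>1 l\<^sub>2 P\<^sub>1 P\<^sub>2. geometric_progression G t l\<^sub>1 P\<^sub>1 \<and> geometric_progression G t l\<^sub>2 P\<^sub>2 \<and>
        S = P\<^sub>1 \<union> P\<^sub>2 \<and> l\<^sub>1 + l\<^sub>2 = card S))"
proof -
  interpret group G using assms(1) unfolding orderable_group_def by blast
  obtain r where r: "linear_order_on (carrier G) r"
    and mono: "\<forall>a\<in>carrier G. \<forall>b\<in>carrier G. \<forall>x\<in>carrier G. \<forall>y\<in>carrier G.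
        (a, b) \<in> r \<longrightarrow> (x \<otimes>\<^bsub>G\<^esub> a \<otimes>\<^bsub>G\<^esub> y, x \<otimes>\<^bsub>G\<^esub> b \<otimes>\<^bsub>G\<^esub> y) \<in> r"
    using assms(1) unfolding orderable_group_def by blast
  have ord: "trans r" "antisym r" "total_on (carrier G) r"
    using r unfolding linear_order_on_def partial_order_on_def preorder_on_def by blast+
  define lt where "lt x y \<longleftrightarrow> (x, y) \<in> r \<and> x \<noteq> y" for x y
  interpret ordered_group G lt
  proof unfold_locales
    show "\<not> lt x x" for x unfolding lt_def by simp
    show "lt x z" if "lt x y" "lt y z" for x y z
      using that transD[OF ord(1)] antisymD[OF ord(2)] unfolding lt_def by blast
    show "lt x y \<or> lt y x" if "x \<in> carrier G" "y \<in> carrier G" "x \<noteq> y" for x y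
      using that ord(3) unfolding lt_def total_on_def by blast
    fix x y z assume xyz: "lt x y" "x \<in> carrier G" "y \<in> carrier G" "z \<in> carrier G"
    have "(z \<otimes>\<^bsub>G\<^esub> x \<otimes>\<^bsub>G\<^esub> \<one>\<^bsub>G\<^esub>, z \<otimes>\<^bsub>G\<^esub> y \<otimes>\<^bsub>G\<^esub> \<one>\<^bsub>G\<^esub>) \<in> r" "(\<one>\<^bsub>G\<^esub> \<otimes>\<^bsub>G\<^esub> x \<otimes>\<^bsub>G\<^esub> z, \<one>\<^bsub>G\<^esub> \<otimes>\<^bsub>G\<^esub> y \<otimes>\<^bsub>G\<^esub> z) \<in> r"
      using mono xyz one_closed unfolding lt_def by blast+
    then show "lt (z \<otimes>\<^bsub>G\<^esub> x) (z \<otimes>\<^bsub>G\<^esub> y)" "lt (x \<otimes>\<^bsub>G\<^esub> z) (y \<otimes>\<^bsub>G\<^esub> z)"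
      using xyz unfolding lt_def by simp_all
  qed
  \<comment> \<open>For the empty set the bound, taken over the integers, would read 0 <= -3. The
    lower bound 2|S| - 1 on the number of products then gives |S| >= 2.\<close>
  have "S \<noteq> {}" using assms(4) by auto
  then have ge: "2 * card S \<le> card (S <#>\<^bsub>G\<^esub> S) + 1" using card_square_ge[OF assms(3,2)] by blast
  then have k2: "2 \<le> card S" and small: "card (S <#>\<^bsub>G\<^esub> S) + 3 \<le> 3 * card S" using assms(4) by linarith+
  have comm: "comm_group (G\<lparr>carrier := generate G S\<rparr>)"
    using small_square_commutes[OF assms(3,2)] small by (intro comm_group_generate[OF assms(2)]) blast
  \<comment> \<open>The structure result needs a commutative group, so it is applied inside the
    generated subgroup and its conclusions are translated back to \<open>G\<close>.\<close>
  define K where "K = G\<lparr>carrier := generate G S\<rparr>"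
  interpret K: comm_group K using comm unfolding K_def .
  have incl: "generate G S \<subseteq> carrier G" by (rule generate_incl[OF assms(2)])
  have cK: "carrier K = generate G S" and mK: "\<And>x y. x \<otimes>\<^bsub>K\<^esub> y = x \<otimes>\<^bsub>G\<^esub> y" and oK: "\<one>\<^bsub>K\<^esub> = \<one>\<^bsub>G\<^esub>"
    and pK: "\<And>x (n::nat). x [^]\<^bsub>K\<^esub> n = x [^]\<^bsub>G\<^esub> n" and sK: "S <#>\<^bsub>K\<^esub> S = S <#>\<^bsub>G\<^esub> S"
    unfolding K_def by (simp_all add: nat_pow_consistent[symmetric] set_mult_def)
  have tf: "x = \<one>\<^bsub>K\<^esub>" if "x \<in> carrier K" "0 < n" "x [^]\<^bsub>K\<^esub> n = \<one>\<^bsub>K\<^esub>" for x and n :: nat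
    using that incl torsion_free[of x n] unfolding cK pK oK by blast
  have SK: "S \<subseteq> carrier K" unfolding cK by (auto intro: generate.incl)
  have gpK: "geometric_progression G t l P" if "geometric_progression K t l P" for t l P
    using that incl unfolding geometric_progression_def cK mK pK by blast
  have struct: "(\<exists>T. T \<subseteq> S \<and> card T \<le> 3 \<and> S \<subseteq> generate K T) \<and> (card S \<noteq> 6 \<longrightarrow>
    (\<exists>t P. geometric_progression K t (2 * card S - 1) P \<and> S \<subseteq> P) \<or>
    (\<exists>t l m P Q. geometric_progression K t l P \<and> geometric_progression K t m Q \<and> S = P \<union> Q \<and> l + m = card S))"
    by (rule K.small_square_structure[OF _ assms(3) SK k2]) (use tf small sK in auto)
  obtain T where T: "T \<subseteq> S" "card T \<le> 3" "S \<subseteq> generate K T" using struct by blast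
  have Tc: "T \<subseteq> carrier G" using T(1) assms(2) by blast
  have "generate K T = generate G T" unfolding K_def
    using T(1) by (intro generate_consistent generate_is_subgroup[OF assms(2)]) (auto intro: generate.incl)
  then have "generate G S \<subseteq> generate G T"
    using T(3) generate_is_subgroup[OF Tc] by (intro generate_subgroup_incl) simp_all
  moreover have "generate G T \<subseteq> generate G S" by (rule mono_generate[OF T(1)])
  moreover have "finite T" using T(1) assms(3) by (rule finite_subset)
  ultimately have gens: "\<exists>T. T \<subseteq> carrier G \<and> finite T \<and> card T \<le> 3 \<and> generate G T = generate G S"
    using T(2) Tc by blast
  have "(\<exists>t l P. geometric_progression G t l P \<and> l \<le> 2 * card S - 1 \<and> S \<subseteq> P) \<or>
      (\<exists>t l\<^sub>1 l\<^sub>2 P\<^sub>1 P\<^sub>2. geometric_progression G t l\<^sub>1 P\<^sub>1 \<and> geometric_progression G t l\<^sub>2 P\<^sub>2 \<and>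
        S = P\<^sub>1 \<union> P\<^sub>2 \<and> l\<^sub>1 + l\<^sub>2 = card S)" if "11 \<le> card S"
  proof -
    from that have "card S \<noteq> 6" by simp
    with struct consider t P where "geometric_progression K t (2 * card S - 1) P" "S \<subseteq> P"
      | t l m P Q where "geometric_progression K t l P" "geometric_progression K t m Q" "S = P \<union> Q" "l + m = card S"
      by blast
    then show ?thesis
    proof cases
      case 1 then show ?thesis using gpK by blast
    next
      case 2 then show ?thesis using gpK by blast
    qed
  qed
  then show ?thesis using comm gens by blast
qed

end
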